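(* There is an assignment $\mathcal{Q}\mapsto \operatorname{ns}(\mathcal{Q})$ which associates to every monoidal complex $\mathcal{Q}$ a smooth refinement $\operatorname{ns}(\mathcal{Q})\to\mathcal{Q}$, such that: (i) if $\mathcal{Q}$ is smooth then $\operatorname{ns}(\mathcal{Q})=\mathcal{Q}$ (with the identity morphism); (ii) if $\mathcal{Q}_0\subset\mathcal{Q}$ is a subcomplex, then the subcomplex of $\operatorname{ns}(\mathcal{Q})$ consisting of those monoids which are mapped into monoids of $\mathcal{Q}_0$ equals $\operatorname{ns}(\mathcal{Q}_0)$.
   Context: "Monoid" means toric monoid: $\sigma=N_\sigma\cap C$ with $N_\sigma$ a lattice and $C=\operatorname{supp}(\sigma)$ a proper rational convex polyhedral cone spanning $N_\sigma\otimes\mathbb{R}$; faces $\tau\le\sigma$ are submonoids with $v,w\in\sigma$, $v+w\in\tau\Rightarrow v,w\in\tau$; $\sigma$ is smooth if freely generated by its extremals (minimal lattice generators of extreme rays). A monoidal complex $\mathcal{Q}$ over a finite poset $(A,\le)$ assigns a monoid $\sigma_a$ to each $a\in A$ and, for $a\le b$, an injective homomorphism $i_{ab}:\sigma_a\to\sigma_b$ which is an isomorphism onto a face of $\sigma_b$, with $i_{aa}=\mathrm{id}$, $i_{bc}i_{ab}=i_{ac}$; complexes are assumed complete and reduced: for every $b$ and every face $\tau\le\sigma_b$ there is exactly one $a\le b$ with $i_{ab}(\sigma_a)=\tau$. $\mathcal{Q}$ is smooth if all $\sigma_a$ are. A morphism $\phi:\mathcal{Q}\to\mathcal{Q}'$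 ($\mathcal{Q}'$ over $B$) is an order-preserving $\phi_\#:A\to B$ with homomorphisms $\phi_a:\sigma_a\to\sigma'_{\phi_\#(a)}$ commuting with face maps. A subcomplex is the restriction of $\mathcal{Q}$ to a subset $A_0\subset A$ which is itself complete and reduced. A refinement is a morphism $\phi:\mathcal{R}\to\mathcal{Q}$ with all $\phi_a$ injective such that, for each $\sigma_b\in\mathcal{Q}$, the cones $\phi_a(\operatorname{supp}\sigma_a)$, $a\in\phi_\#^{-1}(b)$, have union $\operatorname{supp}(\sigma_b)$ and pairwise disjoint relative interiors. *)

theory Defs
  imports Complex_Main
begin

(* Lattice vectors are functions nat => int; a vector "lives in Z^d" if it vanishes from index d on.
   Real vectors likewise are functions nat => real. *)

type_synonym zv = "nat \<Rightarrow> int"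
type_synonym rv = "nat \<Rightarrow> real"

definition zvec :: "nat \<Rightarrow> zv \<Rightarrow> bool" where
  "zvec d v \<longleftrightarrow> (\<forall>i\<ge>d. v i = 0)"

definition rvec :: "nat \<Rightarrow> rv \<Rightarrow> bool" where
  "rvec d x \<longleftrightarrow> (\<forall>i\<ge>d. x i = 0)"

definition vadd :: "zv \<Rightarrow> zv \<Rightarrow> zv" where
  "vadd v w = (\<lambda>i. v i + w i)"

definition rof :: "zv \<Rightarrow> rv" where
  "rof v = (\<lambda>i. of_int (v i))"

definition conehull :: "zv set \<Rightarrow> rv set" where
  "conehull S = {x. \<exists>G c. finite G \<and> G \<subseteq> S \<and> (\<forall>g\<in>G. 0 \<le> c g) \<and>
                        x = (\<lambda>i. \<Sum>g\<in>G. c g * of_int (g i))}"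

definition supp :: "zv set \<Rightarrow> rv set" where
  "supp \<sigma> = conehull \<sigma>"

definition toric_monoid :: "zv set \<Rightarrow> bool" where
  "toric_monoid \<sigma> \<longleftrightarrow> (\<exists>d G. finite G \<and> (\<forall>g\<in>G. zvec d g) \<and>
      \<sigma> = {v. zvec d v \<and> rof v \<in> conehull G} \<and>
      (\<forall>x. rvec d x \<longrightarrow> (\<exists>y\<in>conehull G. \<exists>z\<in>conehull G. x = (\<lambda>i. y i - z i))) \<and>
      (\<forall>x. x \<in> conehull G \<and> (\<lambda>i. - x i) \<in> conehull G \<longrightarrow> x = (\<lambda>i. 0)))"

definition mface :: "zv set \<Rightarrow> zv set \<Rightarrow> bool" where
  "mface \<tau> \<sigma> \<longleftrightarrow> \<tau> \<subseteq> \<sigma> \<and> (\<lambda>i. 0) \<in> \<tau> \<and> (\<forall>x\<in>\<tau>. \<forall>y\<in>\<tau>. vadd x y \<in> \<tau>) \<and>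
      (\<forall>v\<in>\<sigma>. \<forall>w\<in>\<sigma>. vadd v w \<in> \<tau> \<longrightarrow> v \<in> \<tau> \<and> w \<in> \<tau>)"

definition mhom :: "(zv \<Rightarrow> zv) \<Rightarrow> zv set \<Rightarrow> zv set \<Rightarrow> bool" where
  "mhom f \<sigma> \<tau> \<longleftrightarrow> (\<forall>x\<in>\<sigma>. f x \<in> \<tau>) \<and> f (\<lambda>i. 0) = (\<lambda>i. 0) \<and>
      (\<forall>x\<in>\<sigma>. \<forall>y\<in>\<sigma>. f (vadd x y) = vadd (f x) (f y))"

definition face_emb :: "(zv \<Rightarrow> zv) \<Rightarrow> zv set \<Rightarrow> zv set \<Rightarrow> bool" where
  "face_emb f \<sigma> \<tau> \<longleftrightarrow> mhom f \<sigma> \<tau> \<and> inj_on f \<sigma> \<and> mface (f ` \<sigma>) \<tau>"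

definition ray :: "zv \<Rightarrow> rv set" where
  "ray e = {x. \<exists>t\<ge>0. x = (\<lambda>i. t * of_int (e i))}"

definition extremal :: "zv set \<Rightarrow> zv \<Rightarrow> bool" where
  "extremal \<sigma> e \<longleftrightarrow> e \<in> \<sigma> \<and> e \<noteq> (\<lambda>i. 0) \<and>
      (\<forall>x\<in>supp \<sigma>. \<forall>y\<in>supp \<sigma>. (\<lambda>i. x i + y i) \<in> ray e \<longrightarrow> x \<in> ray e \<and> y \<in> ray e) \<and>
      (\<forall>e'\<in>\<sigma>. \<forall>k::nat. e = (\<lambda>i. int k * e' i) \<longrightarrow> k = 1)"

definition smooth :: "zv set \<Rightarrow> bool" where
  "smooth \<sigma> \<longleftrightarrow> finite {e. extremal \<sigma> e} \<and>
     (\<forall>v\<in>\<sigma>. \<exists>!c::zv \<Rightarrow> nat. (\<forall>e. \<not> extremal \<sigma> e \<longrightarrow> c e = 0) \<and>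
                v = (\<lambda>i. \<Sum>e\<in>{e. extremal \<sigma> e}. int (c e) * e i))"

(* relative interior of a convex set (line-segment extension characterisation) *)
definition relint :: "rv set \<Rightarrow> rv set" where
  "relint C = {x\<in>C. \<forall>y\<in>C. \<exists>\<epsilon>>0. (\<lambda>i. x i + \<epsilon> * (x i - y i)) \<in> C}"

record 'a mcomplex =
  idx  :: "'a set"
  le   :: "'a \<Rightarrow> 'a \<Rightarrow> bool"
  mon  :: "'a \<Rightarrow> zv set"
  fmap :: "'a \<Rightarrow> 'a \<Rightarrow> zv \<Rightarrow> zv"

(* complete and reduced monoidal complex over a finite poset *)
definition monoidal_complex :: "'a mcomplex \<Rightarrow> bool" where
  "monoidal_complex Q \<longleftrightarrow>
     finite (idx Q) \<and>
     (\<forall>a\<in>idx Q. le Q a a) \<and>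
     (\<forall>a\<in>idx Q. \<forall>b\<in>idx Q. le Q a b \<and> le Q b a \<longrightarrow> a = b) \<and>
     (\<forall>a\<in>idx Q. \<forall>b\<in>idx Q. \<forall>c\<in>idx Q. le Q a b \<and> le Q b c \<longrightarrow> le Q a c) \<and>
     (\<forall>a\<in>idx Q. toric_monoid (mon Q a)) \<and>
     (\<forall>a\<in>idx Q. \<forall>b\<in>idx Q. le Q a b \<longrightarrow> face_emb (fmap Q a b) (mon Q a) (mon Q b)) \<and>
     (\<forall>a\<in>idx Q. \<forall>x\<in>mon Q a. fmap Q a a x = x) \<and>
     (\<forall>a\<in>idx Q. \<forall>b\<in>idx Q. \<forall>c\<in>idx Q. le Q a b \<and> le Q b c \<longrightarrow>
         (\<forall>x\<in>mon Q a. fmap Q b c (fmap Q a b x) = fmap Q a c x)) \<and>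
     (\<forall>b\<in>idx Q. \<forall>\<tau>. mface \<tau> (mon Q b) \<longrightarrow>
         (\<exists>!a. a \<in> idx Q \<and> le Q a b \<and> fmap Q a b ` mon Q a = \<tau>))"

definition smooth_complex :: "'a mcomplex \<Rightarrow> bool" where
  "smooth_complex Q \<longleftrightarrow> (\<forall>a\<in>idx Q. smooth (mon Q a))"

definition restr :: "'a mcomplex \<Rightarrow> 'a set \<Rightarrow> 'a mcomplex" where
  "restr Q A0 = Q\<lparr>idx := A0\<rparr>"

definition subcomplex :: "'a mcomplex \<Rightarrow> 'a set \<Rightarrow> bool" where
  "subcomplex Q A0 \<longleftrightarrow> A0 \<subseteq> idx Q \<and> monoidal_complex (restr Q A0)"

definition morphism :: "'b mcomplex \<Rightarrow> 'a mcomplex \<Rightarrow> ('b \<Rightarrow> 'a) \<Rightarrow> ('b \<Rightarrow> zv \<Rightarrow> zv) \<Rightarrow> bool" where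
  "morphism R Q f fm \<longleftrightarrow>
     (\<forall>a\<in>idx R. f a \<in> idx Q) \<and>
     (\<forall>a\<in>idx R. \<forall>b\<in>idx R. le R a b \<longrightarrow> le Q (f a) (f b)) \<and>
     (\<forall>a\<in>idx R. mhom (fm a) (mon R a) (mon Q (f a))) \<and>
     (\<forall>a\<in>idx R. \<forall>b\<in>idx R. le R a b \<longrightarrow>
        (\<forall>x\<in>mon R a. fm b (fmap R a b x) = fmap Q (f a) (f b) (fm a x)))"

definition complex_iso :: "'b mcomplex \<Rightarrow> 'a mcomplex \<Rightarrow> ('b \<Rightarrow> 'a) \<Rightarrow> ('b \<Rightarrow> zv \<Rightarrow> zv) \<Rightarrow> bool" where
  "complex_iso R Q f fm \<longleftrightarrow> morphism R Q f fm \<and> bij_betw f (idx R) (idx Q) \<and>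
     (\<forall>a\<in>idx R. \<forall>b\<in>idx R. le Q (f a) (f b) \<longrightarrow> le R a b) \<and>
     (\<forall>a\<in>idx R. bij_betw (fm a) (mon R a) (mon Q (f a)))"

definition refinement :: "'b mcomplex \<Rightarrow> 'a mcomplex \<Rightarrow> ('b \<Rightarrow> 'a) \<Rightarrow> ('b \<Rightarrow> zv \<Rightarrow> zv) \<Rightarrow> bool" where
  "refinement R Q f fm \<longleftrightarrow> morphism R Q f fm \<and>
     (\<forall>a\<in>idx R. inj_on (fm a) (mon R a)) \<and>
     (\<forall>b\<in>idx Q. (\<Union>a\<in>{a\<in>idx R. f a = b}. conehull (fm a ` mon R a)) = supp (mon Q b)) \<and>
     (\<forall>b\<in>idx Q. \<forall>a\<in>{a\<in>idx R. f a = b}. \<forall>a'\<in>{a\<in>idx R. f a = b}. a \<noteq> a' \<longrightarrow>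
         relint (conehull (fm a ` mon R a)) \<inter> relint (conehull (fm a' ` mon R a')) = {})"

end

(* A refinement need not preserve lattices: the monoid of a cell may be any monoid spanning the right
   cone. Hence a simplicial cone needs no subdivision at all, one takes the free monoid on the
   generators of its rays, and it suffices to subdivide into simplicial cones in a way that depends
   only on the faces. This is barycentric subdivision restricted to the non-simplicial faces: a cell is
   spanned by the rays of a simplicial face a and by interior lattice points of the members of a
   chain S of non-simplicial faces above a. A point of a non-simplicial cone is moved away from the
   interior point until it meets a proper face; induction gives that the cells cover and that the
   representation with positive coefficients is unique. Smooth cones are simplicial with their rays
   as basis, so nothing changes there, and everything depends only on the faces below a given index,
   so the construction commutes with restriction to subcomplexes. *)

theory Submission
  imports Defs
begin

section \<open>Finitely generated cones\<close>

text \<open>There is no common ambient space: a face and the monoid above it are related only by a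
  monoid homomorphism between possibly different lattices. Completeness and reducedness supply the
  substitute. Every face of a monoid has exactly one index below it, so a point chosen once per
  index is automatically compatible with all face maps, and the vertices of a cell can be compared
  inside the monoid of its top. Independence of vertices and uniqueness of cells both rest on one
  absorption principle: if a point of the cone over a face stays in the big cone after subtracting a
  positive multiple of a lattice point, then this lattice point belongs to the face. Interior points
  are accordingly characterised by lying in no proper face, without any topology. The index type of
  the refinement is fixed to be \<open>nat\<close>, so the cells are renamed at the end, and the
  equality asserted for subcomplexes becomes an isomorphism compatible with the maps to the original
  complex.\<close>

lemma conehull_sum:
  assumes "finite V" "\<And>v. v \<in> V \<Longrightarrow> u v \<in> S" "\<And>v. v \<in> V \<Longrightarrow> 0 \<le> c v"
  shows "(\<lambda>i. \<Sum>v\<in>V. c v * of_int (u v i)) \<in> conehull S"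
proof -
  \<comment> \<open>Distinct indices may name the same vector, so coefficients are added up over the
    fibres of \<open>u\<close>.\<close>
  define c' where "c' g = (\<Sum>v\<in>{v\<in>V. u v = g}. c v)" for g
  have "(\<Sum>v\<in>V. c v * of_int (u v i)) = (\<Sum>g\<in>u ` V. c' g * of_int (g i))" for i
    unfolding c'_def sum_distrib_right
    by (subst sum.image_gen[OF assms(1), of _ u]) (auto intro!: sum.cong)
  moreover have "\<forall>g\<in>u ` V. 0 \<le> c' g"
    unfolding c'_def using assms(3) by (auto intro!: sum_nonneg)
  ultimately show ?thesis
    unfolding conehull_def using assms(1,2) by (blast intro: finite_imageI)
qed

lemma conehull_zero: "(\<lambda>i. 0) \<in> conehull S"
  using conehull_sum[of "{}" "\<lambda>v. v" S "\<lambda>_. 0"] by simp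

lemma conehull_base: "g \<in> S \<Longrightarrow> rof g \<in> conehull S"
  using conehull_sum[of "{g}" "\<lambda>v. v" S "\<lambda>_. 1"] by (simp add: rof_def)

lemma conehull_add:
  assumes "x \<in> conehull S" "y \<in> conehull S"
  shows "(\<lambda>i. x i + y i) \<in> conehull S"
proof -
  obtain G c where G: "finite G" "G \<subseteq> S" "\<forall>g\<in>G. 0 \<le> c g" "x = (\<lambda>i. \<Sum>g\<in>G. c g * of_int (g i))"
    using assms(1) unfolding conehull_def by auto
  obtain H e where H: "finite H" "H \<subseteq> S" "\<forall>g\<in>H. 0 \<le> e g" "y = (\<lambda>i. \<Sum>g\<in>H. e g * of_int (g i))"
    using assms(2) unfolding conehull_def by auto
  have "(\<lambda>i. \<Sum>v\<in>G <+> H. case_sum c e v * of_int (case_sum id id v i)) \<in> conehull S"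
    using G H by (intro conehull_sum) auto
  then show ?thesis
    using G H by (simp add: sum.Plus)
qed

lemma conehull_scale:
  assumes "x \<in> conehull S" "0 \<le> t"
  shows "(\<lambda>i. t * x i) \<in> conehull S"
proof -
  obtain G c where G: "finite G" "G \<subseteq> S" "\<forall>g\<in>G. 0 \<le> c g" "x = (\<lambda>i. \<Sum>g\<in>G. c g * of_int (g i))"
    using assms(1) unfolding conehull_def by auto
  have "(\<lambda>i. \<Sum>v\<in>G. (t * c v) * of_int (v i)) \<in> conehull S"
    using G assms(2) by (intro conehull_sum) auto
  then show ?thesis
    using G by (simp add: sum_distrib_left mult.assoc)
qed

lemma conehull_induct [consumes 1, case_names zero step]:
  assumes "x \<in> conehull S"
    and zero: "P (\<lambda>i. 0)"
    and step: "\<And>g c y. g \<in> S \<Longrightarrow> 0 \<le> c \<Longrightarrow> y \<in> conehull S \<Longrightarrow> P y \<Longrightarrow> P (\<lambda>i. c * of_int (g i) + y i)"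
  shows "P x"
proof -
  obtain G c where G: "finite G" "G \<subseteq> S" "\<forall>g\<in>G. 0 \<le> c g" "x = (\<lambda>i. \<Sum>g\<in>G. c g * of_int (g i))"
    using assms(1) unfolding conehull_def by auto
  have "P (\<lambda>i. \<Sum>g\<in>G. c g * of_int (g i))"
    using G(1-3)
  proof (induction rule: finite_induct)
    case empty
    then show ?case using zero by simp
  next
    case (insert g F)
    have "(\<lambda>i. \<Sum>g\<in>F. c g * of_int (g i)) \<in> conehull S"
      using insert by (intro conehull_sum) auto
    then show ?case
      using insert step[of g "c g"] by simp
  qed
  then show ?thesis using G by simp
qed

lemma conehull_subset:
  assumes "\<And>g. g \<in> S \<Longrightarrow> rof g \<in> conehull T"
  shows "conehull S \<subseteq> conehull T"
proof
  fix x assume "x \<in> conehull S"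
  then show "x \<in> conehull T"
  proof (induction rule: conehull_induct)
    case zero
    show ?case by (rule conehull_zero)
  next
    case (step g c y)
    then show ?case
      using conehull_add[OF conehull_scale[OF assms]] by (simp add: rof_def)
  qed
qed

lemma conehull_mono: "S \<subseteq> T \<Longrightarrow> conehull S \<subseteq> conehull T"
  by (rule conehull_subset) (auto intro: conehull_base)

lemma conehull_image:
  assumes "finite V"
  shows "x \<in> conehull (u ` V) \<longleftrightarrow>
    (\<exists>c. (\<forall>v\<in>V. 0 \<le> c v) \<and> x = (\<lambda>i. \<Sum>v\<in>V. c v * of_int (u v i)))"
proof
  assume "x \<in> conehull (u ` V)"
  then show "\<exists>c. (\<forall>v\<in>V. 0 \<le> c v) \<and> x = (\<lambda>i. \<Sum>v\<in>V. c v * of_int (u v i))"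
  proof (induction rule: conehull_induct)
    case zero
    show ?case by (rule exI[of _ "\<lambda>_. 0"]) simp
  next
    case (step g c y)
    then obtain w e where w: "w \<in> V" "g = u w" and
      e: "\<forall>v\<in>V. 0 \<le> e v" "y = (\<lambda>i. \<Sum>v\<in>V. e v * of_int (u v i))" by auto
    have "(\<Sum>v\<in>V. (e v + (if v = w then c else 0)) * of_int (u v i)) =
        c * of_int (u w i) + (\<Sum>v\<in>V. e v * of_int (u v i))" for i
      using w assms by (simp add: distrib_right sum.distrib if_distrib[of "\<lambda>z. z * _"] cong: if_cong)
    then show ?case
      using w e step(2) by (intro exI[of _ "\<lambda>v. e v + (if v = w then c else 0)"]) auto
  qed
qed (use assms in \<open>auto intro: conehull_sum\<close>)

text \<open>Isolates the coefficient of one generator; the existential over \<open>t\<close> is what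
  elimination turns into inequalities.\<close>

lemma conehull_insert:
  "x \<in> conehull (insert g G) \<longleftrightarrow> (\<exists>t\<ge>0. (\<lambda>i. x i - t * of_int (g i)) \<in> conehull G)"
proof
  assume "x \<in> conehull (insert g G)"
  then show "\<exists>t\<ge>0. (\<lambda>i. x i - t * of_int (g i)) \<in> conehull G"
  proof (induction rule: conehull_induct)
    case zero
    show ?case by (rule exI[of _ 0]) (simp add: conehull_zero)
  next
    case (step h c y)
    then obtain t where t: "t \<ge> 0" "(\<lambda>i. y i - t * of_int (g i)) \<in> conehull G" by auto
    show ?case
    proof (cases "h = g")
      case True
      then show ?thesis using t step by (intro exI[of _ "t + c"]) (simp add: algebra_simps)
    next
      case False
      then show ?thesis
        using t step conehull_add[OF t(2) conehull_scale[OF conehull_base[of h G], of c]]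
        by (intro exI[of _ t]) (simp add: algebra_simps rof_def)
    qed
  qed
next
  assume "\<exists>t\<ge>0. (\<lambda>i. x i - t * of_int (g i)) \<in> conehull G"
  then obtain t where t: "t \<ge> 0" "(\<lambda>i. x i - t * of_int (g i)) \<in> conehull G" by auto
  have "(\<lambda>i. x i - t * of_int (g i)) \<in> conehull (insert g G)"
    using t conehull_mono[of G "insert g G"] by blast
  from conehull_add[OF this conehull_scale[OF conehull_base[of g] t(1)]]
  show "x \<in> conehull (insert g G)" by (simp add: rof_def)
qed

section \<open>Halfspaces, and leaving a pointed cone along a direction\<close>

definition linfun :: "(rv \<Rightarrow> real) \<Rightarrow> bool" where
  "linfun h \<longleftrightarrow> (\<forall>x y. h (\<lambda>i. x i + y i) = h x + h y) \<and> (\<forall>c x. h (\<lambda>i. c * x i) = c * h x)"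

lemma linfun_add: "linfun h \<Longrightarrow> h (\<lambda>i. x i + y i) = h x + h y"
  unfolding linfun_def by (elim conjE allE)

lemma linfun_scale: "linfun h \<Longrightarrow> h (\<lambda>i. c * x i) = c * h x"
  unfolding linfun_def by (elim conjE allE)

lemma linfun_diff: "linfun h \<Longrightarrow> h (\<lambda>i. x i - t * y i) = h x - t * h y"
  using linfun_add[of h x "\<lambda>i. (-t) * y i"] linfun_scale[of h "-t" y] by simp

lemma rvec_rof: "zvec d g \<Longrightarrow> rvec d (rof g)"
  by (simp add: zvec_def rvec_def rof_def)

lemma conehull_rvec:
  assumes "x \<in> conehull G" "\<And>g. g \<in> G \<Longrightarrow> zvec d g"
  shows "rvec d x"
  using assms(1) by (induction rule: conehull_induct) (use assms(2) in \<open>auto simp: rvec_def zvec_def\<close>)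

lemma interval_nonempty:
  fixes L U :: "real set"
  assumes "finite L" "finite U" "\<And>l u. l \<in> L \<Longrightarrow> u \<in> U \<Longrightarrow> l \<le> u" "\<And>u. u \<in> U \<Longrightarrow> 0 \<le> u"
  shows "\<exists>t\<ge>0. (\<forall>l\<in>L. l \<le> t) \<and> (\<forall>u\<in>U. t \<le> u)"
  using assms by (intro exI[of _ "Max (insert 0 L)"]) auto

text \<open>Fourier--Motzkin elimination of the coefficient of one generator at a time.\<close>

lemma conehull_halfspaces:
  assumes "finite G" "\<And>g. g \<in> G \<Longrightarrow> zvec d g"
  shows "\<exists>H. finite H \<and> (\<forall>h\<in>H. linfun h) \<and>
    (\<forall>x. rvec d x \<longrightarrow> (x \<in> conehull G \<longleftrightarrow> (\<forall>h\<in>H. 0 \<le> h x)))"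
  using assms
proof (induction rule: finite_induct)
  case empty
  \<comment> \<open>Without generators the cone is the origin of \<open>d\<close>-dimensional space,
    cut out by both signs of each coordinate.\<close>
  let ?H = "(\<lambda>i x. x i) ` {..<d} \<union> (\<lambda>i x. - x i) ` {..<d}"
  have "x \<in> conehull {} \<longleftrightarrow> (\<forall>h\<in>?H. 0 \<le> h x)" if x: "rvec d x" for x
  proof
    assume "x \<in> conehull {}"
    then have "x = (\<lambda>i. 0)" by (induction rule: conehull_induct) auto
    then show "\<forall>h\<in>?H. 0 \<le> h x" by auto
  next
    assume h: "\<forall>h\<in>?H. 0 \<le> h x"
    have "x i = 0" for i
    proof (cases "i < d")
      case True
      have "0 \<le> x i" using bspec[OF h, of "\<lambda>x. x i"] True by auto
      moreover have "0 \<le> - x i" using bspec[OF h, of "\<lambda>x. - x i"] True by auto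
      ultimately show ?thesis by simp
    qed (use x in \<open>auto simp: rvec_def\<close>)
    then have "x = (\<lambda>i. 0)" by auto
    then show "x \<in> conehull {}" by (simp add: conehull_zero)
  qed
  then show ?case by (intro exI[of _ ?H]) (auto simp: linfun_def)
next
  case (insert g G)
  then obtain H where H: "finite H" "\<And>h. h \<in> H \<Longrightarrow> linfun h"
    "\<And>x. rvec d x \<Longrightarrow> x \<in> conehull G \<longleftrightarrow> (\<forall>h\<in>H. 0 \<le> h x)" by auto
  let ?g = "rof g"
  define P where "P = {h\<in>H. h ?g > 0}"
  define N where "N = {h\<in>H. h ?g < 0}"
  define Z where "Z = {h\<in>H. h ?g \<ge> 0}"
  \<comment> \<open>For the coefficient \<open>t >= 0\<close> of \<open>g\<close>, a functional
    positive on \<open>g\<close> bounds \<open>t\<close> from above and one negative on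
    \<open>g\<close> bounds it from below. Keeping \<open>Z\<close> says that the upper bounds are
    nonnegative and covers the functionals vanishing on \<open>g\<close>. The mixed functionals,
    which vanish on \<open>g\<close>, say that each lower bound is at most each upper bound.\<close>
  define K where "K = Z \<union> (\<lambda>(p, n) x. p x * (- n ?g) + n x * p ?g) ` (P \<times> N)"
  have fin: "finite P" "finite N" "finite Z" using H by (auto simp: P_def N_def Z_def)
  have "linfun k" if "k \<in> K" for k
  proof -
    consider "k \<in> Z" | p n where "p \<in> P" "n \<in> N" "k = (\<lambda>x. p x * (- n ?g) + n x * p ?g)"
      using \<open>k \<in> K\<close> unfolding K_def by auto
    then show ?thesis
    proof cases
      case 1
      then show ?thesis using H(2) by (simp add: Z_def)
    next
      case 2
      then have lf: "linfun p" "linfun n" using H(2) by (auto simp: P_def N_def)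
      show ?thesis
        unfolding linfun_def 2(3) linfun_add[OF lf(1)] linfun_add[OF lf(2)]
          linfun_scale[OF lf(1)] linfun_scale[OF lf(2)]
        by (simp only: distrib_right distrib_left add_ac mult_ac simp_thms)
    qed
  qed
  moreover have "x \<in> conehull (insert g G) \<longleftrightarrow> (\<forall>k\<in>K. 0 \<le> k x)" if x: "rvec d x" for x
  proof -
    have rv: "rvec d (\<lambda>i. x i - t * of_int (g i))" for t
      using x insert.prems by (auto simp: rvec_def zvec_def)
    have h: "h (\<lambda>i. x i - t * of_int (g i)) = h x - t * h ?g" if "h \<in> H" for h t
      using linfun_diff[OF H(2)[OF that], of x t ?g] by (simp add: rof_def)
    have eq: "x \<in> conehull (insert g G) \<longleftrightarrow> (\<exists>t\<ge>0. \<forall>h\<in>H. t * h ?g \<le> h x)"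
      unfolding conehull_insert H(3)[OF rv]
      by (simp only: h diff_ge_0_iff_ge cong: ball_cong)
    show ?thesis
    proof
      assume "x \<in> conehull (insert g G)"
      then obtain t where t: "t \<ge> 0" "\<And>h. h \<in> H \<Longrightarrow> t * h ?g \<le> h x" using eq by auto
      show "\<forall>k\<in>K. 0 \<le> k x"
      proof
        fix k assume "k \<in> K"
        then consider "k \<in> Z" | p n where "p \<in> P" "n \<in> N" "k = (\<lambda>x. p x * (- n ?g) + n x * p ?g)"
          unfolding K_def by auto
        then show "0 \<le> k x"
        proof cases
          case 1
          then show ?thesis using order_trans[OF mult_nonneg_nonneg[of t "k ?g"] t(2)[of k]] t(1)
            by (simp add: Z_def)
        next
          case 2
          have a: "(t * p ?g) * (- n ?g) \<le> p x * (- n ?g)"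
            using 2 t(2)[of p] by (intro mult_right_mono) (auto simp: P_def N_def)
          have b: "(t * n ?g) * p ?g \<le> n x * p ?g"
            using 2 t(2)[of n] by (intro mult_right_mono) (auto simp: P_def N_def)
          show ?thesis using add_mono[OF a b] 2 by (simp add: algebra_simps)
        qed
      qed
    next
      assume k: "\<forall>k\<in>K. 0 \<le> k x"
      have "\<exists>t\<ge>0. (\<forall>l\<in>(\<lambda>n. n x / n ?g) ` N. l \<le> t) \<and> (\<forall>u\<in>(\<lambda>p. p x / p ?g) ` P. t \<le> u)"
      proof (rule interval_nonempty)
        fix l u assume "l \<in> (\<lambda>n. n x / n ?g) ` N" "u \<in> (\<lambda>p. p x / p ?g) ` P"
        then obtain n p where np: "n \<in> N" "p \<in> P" "l = n x / n ?g" "u = p x / p ?g" by auto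
        then have "(\<lambda>x. p x * (- n ?g) + n x * p ?g) \<in> K" unfolding K_def by force
        then have "0 \<le> p x * (- n ?g) + n x * p ?g" using k by auto
        moreover have pos: "0 < - n ?g" "0 < p ?g" using np by (auto simp: P_def N_def)
        ultimately have "- n x \<le> (p x * (- n ?g)) / p ?g"
          by (simp add: pos_le_divide_eq pos_divide_le_eq)
        then have "(- n x) / (- n ?g) \<le> p x / p ?g"
          using pos(1) by (intro mult_imp_div_pos_le) auto
        then show "l \<le> u" using np by simp
      next
        fix u assume "u \<in> (\<lambda>p. p x / p ?g) ` P"
        then show "0 \<le> u" using k by (auto simp: K_def Z_def P_def)
      qed (use fin in auto)
      then obtain t where t: "t \<ge> 0" "\<And>n. n \<in> N \<Longrightarrow> n x / n ?g \<le> t" "\<And>p. p \<in> P \<Longrightarrow> t \<le> p x / p ?g"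
        by auto
      have "t * h ?g \<le> h x" if "h \<in> H" for h
      proof -
        consider "h ?g > 0" | "h ?g < 0" | "h ?g = 0" by linarith
        then show ?thesis
        proof cases
          case 1
          then show ?thesis using t(3)[of h] that by (auto simp: P_def field_simps)
        next
          case 2
          then show ?thesis using t(2)[of h] that by (auto simp: N_def field_simps)
        next
          case 3
          then show ?thesis using k that by (auto simp: K_def Z_def)
        qed
      qed
      then show "x \<in> conehull (insert g G)" using eq t(1) by auto
    qed
  qed
  ultimately show ?case using fin by (intro exI[of _ K]) (auto simp: K_def)
qed

text \<open>Among the defining functionals positive on \<open>w\<close>, the smallest ratio
  \<open>h x / h w\<close> is the exit parameter. Pointedness ensures that there is such a
  functional: otherwise \<open>- w\<close> would satisfy all inequalities as well.\<close>

lemma conehull_exit: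
  assumes "finite G" "\<And>g. g \<in> G \<Longrightarrow> zvec d g"
    and pointed: "\<And>x. x \<in> conehull G \<Longrightarrow> (\<lambda>i. - x i) \<in> conehull G \<Longrightarrow> x = (\<lambda>i. 0)"
    and x: "x \<in> conehull G" and w: "w \<in> conehull G" "w \<noteq> (\<lambda>i. 0)"
  shows "\<exists>t\<ge>0. (\<lambda>i. x i - t * w i) \<in> conehull G \<and> (\<forall>s>t. (\<lambda>i. x i - s * w i) \<notin> conehull G)"
proof -
  obtain H where H: "finite H" "\<And>h. h \<in> H \<Longrightarrow> linfun h"
    "\<And>x. rvec d x \<Longrightarrow> x \<in> conehull G \<longleftrightarrow> (\<forall>h\<in>H. 0 \<le> h x)"
    using conehull_halfspaces[OF assms(1,2)] by metis
  have rx: "rvec d x" and rw: "rvec d w" using x w conehull_rvec assms(2) by blast+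
  then have rv: "rvec d (\<lambda>i. x i - t * w i)" for t by (simp add: rvec_def)
  have hw: "0 \<le> h w" and hx: "0 \<le> h x" if "h \<in> H" for h
    using that H(3)[OF rw] H(3)[OF rx] x w by auto
  define P where "P = {h\<in>H. h w > 0}"
  have "P \<noteq> {}"
  proof
    assume "P = {}"
    then have z: "h w = 0" if "h \<in> H" for h using hw[OF that] that by (force simp: P_def)
    \<comment> \<open>Here \<open>- w\<close> is obtained as \<open>w - 2 * w\<close>, so that
      \<open>linfun_diff\<close> applies.\<close>
    have "h (\<lambda>i. - w i) = 0" if "h \<in> H" for h
      using z[OF that] linfun_diff[OF H(2)[OF that], of w 2 w] by (simp add: algebra_simps)
    moreover have "rvec d (\<lambda>i. - w i)" using rw by (simp add: rvec_def)
    ultimately have "(\<lambda>i. - w i) \<in> conehull G" using H(3) by (metis order_refl)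
    then show False using pointed w by blast
  qed
  have "finite P" using H by (simp add: P_def)
  define t where "t = Min ((\<lambda>h. h x / h w) ` P)"
  have tle: "t \<le> h x / h w" if "h \<in> P" for h
    unfolding t_def using that \<open>finite P\<close> by (intro Min_le) auto
  have "t \<in> (\<lambda>h. h x / h w) ` P" unfolding t_def using \<open>finite P\<close> \<open>P \<noteq> {}\<close> by (intro Min_in) auto
  then obtain h0 where h0: "h0 \<in> P" "t = h0 x / h0 w" by auto
  have iff: "(\<lambda>i. x i - s * w i) \<in> conehull G \<longleftrightarrow> (\<forall>h\<in>H. s * h w \<le> h x)" for s
    unfolding H(3)[OF rv]
    by (rule ball_cong[OF refl]) (simp only: linfun_diff[OF H(2)] diff_ge_0_iff_ge)
  have "t * h w \<le> h x" if "h \<in> H" for h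
  proof (cases "h \<in> P")
    case True
    then show ?thesis using tle[OF True] by (auto simp: P_def field_simps)
  next
    case False
    then have "h w = 0" using hw[OF that] that by (auto simp: P_def)
    then show ?thesis using hx[OF that] by simp
  qed
  moreover have "h0 x < s * h0 w" if "s > t" for s
    using that h0 by (auto simp: P_def field_simps)
  moreover have "t \<ge> 0" using h0 hx by (auto simp: P_def)
  ultimately show ?thesis
    using iff h0(1) by (intro exI[of _ t]) (auto simp: P_def not_le)
qed

section \<open>From integral to real linear relations\<close>

lemma rat_functional:
  fixes x :: real
  assumes "x \<noteq> 0"
  obtains l :: "real \<Rightarrow> rat" where "\<And>a b. l (a + b) = l a + l b"
    "\<And>q a. l (of_rat q * a) = q * l a" "l x \<noteq> 0"
proof -
  interpret vs: vector_space_pair "\<lambda>q (r::real). of_rat q * r" "\<lambda>q (r::rat). q * r"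
    by unfold_locales (auto simp: algebra_simps of_rat_add of_rat_mult)
  have "\<not> vs.vs1.dependent {x}"
    using assms by (simp add: vs.vs1.dependent_single)
  \<comment> \<open>Viewing \<open>real\<close> as a vector space over \<open>rat\<close>, the
    nonzero \<open>x\<close> is part of a basis, so some rational linear functional takes the value
    1 there.\<close>
  then obtain l where l: "Vector_Spaces.linear (\<lambda>q (r::real). of_rat q * r) (\<lambda>q (r::rat). q * r) l"
    "\<forall>y\<in>{x}. l y = 1"
    using vs.linear_independent_extend[of "{x}" "\<lambda>_. 1"] by blast
  show ?thesis
    by (rule that[of l]) (use l vs.linear_add vs.linear_scale in auto)
qed

lemma clear_denominators:
  fixes q :: "'b \<Rightarrow> rat"
  assumes "finite V"
  obtains N :: int and n :: "'b \<Rightarrow> int" where "N > 0" "\<And>v. v \<in> V \<Longrightarrow> of_int N * q v = of_int (n v)"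
proof -
  have "\<exists>N>0. \<exists>n. \<forall>v\<in>V. of_int N * q v = of_int (n v)"
    using assms
  proof (induction rule: finite_induct)
    case empty
    show ?case by (rule exI[of _ 1]) simp
  next
    case (insert w V)
    then obtain N n where N: "N > 0" "\<forall>v\<in>V. of_int N * q v = of_int (n v)" by auto
    obtain a b where ab: "b > 0" "q w = of_int a / of_int b"
      by (metis quotient_of_denom_pos quotient_of_div surj_pair)
    have "of_int (N * b) * q v = of_int (if v = w then N * a else b * n v)" if "v \<in> insert w V" for v
      using that N ab by (auto simp: mult.commute mult.left_commute)
    then show ?case using N ab by (intro exI[of _ "N * b"]) (auto intro!: exI[of _ "\<lambda>v. if v = w then N * a else b * n v"])
  qed
  then show ?thesis using that by blast
qed

text \<open>Testing a real relation against \<open>\<rat>\<close>-linear functionals \<open>\<real> \<rightarrow> \<rat>\<close> turns it into rational,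
  hence integral, relations.\<close>

lemma real_relation:
  fixes g h :: "'b \<Rightarrow> zv"
  assumes fin: "finite V"
    and int_rel: "\<And>n :: 'b \<Rightarrow> int. (\<And>i. (\<Sum>v\<in>V. n v * g v i) = 0) \<Longrightarrow> (\<And>i. (\<Sum>v\<in>V. n v * h v i) = 0)"
    and rel: "\<And>i. (\<Sum>v\<in>V. (c v :: real) * of_int (g v i)) = 0"
  shows "(\<Sum>v\<in>V. c v * of_int (h v i)) = 0"
proof (rule ccontr)
  assume "(\<Sum>v\<in>V. c v * of_int (h v i)) \<noteq> 0"
  then obtain l :: "real \<Rightarrow> rat" where l: "\<And>a b. l (a + b) = l a + l b"
    "\<And>q a. l (of_rat q * a) = q * l a" "l (\<Sum>v\<in>V. c v * of_int (h v i)) \<noteq> 0"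
    using rat_functional by blast
  have l0: "l 0 = 0" using l(2)[of 0 0] by simp
  have ls: "l (\<Sum>v\<in>W. f v) = (\<Sum>v\<in>W. l (f v))" if "finite W" for f and W :: "'b set"
    using that by (induction rule: finite_induct) (auto simp: l0 l)
  have li: "l (c v * of_int k) = l (c v) * of_int k" for v k
    using l(2)[of "of_int k" "c v"] by (simp add: mult.commute)
  have sum_l: "l (\<Sum>v\<in>V. c v * of_int (k v)) = (\<Sum>v\<in>V. l (c v) * of_int (k v))" for k
    by (simp add: ls[OF fin] li)
  obtain N n where N: "N > 0" "\<And>v. v \<in> V \<Longrightarrow> of_int N * l (c v) = of_int (n v)"
    using clear_denominators[OF fin, of "\<lambda>v. l (c v)"] by metis
  \<comment> \<open>The common denominator \<open>N\<close> turns the rational coefficients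
    \<open>l (c v)\<close> into the integers \<open>n v\<close>. The given relation thus becomes an
    integral one for \<open>g\<close>, and \<open>int_rel\<close> then contradicts the choice of
    \<open>l\<close>.\<close>
  have scaled: "of_int (\<Sum>v\<in>V. n v * k v) = of_int N * l (\<Sum>v\<in>V. c v * of_int (k v))" for k
    unfolding sum_l sum_distrib_left of_int_sum
    by (rule sum.cong) (auto simp: N(2)[symmetric] mult.assoc)
  have "(\<Sum>v\<in>V. n v * g v j) = 0" for j
    using scaled[of "\<lambda>v. g v j"] unfolding rel l0 mult_zero_right of_int_eq_0_iff .
  then have "(\<Sum>v\<in>V. n v * h v i) = 0" by (rule int_rel)
  then show False using scaled[of "\<lambda>v. h v i"] l(3) N(1) by simp
qed

section \<open>Toric monoids and their faces\<close>

definition submonoid :: "zv set \<Rightarrow> bool" where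
  "submonoid M \<longleftrightarrow> (\<lambda>i. 0) \<in> M \<and> (\<forall>x\<in>M. \<forall>y\<in>M. vadd x y \<in> M)"

lemma submonoid_scale:
  assumes "submonoid M" "v \<in> M"
  shows "(\<lambda>i. int n * v i) \<in> M"
proof (induction n)
  case 0
  then show ?case using assms by (simp add: submonoid_def)
next
  case (Suc n)
  then have "vadd v (\<lambda>i. int n * v i) \<in> M" using assms by (simp add: submonoid_def)
  then show ?case by (simp add: vadd_def algebra_simps)
qed

lemma submonoid_sum:
  assumes "submonoid M" "finite V" "\<And>v. v \<in> V \<Longrightarrow> u v \<in> M"
  shows "(\<lambda>i. \<Sum>v\<in>V. int (n v) * u v i) \<in> M"
  using assms(2,3)
proof (induction rule: finite_induct)
  case empty
  then show ?case using assms(1) by (simp add: submonoid_def)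
next
  case (insert w V)
  then have "vadd (\<lambda>i. int (n w) * u w i) (\<lambda>i. \<Sum>v\<in>V. int (n v) * u v i) \<in> M"
    using assms(1) submonoid_scale[OF assms(1), of "u w" "n w"] by (simp add: submonoid_def)
  then show ?case using insert by (simp add: vadd_def)
qed

lemma mface_submonoid: "mface \<tau> \<sigma> \<Longrightarrow> submonoid \<tau>"
  by (simp add: mface_def submonoid_def)

lemma mhom_add: "mhom f \<sigma> \<tau> \<Longrightarrow> x \<in> \<sigma> \<Longrightarrow> y \<in> \<sigma> \<Longrightarrow> f (vadd x y) = vadd (f x) (f y)"
  by (simp add: mhom_def)

lemma mhom_scale:
  assumes "mhom f \<sigma> \<tau>" "submonoid \<sigma>" "v \<in> \<sigma>"
  shows "f (\<lambda>i. int n * v i) = (\<lambda>i. int n * f v i)"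
proof (induction n)
  case 0
  then show ?case using assms by (simp add: mhom_def)
next
  case (Suc n)
  have "f (\<lambda>i. int (Suc n) * v i) = f (vadd v (\<lambda>i. int n * v i))"
    by (simp add: vadd_def algebra_simps)
  also have "\<dots> = vadd (f v) (f (\<lambda>i. int n * v i))"
    using assms submonoid_scale[OF assms(2,3)] by (simp add: mhom_def)
  finally show ?case using Suc by (simp add: vadd_def algebra_simps)
qed

lemma mhom_sum:
  assumes "mhom f \<sigma> \<tau>" "submonoid \<sigma>" "finite V" "\<And>v. v \<in> V \<Longrightarrow> u v \<in> \<sigma>"
  shows "f (\<lambda>i. \<Sum>v\<in>V. int (n v) * u v i) = (\<lambda>i. \<Sum>v\<in>V. int (n v) * f (u v) i)"
  using assms(3,4)
proof (induction rule: finite_induct)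
  case empty
  then show ?case using assms(1) by (simp add: mhom_def)
next
  case (insert w V)
  have "f (\<lambda>i. \<Sum>v\<in>insert w V. int (n v) * u v i)
      = f (vadd (\<lambda>i. int (n w) * u w i) (\<lambda>i. \<Sum>v\<in>V. int (n v) * u v i))"
    using insert by (simp add: vadd_def)
  also have "\<dots> = vadd (f (\<lambda>i. int (n w) * u w i)) (f (\<lambda>i. \<Sum>v\<in>V. int (n v) * u v i))"
    using insert
    by (intro mhom_add[OF assms(1)] submonoid_scale[OF assms(2)] submonoid_sum[OF assms(2)]) auto
  finally show ?case
    using insert mhom_scale[OF assms(1,2)] by (simp add: vadd_def)
qed

text \<open>Monoid homomorphisms see only nonnegative combinations. Splitting the coefficients into
  positive and negative parts turns a relation into an equation between two such
  combinations.\<close>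

lemma sum_int_eq_iff:
  "(\<Sum>v\<in>V. n v * (u v :: int)) = 0 \<longleftrightarrow>
    (\<Sum>v\<in>V. int (nat (n v)) * u v) = (\<Sum>v\<in>V. int (nat (- n v)) * u v)"
proof -
  have "(\<Sum>v\<in>V. n v * u v) = (\<Sum>v\<in>V. int (nat (n v)) * u v) - (\<Sum>v\<in>V. int (nat (- n v)) * u v)"
    by (subst sum_subtractf[symmetric], rule sum.cong) (auto simp: left_diff_distrib[symmetric])
  then show ?thesis by simp
qed

lemma mhom_int_relation:
  assumes "mhom f \<sigma> \<tau>" "submonoid \<sigma>" "finite V" "\<And>v. v \<in> V \<Longrightarrow> u v \<in> \<sigma>"
    and "\<And>i. (\<Sum>v\<in>V. n v * u v i) = 0"
  shows "(\<Sum>v\<in>V. n v * f (u v) i) = 0"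
proof -
  have "(\<lambda>i. \<Sum>v\<in>V. int (nat (n v)) * u v i) = (\<lambda>i. \<Sum>v\<in>V. int (nat (- n v)) * u v i)"
    by (rule ext, rule sum_int_eq_iff[THEN iffD1], rule assms(5))
  from arg_cong[OF this, of f]
  have "(\<lambda>i. \<Sum>v\<in>V. int (nat (n v)) * f (u v) i) = (\<lambda>i. \<Sum>v\<in>V. int (nat (- n v)) * f (u v) i)"
    by (simp only: mhom_sum[OF assms(1-4)])
  from fun_cong[OF this, of i] show ?thesis by (rule sum_int_eq_iff[THEN iffD2])
qed

lemma mhom_inj_int_relation:
  assumes "mhom f \<sigma> \<tau>" "inj_on f \<sigma>" "submonoid \<sigma>" "finite V" "\<And>v. v \<in> V \<Longrightarrow> u v \<in> \<sigma>"
    and "\<And>i. (\<Sum>v\<in>V. n v * f (u v) i) = 0"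
  shows "(\<Sum>v\<in>V. n v * u v i) = 0"
proof -
  have "(\<lambda>i. \<Sum>v\<in>V. int (nat (n v)) * f (u v) i) = (\<lambda>i. \<Sum>v\<in>V. int (nat (- n v)) * f (u v) i)"
    by (rule ext, rule sum_int_eq_iff[THEN iffD1], rule assms(6))
  then have "f (\<lambda>i. \<Sum>v\<in>V. int (nat (n v)) * u v i) = f (\<lambda>i. \<Sum>v\<in>V. int (nat (- n v)) * u v i)"
    by (simp only: mhom_sum[OF assms(1,3-5)])
  then have "(\<lambda>i. \<Sum>v\<in>V. int (nat (n v)) * u v i) = (\<lambda>i. \<Sum>v\<in>V. int (nat (- n v)) * u v i)"
    by (rule inj_onD[OF assms(2) _ submonoid_sum[OF assms(3-5)] submonoid_sum[OF assms(3-5)]])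
  from fun_cong[OF this, of i] show ?thesis by (rule sum_int_eq_iff[THEN iffD2])
qed

lemma mhom_real_relation:
  assumes "mhom f \<sigma> \<tau>" "submonoid \<sigma>" "finite V" "\<And>v. v \<in> V \<Longrightarrow> u v \<in> \<sigma>"
    and "\<And>i. (\<Sum>v\<in>V. (c v :: real) * of_int (u v i)) = 0"
  shows "(\<Sum>v\<in>V. c v * of_int (f (u v) i)) = 0"
  by (rule real_relation[where g = u]) (use assms mhom_int_relation[OF assms(1-4)] in auto)

lemma mhom_inj_real_relation:
  assumes "mhom f \<sigma> \<tau>" "inj_on f \<sigma>" "submonoid \<sigma>" "finite V" "\<And>v. v \<in> V \<Longrightarrow> u v \<in> \<sigma>"
    and "\<And>i. (\<Sum>v\<in>V. (c v :: real) * of_int (f (u v) i)) = 0"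
  shows "(\<Sum>v\<in>V. c v * of_int (u v i)) = 0"
  by (rule real_relation[where g = "\<lambda>v. f (u v)"]) (use assms mhom_inj_int_relation[OF assms(1-5)] in auto)

text \<open>This replaces the linear extension of \<open>f\<close> to the real cones, which would depend on a choice of
  presentations.\<close>

lemma mhom_lift:
  assumes f: "mhom f \<sigma> \<tau>" "submonoid \<sigma>" and x: "x \<in> conehull (f ` \<sigma>)"
  obtains y where "y \<in> conehull \<sigma>"
    "\<And>(V :: 'b set) u c. finite V \<Longrightarrow> (\<And>v. v \<in> V \<Longrightarrow> u v \<in> \<sigma>) \<Longrightarrow>
      y = (\<lambda>i. \<Sum>v\<in>V. c v * of_int (u v i)) \<Longrightarrow> x = (\<lambda>i. \<Sum>v\<in>V. c v * of_int (f (u v) i))"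
proof -
  obtain H e where H: "finite H" "H \<subseteq> f ` \<sigma>" "\<forall>h\<in>H. 0 \<le> e h" "x = (\<lambda>i. \<Sum>h\<in>H. e h * of_int (h i))"
    using x unfolding conehull_def by auto
  have "\<forall>h\<in>H. \<exists>v. v \<in> \<sigma> \<and> f v = h" using H(2) by auto
  then obtain g where g: "\<And>h. h \<in> H \<Longrightarrow> g h \<in> \<sigma>" "\<And>h. h \<in> H \<Longrightarrow> f (g h) = h"
    unfolding bchoice_iff by blast
  show ?thesis
  proof (rule that[of "\<lambda>i. \<Sum>h\<in>H. e h * of_int (g h i)"])
    show "(\<lambda>i. \<Sum>h\<in>H. e h * of_int (g h i)) \<in> conehull \<sigma>"
      using H g by (intro conehull_sum) auto
    fix V :: "'b set" and u c
    assume V: "finite V" "\<And>v. v \<in> V \<Longrightarrow> u v \<in> \<sigma>"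
      and eq: "(\<lambda>i. \<Sum>h\<in>H. e h * of_int (g h i)) = (\<lambda>i. \<Sum>v\<in>V. c v * of_int (u v i))"
    \<comment> \<open>Two presentations of \<open>y\<close> differ by one real relation, indexed by
      the disjoint sum of their index sets; the homomorphism preserves it.\<close>
    have "(\<Sum>v\<in>H <+> V. case_sum e (\<lambda>v. - c v) v * of_int (f (case_sum g u v) i)) = 0" for i
    proof (rule mhom_real_relation[OF f])
      show "finite (H <+> V)" using H V by simp
      show "case_sum g u v \<in> \<sigma>" if "v \<in> H <+> V" for v using that g V by auto
      show "(\<Sum>v\<in>H <+> V. case_sum e (\<lambda>v. - c v) v * of_int (case_sum g u v i)) = 0" for i
        using H V fun_cong[OF eq, of i] by (simp add: sum.Plus sum_negf)
    qed
    then show "x = (\<lambda>i. \<Sum>v\<in>V. c v * of_int (f (u v) i))"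
      using H V g by (auto simp: sum.Plus sum_negf)
  qed
qed

section \<open>Toric monoids, real cones over faces, and boundary points\<close>

lemma toric_monoidE:
  assumes "toric_monoid \<sigma>"
  obtains d G where "finite G" "\<And>g. g \<in> G \<Longrightarrow> zvec d g" "G \<subseteq> \<sigma>" "supp \<sigma> = conehull G"
    "\<And>v. v \<in> \<sigma> \<longleftrightarrow> zvec d v \<and> rof v \<in> supp \<sigma>"
    "\<And>x. x \<in> supp \<sigma> \<Longrightarrow> (\<lambda>i. - x i) \<in> supp \<sigma> \<Longrightarrow> x = (\<lambda>i. 0)"
proof -
  obtain d G where G: "finite G" "\<forall>g\<in>G. zvec d g" "\<sigma> = {v. zvec d v \<and> rof v \<in> conehull G}"
    "\<forall>x. x \<in> conehull G \<and> (\<lambda>i. - x i) \<in> conehull G \<longrightarrow> x = (\<lambda>i. 0)"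
    using assms unfolding toric_monoid_def by blast
  have sub: "G \<subseteq> \<sigma>" using G conehull_base by auto
  have "supp \<sigma> = conehull G"
    unfolding supp_def
  proof
    show "conehull \<sigma> \<subseteq> conehull G" by (rule conehull_subset) (simp add: G)
    show "conehull G \<subseteq> conehull \<sigma>" using sub by (rule conehull_mono)
  qed
  with G sub show ?thesis by (intro that[of G d]) auto
qed

lemma toric_submonoid:
  assumes "toric_monoid \<sigma>"
  shows "submonoid \<sigma>"
proof -
  obtain d where d: "\<And>v. v \<in> \<sigma> \<longleftrightarrow> zvec d v \<and> rof v \<in> supp \<sigma>"
    using toric_monoidE[OF assms] by metis
  have "rof (vadd v w) \<in> supp \<sigma>" if "v \<in> \<sigma>" "w \<in> \<sigma>" for v w
    using conehull_add[of "rof v" \<sigma> "rof w"] that d by (simp add: rof_def vadd_def supp_def)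
  moreover have "rof (\<lambda>i. 0) \<in> supp \<sigma>" using conehull_zero by (simp add: rof_def supp_def)
  ultimately show ?thesis
    unfolding submonoid_def by (auto simp: d zvec_def vadd_def)
qed

text \<open>Saturation: a toric monoid contains every lattice point of its cone, so subtraction is
  allowed whenever the real difference stays in the cone.\<close>

lemma toric_diff:
  assumes "toric_monoid \<sigma>" "v \<in> \<sigma>" "w \<in> \<sigma>" "(\<lambda>i. of_int (v i) - of_int (w i)) \<in> supp \<sigma>"
  shows "(\<lambda>i. v i - w i) \<in> \<sigma>"
proof -
  obtain d where d: "\<And>v. v \<in> \<sigma> \<longleftrightarrow> zvec d v \<and> rof v \<in> supp \<sigma>"
    using toric_monoidE[OF assms(1)] by metis
  then show ?thesis using assms by (simp add: rof_def zvec_def)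
qed

lemma toric_pointed:
  assumes "toric_monoid \<sigma>" "x \<in> supp \<sigma>" "(\<lambda>i. - x i) \<in> supp \<sigma>"
  shows "x = (\<lambda>i. 0)"
  using toric_monoidE[OF assms(1)] assms(2,3) by metis

lemma toric_exit:
  assumes "toric_monoid \<sigma>" "x \<in> supp \<sigma>" "w \<in> supp \<sigma>" "w \<noteq> (\<lambda>i. 0)"
  obtains t where "t \<ge> 0" "(\<lambda>i. x i - t * w i) \<in> supp \<sigma>" "\<And>s. s > t \<Longrightarrow> (\<lambda>i. x i - s * w i) \<notin> supp \<sigma>"
proof -
  obtain d G where G: "finite G" "\<And>g. g \<in> G \<Longrightarrow> zvec d g" "supp \<sigma> = conehull G"
    using toric_monoidE[OF assms(1)] by metis
  show ?thesis
    using conehull_exit[OF G(1,2) _ assms(2-4)[unfolded G(3)]] toric_pointed[OF assms(1)] that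
    unfolding G(3) by blast
qed

text \<open>The bridge from the lattice definition of a face to real cones. In the order given by
  the cone, some \<open>T\<close> in the face dominates \<open>z\<close>, and a large multiple of
  \<open>T\<close> then dominates \<open>g\<close>; so \<open>g\<close> is a summand of an element
  of the face.\<close>

lemma mface_absorb:
  assumes tor: "toric_monoid \<sigma>" and \<tau>: "mface \<tau> \<sigma>" and g: "g \<in> \<sigma>"
    and z: "z \<in> conehull \<tau>" and s: "s > 0" "(\<lambda>i. z i - s * of_int (g i)) \<in> supp \<sigma>"
  shows "g \<in> \<tau>"
proof -
  have sub: "submonoid \<tau>" "\<tau> \<subseteq> \<sigma>" using \<tau> mface_submonoid by (auto simp: mface_def)
  have "\<exists>T\<in>\<tau>. (\<lambda>i. of_int (T i) - z i) \<in> conehull \<tau>"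
    using z
  proof (induction rule: conehull_induct)
    case zero
    show ?case using sub by (intro bexI[of _ "\<lambda>i. 0"]) (auto simp: submonoid_def conehull_zero)
  next
    case (step h c y)
    then obtain T where T: "T \<in> \<tau>" "(\<lambda>i. of_int (T i) - y i) \<in> conehull \<tau>" by auto
    \<comment> \<open>Rounding the real coefficient up keeps the difference in the cone over the
      face.\<close>
    let ?n = "nat \<lceil>c\<rceil>"
    have "vadd (\<lambda>i. int ?n * h i) T \<in> \<tau>"
      using sub T submonoid_scale[OF sub(1) step(1), of ?n] unfolding submonoid_def by blast
    moreover have "(\<lambda>i. (real ?n - c) * of_int (h i) + (of_int (T i) - y i)) \<in> conehull \<tau>"
      using conehull_add[OF conehull_scale[OF conehull_base[OF step(1)]] T(2), of "real ?n - c"]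
      by (simp add: rof_def of_nat_ceiling)
    moreover have "(\<lambda>i. (real ?n - c) * of_int (h i) + (of_int (T i) - y i))
      = (\<lambda>i. of_int (vadd (\<lambda>i. int ?n * h i) T i) - (c * of_int (h i) + y i))"
      by (simp add: vadd_def algebra_simps)
    ultimately show ?case by auto
  qed
  then obtain T where T: "T \<in> \<tau>" "(\<lambda>i. of_int (T i) - z i) \<in> supp \<sigma>"
    using conehull_mono[OF sub(2)] by (auto simp: supp_def)
  define n where "n = nat \<lceil>1 / s\<rceil>"
  have "real n \<ge> 1 / s" by (simp add: n_def of_nat_ceiling)
  then have ns: "real n * s - 1 \<ge> 0" using s(1) by (simp add: field_simps)
  have nT: "(\<lambda>i. int n * T i) \<in> \<tau>" using submonoid_scale[OF sub(1) T(1)] .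
  \<comment> \<open>The sum collapses to \<open>n * T - g\<close>: the terms in \<open>z\<close>
    cancel, and the last term corrects the coefficient \<open>n * s\<close> of \<open>g\<close> to
    1, which needs \<open>n >= 1 / s\<close>.\<close>
  have "(\<lambda>i. real n * ((of_int (T i) - z i) + (z i - s * of_int (g i))) + (real n * s - 1) * rof g i) \<in> supp \<sigma>"
    using conehull_add[OF conehull_scale[OF conehull_add[OF T(2)[unfolded supp_def] s(2)[unfolded supp_def]]]
        conehull_scale[OF conehull_base[OF g] ns], of "real n"]
    by (simp add: supp_def)
  also have "(\<lambda>i. real n * ((of_int (T i) - z i) + (z i - s * of_int (g i))) + (real n * s - 1) * rof g i)
     = (\<lambda>i. of_int (int n * T i) - of_int (g i))"
    by (simp add: rof_def algebra_simps)
  finally have "(\<lambda>i. int n * T i - g i) \<in> \<sigma>"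
    using toric_diff[OF tor _ g] nT sub(2) by auto
  moreover have "vadd g (\<lambda>i. int n * T i - g i) \<in> \<tau>" using nT by (simp add: vadd_def)
  ultimately show ?thesis using \<tau> g unfolding mface_def by blast
qed

lemma mface_conehull_mem:
  assumes "toric_monoid \<sigma>" "mface \<tau> \<sigma>" "g \<in> \<sigma>" "rof g \<in> conehull \<tau>"
  shows "g \<in> \<tau>"
  by (rule mface_absorb[OF assms(1-4), of 1]) (use conehull_zero in \<open>auto simp: rof_def supp_def\<close>)

text \<open>Extends the face property from lattice points to all real points of the cone, by peeling
  generators off \<open>x\<close> and absorbing each one.\<close>

lemma mface_conehull_face:
  assumes tor: "toric_monoid \<sigma>" and \<tau>: "mface \<tau> \<sigma>" and x: "x \<in> supp \<sigma>" and y: "y \<in> supp \<sigma>"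
    and xy: "(\<lambda>i. x i + y i) \<in> conehull \<tau>"
  shows "x \<in> conehull \<tau>"
proof -
  have "(\<lambda>i. x i + y i) \<in> conehull \<tau> \<longrightarrow> x \<in> conehull \<tau>" if "x \<in> conehull \<sigma>" "y \<in> conehull \<sigma>" for x y
    using that
  proof (induction arbitrary: y rule: conehull_induct)
    case zero
    show ?case using conehull_zero by auto
  next
    case (step g c x)
    show ?case
    proof
      assume a: "(\<lambda>i. c * of_int (g i) + x i + y i) \<in> conehull \<tau>"
      have cg: "(\<lambda>i. c * of_int (g i)) \<in> conehull \<sigma>"
        using conehull_scale[OF conehull_base[OF step(1)] step(2)] by (simp add: rof_def)
      \<comment> \<open>The share of the current generator is moved to the other summand, so that
        the induction hypothesis applies to the rest of \<open>x\<close>.\<close>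
      have "(\<lambda>i. y i + c * of_int (g i)) \<in> conehull \<sigma>" using conehull_add[OF step(5) cg] .
      from step(4)[OF this] a have xt: "x \<in> conehull \<tau>" by (simp add: algebra_simps)
      show "(\<lambda>i. c * of_int (g i) + x i) \<in> conehull \<tau>"
      proof (cases "c = 0")
        case False
        then have "g \<in> \<tau>"
          using conehull_add[OF step(3,5)] step(2)
          by (intro mface_absorb[OF tor \<tau> step(1) a, of c]) (auto simp: supp_def)
        then show ?thesis
          using conehull_add[OF conehull_scale[OF conehull_base step(2)] xt] by (simp add: rof_def)
      qed (use xt in simp)
    qed
  qed
  with x y xy show ?thesis by (auto simp: supp_def)
qed

text \<open>The smallest face whose cone contains \<open>x\<close>, described by the lattice
  directions in which one can step back from \<open>x\<close> and stay in the cone.\<close>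

definition minface :: "zv set \<Rightarrow> rv \<Rightarrow> zv set" where
  "minface \<sigma> x = {v\<in>\<sigma>. \<exists>s>0. (\<lambda>i. x i - s * of_int (v i)) \<in> supp \<sigma>}"

lemma minface_mface:
  assumes tor: "toric_monoid \<sigma>" and x: "x \<in> supp \<sigma>"
  shows "mface (minface \<sigma> x) \<sigma>"
proof -
  have sub: "submonoid \<sigma>" using toric_submonoid[OF tor] .
  have "vadd v w \<in> minface \<sigma> x" if v: "v \<in> minface \<sigma> x" and w: "w \<in> minface \<sigma> x" for v w
  proof -
    obtain s t where s: "s > 0" "(\<lambda>i. x i - s * of_int (v i)) \<in> supp \<sigma>"
      and t: "t > 0" "(\<lambda>i. x i - t * of_int (w i)) \<in> supp \<sigma>" 
      using v w unfolding minface_def by auto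
    \<comment> \<open>The convex weights are chosen so that \<open>v\<close> and \<open>w\<close>
      receive the same coefficient \<open>s * t / (s + t)\<close>.\<close>
    have "(\<lambda>i. t / (s + t) * (x i - s * of_int (v i)) + s / (s + t) * (x i - t * of_int (w i))) \<in> supp \<sigma>"
      using s t unfolding supp_def by (intro conehull_add conehull_scale) auto
    also have "(\<lambda>i. t / (s + t) * (x i - s * of_int (v i)) + s / (s + t) * (x i - t * of_int (w i)))
       = (\<lambda>i. x i - (s * t / (s + t)) * of_int (vadd v w i))"
    proof
      fix i
      have "s + t \<noteq> 0" using s t by auto
      then have one: "t / (s + t) + s / (s + t) = 1" by (simp add: add_divide_distrib[symmetric])
      have "t / (s + t) * (x i - s * of_int (v i)) + s / (s + t) * (x i - t * of_int (w i))
        = (t / (s + t) + s / (s + t)) * x i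
          - (t / (s + t) * s * of_int (v i) + s / (s + t) * t * of_int (w i))"
        by (simp only: algebra_simps)
      also have "\<dots> = x i - (s * t / (s + t)) * of_int (vadd v w i)"
        unfolding one by (simp add: algebra_simps add_divide_distrib vadd_def)
      finally show "t / (s + t) * (x i - s * of_int (v i)) + s / (s + t) * (x i - t * of_int (w i))
         = x i - (s * t / (s + t)) * of_int (vadd v w i)" .
    qed
    finally show ?thesis
      using s t v w sub unfolding minface_def submonoid_def
      by (auto intro!: exI[of _ "s * t / (s + t)"])
  qed
  moreover have "v \<in> minface \<sigma> x" if v: "v \<in> \<sigma>" and w: "w \<in> \<sigma>" and vw: "vadd v w \<in> minface \<sigma> x" for v w
  proof -
    obtain s where s: "s > 0" "(\<lambda>i. x i - s * of_int (vadd v w i)) \<in> supp \<sigma>"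
      using vw unfolding minface_def by auto
    have "(\<lambda>i. (x i - s * of_int (vadd v w i)) + s * rof w i) \<in> supp \<sigma>"
      using s w unfolding supp_def by (intro conehull_add conehull_scale conehull_base) auto
    also have "(\<lambda>i. (x i - s * of_int (vadd v w i)) + s * rof w i) = (\<lambda>i. x i - s * of_int (v i))"
      by (simp add: rof_def vadd_def algebra_simps)
    finally show ?thesis using v s unfolding minface_def by auto
  qed
  moreover have "vadd v w = vadd w v" for v w by (auto simp: vadd_def)
  moreover have "(\<lambda>i. 0) \<in> minface \<sigma> x"
    using x sub by (auto simp: minface_def submonoid_def intro!: exI[of _ 1])
  moreover have "minface \<sigma> x \<subseteq> \<sigma>" by (auto simp: minface_def)
  ultimately show ?thesis
    unfolding mface_def by metis
qed

text \<open>Each generator with nonzero coefficient in a presentation of \<open>x\<close> may be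
  subtracted with that coefficient, so it belongs to the minimal face.\<close>

lemma minface_conehull:
  assumes "x \<in> supp \<sigma>"
  shows "x \<in> conehull (minface \<sigma> x)"
proof -
  obtain G c where G: "finite G" "G \<subseteq> \<sigma>" "\<forall>g\<in>G. 0 \<le> c g" "x = (\<lambda>i. \<Sum>g\<in>G. c g * of_int (g i))"
    using assms unfolding supp_def conehull_def by auto
  define G' where "G' = {g\<in>G. c g \<noteq> 0}"
  have x: "x = (\<lambda>i. \<Sum>g\<in>G'. c g * of_int (g i))"
    unfolding G(4) G'_def using G(1) by (intro ext sum.mono_neutral_right) auto
  have fin: "finite G'" using G by (simp add: G'_def)
  have "g \<in> minface \<sigma> x" if g: "g \<in> G'" for g
  proof -
    have "x i - c g * of_int (g i) = (\<Sum>h\<in>G' - {g}. c h * of_int (h i))" for i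
      unfolding x using fin g by (simp add: sum_diff1)
    moreover have "(\<lambda>i. \<Sum>h\<in>G' - {g}. c h * of_int (h i)) \<in> supp \<sigma>"
      unfolding supp_def using fin G by (intro conehull_sum) (auto simp: G'_def)
    ultimately show ?thesis
      using g G by (auto simp: minface_def G'_def intro!: exI[of _ "c g"] order_neq_le_trans)
  qed
  then have "(\<lambda>i. \<Sum>g\<in>G'. c g * of_int (g i)) \<in> conehull (minface \<sigma> x)"
    using fin G by (intro conehull_sum) (auto simp: G'_def)
  then show ?thesis unfolding x[symmetric] .
qed

text \<open>At the exit point the minimal face is proper. Otherwise every lattice point, hence every
  real point of the cone and in particular \<open>w\<close>, could be subtracted with a further
  positive multiple.\<close>

lemma toric_exit_face:
  assumes tor: "toric_monoid \<sigma>" and "x \<in> supp \<sigma>" "w \<in> supp \<sigma>" "w \<noteq> (\<lambda>i. 0)"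
  obtains t \<tau> where "t \<ge> 0" "mface \<tau> \<sigma>" "\<tau> \<noteq> \<sigma>" "(\<lambda>i. x i - t * w i) \<in> conehull \<tau>"
proof -
  obtain t where t: "t \<ge> 0" "(\<lambda>i. x i - t * w i) \<in> supp \<sigma>" "\<And>s. s > t \<Longrightarrow> (\<lambda>i. x i - s * w i) \<notin> supp \<sigma>"
    using toric_exit[OF assms] by metis
  let ?y = "\<lambda>i. x i - t * w i"
  have "minface \<sigma> ?y \<noteq> \<sigma>"
  proof
    assume eq: "minface \<sigma> ?y = \<sigma>"
    have "\<exists>s>0. (\<lambda>i. ?y i - s * z i) \<in> conehull \<sigma>" if "z \<in> conehull \<sigma>" for z
      using that
    proof (induction rule: conehull_induct)
      case zero
      show ?case using t(2) by (auto simp: supp_def intro!: exI[of _ 1])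
    next
      case (step g c z)
      then obtain s where s: "s > 0" "(\<lambda>i. ?y i - s * z i) \<in> conehull \<sigma>" by auto
      from step(1) eq obtain r where r: "r > 0" "(\<lambda>i. ?y i - r * of_int (g i)) \<in> conehull \<sigma>"
        unfolding minface_def supp_def by auto
      \<comment> \<open>Convex weights giving \<open>g\<close> and \<open>z\<close> coefficients in
        the ratio \<open>c : 1\<close>.\<close>
      let ?a = "s * c / (r + s * c)" and ?b = "r / (r + s * c)"
      have pos: "r + s * c > 0" using r s step(2) by (intro add_pos_nonneg) auto
      have "(\<lambda>i. ?a * (?y i - r * of_int (g i)) + ?b * (?y i - s * z i)) \<in> conehull \<sigma>"
        using r s step(2) pos by (intro conehull_add conehull_scale) auto
      also have "(\<lambda>i. ?a * (?y i - r * of_int (g i)) + ?b * (?y i - s * z i))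
         = (\<lambda>i. ?y i - (r * s / (r + s * c)) * (c * of_int (g i) + z i))"
      proof
        fix i
        have "r + s * c \<noteq> 0" using pos by simp
        then have one: "?a + ?b = 1" by (simp add: add_divide_distrib[symmetric])
        have "?a * (?y i - r * of_int (g i)) + ?b * (?y i - s * z i)
          = (?a + ?b) * ?y i - (?a * r * of_int (g i) + ?b * s * z i)" by (simp only: algebra_simps)
        also have "\<dots> = ?y i - (r * s / (r + s * c)) * (c * of_int (g i) + z i)"
          unfolding one by (simp add: algebra_simps add_divide_distrib)
        finally show "?a * (?y i - r * of_int (g i)) + ?b * (?y i - s * z i)
          = ?y i - (r * s / (r + s * c)) * (c * of_int (g i) + z i)" .
      qed
      finally show ?case using r s pos by (intro exI[of _ "r * s / (r + s * c)"]) auto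
    qed
    then obtain s where "s > 0" "(\<lambda>i. ?y i - s * w i) \<in> supp \<sigma>" using assms by (auto simp: supp_def)
    then show False using t(3)[of "t + s"] by (simp add: algebra_simps)
  qed
  then show ?thesis
    using that[OF t(1) minface_mface[OF tor t(2)] _ minface_conehull[OF t(2)]] by blast
qed

text \<open>The sum of the cone generators works: a face containing it absorbs each generator, hence
  spans the full cone, and a face contains every lattice point of its cone that lies in the
  monoid.\<close>

lemma toric_interior:
  assumes tor: "toric_monoid \<sigma>"
  shows "\<exists>b\<in>\<sigma>. \<forall>\<tau>. mface \<tau> \<sigma> \<and> b \<in> \<tau> \<longrightarrow> \<tau> = \<sigma>"
proof -
  obtain d G where G: "finite G" "G \<subseteq> \<sigma>" "supp \<sigma> = conehull G"
    using toric_monoidE[OF tor] by metis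
  have sub: "submonoid \<sigma>" using toric_submonoid[OF tor] .
  let ?b = "\<lambda>i. \<Sum>g\<in>G. int 1 * g i"
  have b: "?b \<in> \<sigma>" using G by (intro submonoid_sum[OF sub]) auto
  have "\<tau> = \<sigma>" if \<tau>: "mface \<tau> \<sigma>" "?b \<in> \<tau>" for \<tau>
  proof -
    have "g \<in> \<tau>" if "g \<in> G" for g
    proof (rule mface_absorb[OF tor \<tau>(1) _ conehull_base[OF \<tau>(2)], of _ 1])
      have "(\<lambda>i. \<Sum>h\<in>G-{g}. 1 * of_int (h i)) \<in> supp \<sigma>"
        unfolding supp_def using G by (intro conehull_sum) auto
      also have "(\<lambda>i. \<Sum>h\<in>G-{g}. 1 * of_int (h i)) = (\<lambda>i. rof ?b i - 1 * of_int (g i))"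
        using G that by (simp add: rof_def sum_diff1)
      finally show "(\<lambda>i. rof ?b i - 1 * of_int (g i)) \<in> supp \<sigma>" .
    qed (use G that in auto)
    then have "conehull G \<subseteq> conehull \<tau>" by (intro conehull_mono) auto
    then have "rof v \<in> conehull \<tau>" if "v \<in> \<sigma>" for v
      using conehull_base[OF that] G(3) by (auto simp: supp_def)
    then show ?thesis
      using mface_conehull_mem[OF tor \<tau>(1)] \<tau>(1) by (auto simp: mface_def)
  qed
  with b show ?thesis by blast
qed

text \<open>Division with remainder along a line. It serves twice: to recognise a monoid of
  proportional vectors as a ray, and to find the generator of the lattice points on an extremal
  ray.\<close>

lemma toric_proportional:
  assumes tor: "toric_monoid \<sigma>" and M: "M \<subseteq> \<sigma>" and sub: "submonoid M" and ne: "M \<noteq> {\<lambda>i. 0}"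
    and diff: "\<And>v w. v \<in> M \<Longrightarrow> w \<in> M \<Longrightarrow> (\<lambda>i. v i - w i) \<in> \<sigma> \<Longrightarrow> (\<lambda>i. v i - w i) \<in> M"
    and prpl: "\<And>v w. v \<in> M \<Longrightarrow> w \<in> M \<Longrightarrow> w \<noteq> (\<lambda>i. 0) \<Longrightarrow> \<exists>t. \<forall>i. of_int (v i) = (t :: real) * of_int (w i)"
  shows "\<exists>e. e \<noteq> (\<lambda>i. 0) \<and> M = range (\<lambda>n i. int n * e i)"
proof -
  obtain w where w: "w \<in> M" "w \<noteq> (\<lambda>i. 0)" using ne sub by (auto simp: submonoid_def)
  then obtain k where k: "w k \<noteq> 0" by auto
  have nz: "v k \<noteq> 0" if v: "v \<in> M" "v \<noteq> (\<lambda>i. 0)" for v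
  proof
    assume "v k = 0"
    moreover obtain t :: real where t: "\<forall>i. of_int (w i) = t * of_int (v i)" using prpl[OF w(1) v] by auto
    ultimately have "of_int (w k) = (0 :: real)" by simp
    then show False using k by simp
  qed
  \<comment> \<open>Coordinate \<open>k\<close> is nonzero on every nonzero vector of
    \<open>M\<close>, so its absolute value can measure size.\<close>
  obtain e where e: "e \<in> M" "e \<noteq> (\<lambda>i. 0)"
    and least: "\<And>v. v \<in> M \<Longrightarrow> v \<noteq> (\<lambda>i. 0) \<Longrightarrow> nat \<bar>e k\<bar> \<le> nat \<bar>v k\<bar>"
    using ex_has_least_nat[of "\<lambda>v. v \<in> M \<and> v \<noteq> (\<lambda>i. 0)" w "\<lambda>v. nat \<bar>v k\<bar>"] w by auto
  have "v \<in> range (\<lambda>n i. int n * e i)" if v: "v \<in> M" for v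
  proof -
    obtain t :: real where t: "\<And>i. of_int (v i) = t * of_int (e i)" using prpl[OF v e] by auto
    \<comment> \<open>A negative factor would put both \<open>e\<close> and its negative into the
      pointed cone.\<close>
    have "t \<ge> 0"
    proof (rule ccontr)
      assume "\<not> t \<ge> 0"
      then have "(\<lambda>i. (1 / - t) * rof v i) \<in> supp \<sigma>"
        unfolding supp_def using v M by (intro conehull_scale conehull_base) auto
      also have "(\<lambda>i. (1 / - t) * rof v i) = (\<lambda>i. - rof e i)"
        using \<open>\<not> t \<ge> 0\<close> t by (auto simp: rof_def)
      finally have "rof e = (\<lambda>i. 0)"
        using toric_pointed[OF tor, of "rof e"] conehull_base[OF subsetD[OF M e(1)]] by (simp add: supp_def)
      then have "e = (\<lambda>i. 0)" by (auto simp: rof_def fun_eq_iff)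
      then show False using e by simp
    qed
    define n where "n = nat \<lfloor>t\<rfloor>"
    have n: "real n \<le> t" "t < real n + 1" using \<open>t \<ge> 0\<close> by (auto simp: n_def)
    let ?r = "\<lambda>i. v i - int n * e i"
    have eq: "of_int (?r i) = (t - real n) * of_int (e i)" for i
      using t by (simp add: algebra_simps)
    have "?r \<in> M"
    proof (rule diff[OF v submonoid_scale[OF sub e(1)]],
        rule toric_diff[OF tor subsetD[OF M v] subsetD[OF M submonoid_scale[OF sub e(1)]]])
      have "(\<lambda>i. (t - real n) * rof e i) \<in> supp \<sigma>"
        unfolding supp_def using n e M by (intro conehull_scale conehull_base) auto
      then show "(\<lambda>i. of_int (v i) - of_int (int n * e i)) \<in> supp \<sigma>"
        using eq by (simp add: rof_def)
    qed
    moreover have "\<bar>?r k\<bar> < \<bar>e k\<bar>"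
    proof -
      have "of_int \<bar>?r k\<bar> = (t - real n) * \<bar>of_int (e k)\<bar>"
        using eq[of k] n by (simp add: abs_mult)
      also have "\<dots> < 1 * \<bar>of_int (e k)\<bar>"
        using n nz[OF e] by (intro mult_strict_right_mono) auto
      finally show ?thesis by linarith
    qed
    ultimately have "?r = (\<lambda>i. 0)" using least[of ?r] by force
    then have "v = (\<lambda>i. int n * e i)" by (auto simp: fun_eq_iff)
    then show ?thesis by blast
  qed
  then show ?thesis using e submonoid_scale[OF sub e(1)] by (intro exI[of _ e]) auto
qed

section \<open>Cells of a monoidal complex\<close>

definition is_ray :: "zv set \<Rightarrow> bool" where
  "is_ray \<sigma> \<longleftrightarrow> (\<exists>e. e \<noteq> (\<lambda>i. 0) \<and> \<sigma> = range (\<lambda>n i. int n * e i))"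

text \<open>For a ray the interior point has to be the generator, since otherwise smooth monoids would be
  replaced by proper submonoids.\<close>

definition center :: "zv set \<Rightarrow> zv" where
  "center \<sigma> = (if is_ray \<sigma> then SOME e. e \<noteq> (\<lambda>i. 0) \<and> \<sigma> = range (\<lambda>n i. int n * e i)
     else SOME b. b \<in> \<sigma> \<and> (\<forall>\<tau>. mface \<tau> \<sigma> \<and> b \<in> \<tau> \<longrightarrow> \<tau> = \<sigma>))"

lemma center_ray:
  assumes "is_ray \<sigma>"
  shows "center \<sigma> \<noteq> (\<lambda>i. 0)" "\<sigma> = range (\<lambda>n i. int n * center \<sigma> i)"
  using someI_ex[OF assms[unfolded is_ray_def]] assms by (auto simp: center_def)

lemma center_ray_mem: "is_ray \<sigma> \<Longrightarrow> center \<sigma> \<in> \<sigma>"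
  by (subst center_ray(2)) (auto intro: image_eqI[of _ _ 1])

lemma center_interior:
  assumes "toric_monoid \<sigma>"
  shows "center \<sigma> \<in> \<sigma> \<and> (\<forall>\<tau>. mface \<tau> \<sigma> \<and> center \<sigma> \<in> \<tau> \<longrightarrow> \<tau> = \<sigma>)"
proof (cases "is_ray \<sigma>")
  case True
  have "\<tau> = \<sigma>" if \<tau>: "mface \<tau> \<sigma>" "center \<sigma> \<in> \<tau>" for \<tau>
  proof -
    have "range (\<lambda>n i. int n * center \<sigma> i) \<subseteq> \<tau>"
      using submonoid_scale[OF mface_submonoid[OF \<tau>(1)] \<tau>(2)] by auto
    then show ?thesis using center_ray(2)[OF True] \<tau>(1) by (auto simp: mface_def)
  qed
  then show ?thesis using center_ray_mem[OF True] by auto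
next
  case False
  have "\<exists>b. b \<in> \<sigma> \<and> (\<forall>\<tau>. mface \<tau> \<sigma> \<and> b \<in> \<tau> \<longrightarrow> \<tau> = \<sigma>)"
    using toric_interior[OF assms] by blast
  from someI_ex[OF this] show ?thesis using False by (simp add: center_def)
qed

lemma mface_zero:
  assumes tor: "toric_monoid \<sigma>"
  shows "mface {\<lambda>i. 0} \<sigma>"
proof -
  have "v = (\<lambda>i. 0)" if v: "v \<in> \<sigma>" and w: "w \<in> \<sigma>" and vw: "vadd v w = (\<lambda>i. 0)" for v w
  proof -
    have "(\<lambda>i. - rof v i) = rof w"
    proof
      fix i
      have "v i + w i = 0" using fun_cong[OF vw, of i] by (simp add: vadd_def)
      then have "w i = - v i" by simp
      then show "- rof v i = rof w i" by (simp add: rof_def)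
    qed
    then have "rof v = (\<lambda>i. 0)"
      using conehull_base[OF v] conehull_base[OF w] toric_pointed[OF tor] by (simp add: supp_def)
    then show ?thesis by (auto simp: rof_def fun_eq_iff)
  qed
  moreover have "vadd v w = vadd w v" for v w by (auto simp: vadd_def)
  ultimately have "v = (\<lambda>i. 0) \<and> w = (\<lambda>i. 0)" if "v \<in> \<sigma>" "w \<in> \<sigma>" "vadd v w = (\<lambda>i. 0)" for v w
    using that by metis
  moreover have "(\<lambda>i. 0) \<in> \<sigma>" using toric_submonoid[OF tor] by (simp add: submonoid_def)
  ultimately show ?thesis
    unfolding mface_def by (simp add: vadd_def)
qed

text \<open>Stated for an indexed family, so that equal vectors at different indices of a finite
  \<open>V\<close> count as dependent.\<close>

definition indep :: "'b set \<Rightarrow> ('b \<Rightarrow> zv) \<Rightarrow> bool" where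
  "indep V u \<longleftrightarrow> (\<forall>c :: 'b \<Rightarrow> real. (\<forall>i. (\<Sum>v\<in>V. c v * of_int (u v i)) = 0) \<longrightarrow> (\<forall>v\<in>V. c v = 0))"

lemma indep_eqD:
  assumes "indep V u" "(\<lambda>i. \<Sum>v\<in>V. c v * of_int (u v i)) = (\<lambda>i. \<Sum>v\<in>V. (d v :: real) * of_int (u v i))" "v \<in> V"
  shows "c v = d v"
proof -
  have "(\<Sum>v\<in>V. (c v - d v) * of_int (u v i)) = 0" for i
    using fun_cong[OF assms(2), of i] by (simp add: left_diff_distrib sum_subtractf)
  then show ?thesis using assms(1,3) unfolding indep_def by fastforce
qed

definition rays :: "'a mcomplex \<Rightarrow> 'a \<Rightarrow> 'a set" where
  "rays Q a = {r\<in>idx Q. le Q r a \<and> is_ray (mon Q r)}"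

text \<open>The centre of the face \<open>v\<close> as seen in the monoid of \<open>t\<close>; the
  first index is the ambient one.\<close>

definition vec :: "'a mcomplex \<Rightarrow> 'a \<Rightarrow> 'a \<Rightarrow> zv" where
  "vec Q t v = fmap Q v t (center (mon Q v))"

text \<open>In a complete complex the zero monoid has no rays and is therefore simplicial, so it can
  be the base of a cell but never a member of a chain.\<close>

definition simplicial :: "'a mcomplex \<Rightarrow> 'a \<Rightarrow> bool" where
  "simplicial Q a \<longleftrightarrow> indep (rays Q a) (vec Q a)"

text \<open>A cell with base \<open>a\<close>, flag \<open>S\<close> and top \<open>t\<close> is the cone spanned by the rays of the simplicial
  face \<open>a\<close> and by the centers of the non-simplicial faces in the chain \<open>S\<close> above \<open>a\<close>, the largest of
  which is \<open>t\<close>.\<close>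

inductive cell :: "'a mcomplex \<Rightarrow> 'a \<Rightarrow> 'a set \<Rightarrow> 'a \<Rightarrow> bool" for Q where
  base: "a \<in> idx Q \<Longrightarrow> simplicial Q a \<Longrightarrow> cell Q a {} a"
| step: "cell Q a S b \<Longrightarrow> c \<in> idx Q \<Longrightarrow> le Q b c \<Longrightarrow> b \<noteq> c \<Longrightarrow> \<not> simplicial Q c \<Longrightarrow> cell Q a (insert c S) c"

abbreviation verts :: "'a mcomplex \<Rightarrow> 'a \<Rightarrow> 'a set \<Rightarrow> 'a set" where
  "verts Q a S \<equiv> rays Q a \<union> S"

section \<open>Face maps and centres in a complete complex\<close>

locale complete_complex =
  fixes Q :: "'a mcomplex"
  assumes complete: "monoidal_complex Q"
begin

lemma finite_idx: "finite (idx Q)"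
  and le_refl: "a \<in> idx Q \<Longrightarrow> le Q a a"
  and toric: "a \<in> idx Q \<Longrightarrow> toric_monoid (mon Q a)"
  and fmap_id: "a \<in> idx Q \<Longrightarrow> x \<in> mon Q a \<Longrightarrow> fmap Q a a x = x"
  using complete unfolding monoidal_complex_def by simp_all

lemma le_antisym: "le Q a b \<Longrightarrow> le Q b a \<Longrightarrow> a \<in> idx Q \<Longrightarrow> b \<in> idx Q \<Longrightarrow> a = b"
  using complete unfolding monoidal_complex_def by (elim conjE) blast

lemma le_trans: "le Q a b \<Longrightarrow> le Q b c \<Longrightarrow> a \<in> idx Q \<Longrightarrow> b \<in> idx Q \<Longrightarrow> c \<in> idx Q \<Longrightarrow> le Q a c"
  using complete unfolding monoidal_complex_def by (elim conjE) blast

lemma fmap_comp: "le Q a b \<Longrightarrow> le Q b c \<Longrightarrow> a \<in> idx Q \<Longrightarrow> b \<in> idx Q \<Longrightarrow> c \<in> idx Q \<Longrightarrow> x \<in> mon Q a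
    \<Longrightarrow> fmap Q b c (fmap Q a b x) = fmap Q a c x"
  using complete unfolding monoidal_complex_def by (elim conjE) blast

lemma face_emb: "le Q a b \<Longrightarrow> a \<in> idx Q \<Longrightarrow> b \<in> idx Q \<Longrightarrow> face_emb (fmap Q a b) (mon Q a) (mon Q b)"
  using complete unfolding monoidal_complex_def by (elim conjE) blast

lemma face_ex1:
  assumes "b \<in> idx Q" "mface \<tau> (mon Q b)"
  shows "\<exists>!a. a \<in> idx Q \<and> le Q a b \<and> fmap Q a b ` mon Q a = \<tau>"
proof -
  have "\<forall>b\<in>idx Q. \<forall>\<tau>. mface \<tau> (mon Q b) \<longrightarrow> (\<exists>!a. a \<in> idx Q \<and> le Q a b \<and> fmap Q a b ` mon Q a = \<tau>)"
    using complete unfolding monoidal_complex_def by (elim conjE)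
  from this[rule_format, OF assms] show ?thesis .
qed

lemma sub: "a \<in> idx Q \<Longrightarrow> submonoid (mon Q a)"
  using toric toric_submonoid by blast

lemma hom: "le Q a b \<Longrightarrow> a \<in> idx Q \<Longrightarrow> b \<in> idx Q \<Longrightarrow> mhom (fmap Q a b) (mon Q a) (mon Q b)"
  and inj: "le Q a b \<Longrightarrow> a \<in> idx Q \<Longrightarrow> b \<in> idx Q \<Longrightarrow> inj_on (fmap Q a b) (mon Q a)"
  and im_face: "le Q a b \<Longrightarrow> a \<in> idx Q \<Longrightarrow> b \<in> idx Q \<Longrightarrow> mface (fmap Q a b ` mon Q a) (mon Q b)"
  using face_emb unfolding face_emb_def by blast+

abbreviation im :: "'a \<Rightarrow> 'a \<Rightarrow> zv set" where
  "im t a \<equiv> fmap Q a t ` mon Q a"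

lemma im_self: "a \<in> idx Q \<Longrightarrow> im a a = mon Q a"
  using fmap_id by force

lemma im_comp:
  assumes "le Q a b" "le Q b t" "a \<in> idx Q" "b \<in> idx Q" "t \<in> idx Q"
  shows "fmap Q b t ` im b a = im t a"
  using fmap_comp[OF assms] by (force simp: image_image)

lemma im_mono:
  assumes "le Q a b" "le Q b t" "a \<in> idx Q" "b \<in> idx Q" "t \<in> idx Q"
  shows "im t a \<subseteq> im t b"
  unfolding im_comp[OF assms, symmetric] using im_face[OF assms(1,3,4)] by (auto simp: mface_def)

lemma face_index_unique:
  assumes "a \<in> idx Q" "b \<in> idx Q" "t \<in> idx Q" "le Q a t" "le Q b t" "im t a = im t b"
  shows "a = b"
  using face_ex1[OF assms(3) im_face[OF assms(4,1,3)]] assms by metis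

lemma preimage_face:
  assumes "a \<in> idx Q" "t \<in> idx Q" "le Q a t" "mface \<tau> (mon Q t)"
  shows "mface {x\<in>mon Q a. fmap Q a t x \<in> \<tau>} (mon Q a)"
proof -
  have f: "mhom (fmap Q a t) (mon Q a) (mon Q t)" using hom assms by blast
  have add: "fmap Q a t (vadd x y) = vadd (fmap Q a t x) (fmap Q a t y)" "vadd x y \<in> mon Q a"
    if "x \<in> mon Q a" "y \<in> mon Q a" for x y
    using that f sub[OF assms(1)] by (simp_all add: mhom_def submonoid_def)
  have mem: "fmap Q a t x \<in> mon Q t" if "x \<in> mon Q a" for x using that f by (simp add: mhom_def)
  have zero: "fmap Q a t (\<lambda>i. 0) = (\<lambda>i. 0)" "(\<lambda>i. 0) \<in> mon Q a"
    using f sub[OF assms(1)] by (simp_all add: mhom_def submonoid_def)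
  show ?thesis
    unfolding mface_def
  proof (intro conjI ballI impI)
    fix v w assume vw: "v \<in> mon Q a" "w \<in> mon Q a" "vadd v w \<in> {x\<in>mon Q a. fmap Q a t x \<in> \<tau>}"
    then have "vadd (fmap Q a t v) (fmap Q a t w) \<in> \<tau>" using add by simp
    then have "fmap Q a t v \<in> \<tau> \<and> fmap Q a t w \<in> \<tau>"
      using assms(4) mem[OF vw(1)] mem[OF vw(2)] unfolding mface_def by blast
    then show "v \<in> {x\<in>mon Q a. fmap Q a t x \<in> \<tau>}" "w \<in> {x\<in>mon Q a. fmap Q a t x \<in> \<tau>}"
      using vw by auto
  qed (use assms(4) in \<open>auto simp: zero add mface_def\<close>)
qed

text \<open>The preimage of \<open>im t a\<close> in \<open>mon Q b\<close> is a face and so has an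
  index below \<open>b\<close>; this index has the same image in \<open>t\<close> as
  \<open>a\<close>, hence is \<open>a\<close>. Thus the order can be read off in any common upper
  monoid.\<close>

lemma im_le:
  assumes "a \<in> idx Q" "b \<in> idx Q" "t \<in> idx Q" "le Q a t" "le Q b t" "im t a \<subseteq> im t b"
  shows "le Q a b"
proof -
  let ?\<tau> = "{x\<in>mon Q b. fmap Q b t x \<in> im t a}"
  have "mface ?\<tau> (mon Q b)"
    using preimage_face[OF assms(2,3,5) im_face[OF assms(4,1,3)]] .
  then obtain a' where a': "a' \<in> idx Q" "le Q a' b" "im b a' = ?\<tau>"
    using face_ex1[OF assms(2)] by blast
  have "im t a' = fmap Q b t ` ?\<tau>"
    using im_comp[OF a'(2) assms(5) a'(1) assms(2,3)] a'(3) by simp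
  also have "\<dots> = im t a"
  proof
    show "im t a \<subseteq> fmap Q b t ` ?\<tau>"
    proof
      fix y assume y: "y \<in> im t a"
      then obtain x where "x \<in> mon Q b" "y = fmap Q b t x" using assms(6) by blast
      then show "y \<in> fmap Q b t ` ?\<tau>" using y by blast
    qed
  qed auto
  finally have "a' = a"
    using face_index_unique a' assms le_trans[OF a'(2) assms(5)] by blast
  then show ?thesis using a' by simp
qed

lemma center_mem: "a \<in> idx Q \<Longrightarrow> center (mon Q a) \<in> mon Q a"
  using center_interior toric by blast

lemma vec_mem_im: "v \<in> idx Q \<Longrightarrow> vec Q t v \<in> im t v"
  using center_mem by (auto simp: vec_def)

lemma vec_mem: "v \<in> idx Q \<Longrightarrow> t \<in> idx Q \<Longrightarrow> le Q v t \<Longrightarrow> vec Q t v \<in> mon Q t"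
  using vec_mem_im im_face by (fastforce simp: mface_def)

lemma vec_self: "a \<in> idx Q \<Longrightarrow> vec Q a a = center (mon Q a)"
  using center_mem fmap_id by (simp add: vec_def)

lemma vec_comp:
  assumes "le Q v a" "le Q a t" "v \<in> idx Q" "a \<in> idx Q" "t \<in> idx Q"
  shows "fmap Q a t (vec Q a v) = vec Q t v"
  unfolding vec_def using fmap_comp[OF assms] center_mem[OF assms(3)] by simp

text \<open>The centre of \<open>v\<close> lies in no proper face, so the preimage of
  \<open>\<tau>\<close> must be all of \<open>mon Q v\<close>.\<close>

lemma vec_absorb:
  assumes "v \<in> idx Q" "t \<in> idx Q" "le Q v t" "mface \<tau> (mon Q t)" "vec Q t v \<in> \<tau>"
  shows "im t v \<subseteq> \<tau>"
proof -
  have "{x\<in>mon Q v. fmap Q v t x \<in> \<tau>} = mon Q v"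
    using center_interior[OF toric[OF assms(1)]] preimage_face[OF assms(1-4)] assms(5)
    by (auto simp: vec_def)
  then show ?thesis by auto
qed

lemma rays_idx: "r \<in> rays Q a \<Longrightarrow> r \<in> idx Q" and rays_le: "r \<in> rays Q a \<Longrightarrow> le Q r a"
  and finite_rays: "finite (rays Q a)"
  using finite_idx by (auto simp: rays_def)

lemma rays_mono: "le Q a b \<Longrightarrow> a \<in> idx Q \<Longrightarrow> b \<in> idx Q \<Longrightarrow> rays Q a \<subseteq> rays Q b"
  using le_trans by (auto simp: rays_def)

text \<open>Injective homomorphisms carry real relations in both directions, so independence does
  not depend on the ambient monoid.\<close>

lemma indep_vec:
  assumes V: "finite V" "V \<subseteq> idx Q" "\<And>v. v \<in> V \<Longrightarrow> le Q v a" and at: "a \<in> idx Q" "t \<in> idx Q" "le Q a t"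
  shows "indep V (vec Q t) \<longleftrightarrow> indep V (vec Q a)"
proof -
  have mem: "v \<in> V \<Longrightarrow> vec Q a v \<in> mon Q a" for v using vec_mem V at by blast
  have eq: "(\<Sum>v\<in>V. c v * of_int (vec Q t v i)) = (\<Sum>v\<in>V. c v * of_int (fmap Q a t (vec Q a v) i))"
    for c :: "'a \<Rightarrow> real" and i
    using vec_comp V at by (intro sum.cong) auto
  have "(\<forall>i. (\<Sum>v\<in>V. c v * of_int (vec Q t v i)) = 0) \<longleftrightarrow> (\<forall>i. (\<Sum>v\<in>V. c v * of_int (vec Q a v i)) = 0)"
    for c :: "'a \<Rightarrow> real"
    unfolding eq
    using mhom_real_relation[where u = "vec Q a" and c = c, OF hom[OF at(3,1,2)] sub[OF at(1)] V(1) mem]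
      mhom_inj_real_relation[where u = "vec Q a" and c = c, OF hom[OF at(3,1,2)] inj[OF at(3,1,2)] sub[OF at(1)] V(1) mem]
    by blast
  then show ?thesis unfolding indep_def by simp
qed

lemma idx_induct [consumes 1, case_names less]:
  assumes "a \<in> idx Q"
    and "\<And>a. a \<in> idx Q \<Longrightarrow> (\<And>b. b \<in> idx Q \<Longrightarrow> le Q b a \<Longrightarrow> b \<noteq> a \<Longrightarrow> P b) \<Longrightarrow> P a"
  shows "P a"
  using assms(1)
proof (induction "card {x\<in>idx Q. le Q x a}" arbitrary: a rule: less_induct)
  case less
  show ?case
  proof (rule assms(2)[OF less.prems])
    fix b assume b: "b \<in> idx Q" "le Q b a" "b \<noteq> a"
    have "{x\<in>idx Q. le Q x b} \<subset> {x\<in>idx Q. le Q x a}"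
      using b less.prems le_trans[of _ b a] le_antisym[of a b] le_refl[of a] by blast
    then show "P b"
      using b finite_idx by (intro less.hyps psubset_card_mono) auto
  qed
qed

text \<open>The lift \<open>y\<close> is fixed before any presentation is known: the vertex set
  \<open>V\<close> may be found only afterwards, by applying an induction hypothesis to
  \<open>y\<close>.\<close>

lemma lift_vec:
  assumes b: "b \<in> idx Q" "a \<in> idx Q" "le Q b a" and x: "x \<in> conehull (im a b)"
  obtains y where "y \<in> supp (mon Q b)"
    "\<And>V c. finite V \<Longrightarrow> V \<subseteq> idx Q \<Longrightarrow> (\<And>v. v \<in> V \<Longrightarrow> le Q v b) \<Longrightarrow>
      y = (\<lambda>i. \<Sum>v\<in>V. c v * of_int (vec Q b v i)) \<Longrightarrow> x = (\<lambda>i. \<Sum>v\<in>V. c v * of_int (vec Q a v i))"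
proof -
  obtain y where y: "y \<in> conehull (mon Q b)"
    "\<And>(V :: 'a set) u c. finite V \<Longrightarrow> (\<And>v. v \<in> V \<Longrightarrow> u v \<in> mon Q b) \<Longrightarrow>
      y = (\<lambda>i. \<Sum>v\<in>V. c v * of_int (u v i)) \<Longrightarrow>
      x = (\<lambda>i. \<Sum>v\<in>V. c v * of_int (fmap Q b a (u v) i))"
    using mhom_lift[OF hom[OF b(3,1,2)] sub[OF b(1)] x] by blast
  show ?thesis
  proof (rule that[of y])
    show "y \<in> supp (mon Q b)" using y(1) by (simp add: supp_def)
    fix V :: "'a set" and c
    assume V: "finite V" "V \<subseteq> idx Q" "\<And>v. v \<in> V \<Longrightarrow> le Q v b"
      and yV: "y = (\<lambda>i. \<Sum>v\<in>V. c v * of_int (vec Q b v i))"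
    have "x = (\<lambda>i. \<Sum>v\<in>V. c v * of_int (fmap Q b a (vec Q b v) i))"
      using y(2)[OF V(1) _ yV] vec_mem V b by blast
    also have "\<dots> = (\<lambda>i. \<Sum>v\<in>V. c v * of_int (vec Q a v i))"
      using vec_comp V b by (intro ext sum.cong) auto
    finally show "x = (\<lambda>i. \<Sum>v\<in>V. c v * of_int (vec Q a v i))" .
  qed
qed

lemma conehull_im_subset:
  assumes b: "b \<in> idx Q" "a \<in> idx Q" "le Q b a"
    and V: "finite V" "V \<subseteq> idx Q" "\<And>v. v \<in> V \<Longrightarrow> le Q v b"
    and sup: "supp (mon Q b) \<subseteq> conehull (vec Q b ` V)"
  shows "conehull (im a b) \<subseteq> conehull (vec Q a ` V)"
proof
  fix x assume "x \<in> conehull (im a b)"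
  then obtain y where y: "y \<in> supp (mon Q b)"
    "\<And>V c. finite V \<Longrightarrow> V \<subseteq> idx Q \<Longrightarrow> (\<And>v. v \<in> V \<Longrightarrow> le Q v b) \<Longrightarrow>
      y = (\<lambda>i. \<Sum>v\<in>V. c v * of_int (vec Q b v i)) \<Longrightarrow> x = (\<lambda>i. \<Sum>v\<in>V. c v * of_int (vec Q a v i))"
    using lift_vec[OF b] by blast
  obtain c where c: "\<forall>v\<in>V. 0 \<le> c v" "y = (\<lambda>i. \<Sum>v\<in>V. c v * of_int (vec Q b v i))"
    using sup y(1) conehull_image[OF V(1)] by blast
  then show "x \<in> conehull (vec Q a ` V)"
    using y(2)[OF V c(2)] unfolding conehull_image[OF V(1)] by blast
qed

text \<open>A lattice point of a cone which is neither zero nor a ray is a sum of two boundary points: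
  leave the cone along any other direction, then along the boundary point reached.\<close>

lemma supp_rays:
  assumes "a \<in> idx Q"
  shows "supp (mon Q a) \<subseteq> conehull (vec Q a ` rays Q a)"
  using assms
proof (induction rule: idx_induct)
  case (less a)
  let ?D = "conehull (vec Q a ` rays Q a)"
  note tor = toric[OF less(1)]
  \<comment> \<open>Proper faces are settled by induction, as their rays are among the rays of
    \<open>a\<close>.\<close>
  have proper: "conehull \<tau> \<subseteq> ?D" if \<tau>: "mface \<tau> (mon Q a)" "\<tau> \<noteq> mon Q a" for \<tau>
  proof -
    obtain b where b: "b \<in> idx Q" "le Q b a" "im a b = \<tau>" using face_ex1[OF less(1) \<tau>(1)] by blast
    with \<tau>(2) im_self[OF less(1)] have ne: "b \<noteq> a" by auto
    have "conehull \<tau> \<subseteq> conehull (vec Q a ` rays Q b)"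
      using conehull_im_subset[OF b(1) less(1) b(2) finite_rays _ rays_le less(2)[OF b(1,2) ne]]
        rays_idx b(3) by blast
    also have "\<dots> \<subseteq> ?D" using rays_mono[OF b(2,1) less(1)] by (intro conehull_mono) auto
    finally show ?thesis .
  qed
  have "rof g \<in> ?D" if g: "g \<in> mon Q a" for g
  proof (cases "g = (\<lambda>i. 0)")
    case True
    then show ?thesis using conehull_zero by (simp add: rof_def)
  next
    case nz: False
    show ?thesis
    proof (cases "is_ray (mon Q a)")
      case True
      then obtain n where "g = (\<lambda>i. int n * vec Q a a i)"
        using g center_ray(2)[OF True] vec_self[OF less(1)] by auto
      moreover have "a \<in> rays Q a" using True less(1) le_refl by (simp add: rays_def)
      ultimately show ?thesis
        using conehull_scale[OF conehull_base[of "vec Q a a"], of "vec Q a ` rays Q a" "real n"]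
        by (simp add: rof_def)
    next
      case False
      \<comment> \<open>If all elements were proportional to \<open>g\<close>, the monoid would be a
        ray.\<close>
      have "\<exists>v\<in>mon Q a. \<nexists>t::real. \<forall>i. of_int (v i) = t * of_int (g i)"
      proof (rule ccontr)
        assume "\<not> ?thesis"
        then have all: "\<And>v. v \<in> mon Q a \<Longrightarrow> \<exists>t::real. \<forall>i. of_int (v i) = t * of_int (g i)" by blast
        have "\<exists>t::real. \<forall>i. of_int (v i) = t * of_int (w i)"
          if vw: "v \<in> mon Q a" "w \<in> mon Q a" "w \<noteq> (\<lambda>i. 0)" for v w
        proof -
          obtain t s :: real where ts: "\<forall>i. of_int (v i) = t * of_int (g i)" "\<forall>i. of_int (w i) = s * of_int (g i)"
            using all[OF vw(1)] all[OF vw(2)] by (elim exE) (rule that)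
          then have "s \<noteq> 0" using vw(3) by auto
          then show ?thesis using ts by (intro exI[of _ "t / s"]) auto
        qed
        moreover have "mon Q a \<noteq> {\<lambda>i. 0}" using g nz by auto
        ultimately show False using toric_proportional[OF tor subset_refl sub[OF less(1)]] False
          unfolding is_ray_def by blast
      qed
      then obtain v where v: "v \<in> mon Q a" "\<And>t::real. \<not> (\<forall>i. of_int (v i) = t * of_int (g i))" by blast
      have gs: "rof g \<in> supp (mon Q a)" and vs: "rof v \<in> supp (mon Q a)"
        using g v conehull_base by (auto simp: supp_def)
      have "rof v \<noteq> (\<lambda>i. 0)" using v(2)[of 0] by (auto simp: rof_def fun_eq_iff)
      then obtain t \<tau> where t: "t \<ge> 0" "mface \<tau> (mon Q a)" "\<tau> \<noteq> mon Q a" "(\<lambda>i. rof g i - t * rof v i) \<in> conehull \<tau>"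
        by (rule toric_exit_face[OF tor gs vs])
      let ?y = "\<lambda>i. rof g i - t * rof v i"
      \<comment> \<open>The first exit point is nonzero because \<open>v\<close> is not proportional
        to \<open>g\<close>, so it can serve as the second direction.\<close>
      have "?y \<noteq> (\<lambda>i. 0)"
      proof
        assume "?y = (\<lambda>i. 0)"
        then have eq: "of_int (g i) = t * of_int (v i)" for i by (auto simp: rof_def fun_eq_iff)
        then have "t \<noteq> 0" using nz by auto
        then have "\<forall>i. of_int (v i) = (1 / t) * of_int (g i)" using eq by simp
        then show False using v(2) by blast
      qed
      moreover have "?y \<in> supp (mon Q a)"
        using t(4) conehull_mono[of \<tau> "mon Q a"] t(2) unfolding supp_def mface_def by blast
      ultimately obtain s \<tau>' where s: "s \<ge> 0" "mface \<tau>' (mon Q a)" "\<tau>' \<noteq> mon Q a"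
        "(\<lambda>i. rof g i - s * ?y i) \<in> conehull \<tau>'"
        using toric_exit_face[OF tor gs, of ?y] by metis
      have "(\<lambda>i. s * ?y i + (rof g i - s * ?y i)) \<in> ?D"
        using proper[OF t(2,3)] proper[OF s(2,3)] t(4) s(4) by (intro conehull_add conehull_scale s(1)) auto
      then show ?thesis by simp
    qed
  qed
  then show ?case unfolding supp_def by (rule conehull_subset)
qed

section \<open>Independence, uniqueness and covering for cells\<close>

lemma cell_idx:
  assumes "cell Q a S t"
  shows "a \<in> idx Q" "t \<in> idx Q" "simplicial Q a" "le Q a t" "finite S" "S \<subseteq> idx Q"
    "\<And>s. s \<in> S \<Longrightarrow> \<not> simplicial Q s" "\<And>s. s \<in> S \<Longrightarrow> le Q a s" "\<And>s. s \<in> S \<Longrightarrow> le Q s t"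
    "S = {} \<Longrightarrow> t = a" "S \<noteq> {} \<Longrightarrow> t \<in> S"
proof -
  have "a \<in> idx Q \<and> t \<in> idx Q \<and> simplicial Q a \<and> le Q a t \<and> finite S \<and> S \<subseteq> idx Q \<and>
    (\<forall>s\<in>S. \<not> simplicial Q s \<and> le Q a s \<and> le Q s t) \<and> (S = {} \<longrightarrow> t = a) \<and> (S \<noteq> {} \<longrightarrow> t \<in> S)"
    using assms
  proof induction
    case (base a)
    then show ?case using le_refl by auto
  next
    case (step a S b c)
    then have "le Q a c" using le_trans by blast
    moreover have "le Q s c" if "s \<in> S" for s using step that le_trans by blast
    ultimately show ?case using step le_refl by auto
  qed
  then show "a \<in> idx Q" "t \<in> idx Q" "simplicial Q a" "le Q a t" "finite S" "S \<subseteq> idx Q"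
    "\<And>s. s \<in> S \<Longrightarrow> \<not> simplicial Q s" "\<And>s. s \<in> S \<Longrightarrow> le Q a s" "\<And>s. s \<in> S \<Longrightarrow> le Q s t"
    "S = {} \<Longrightarrow> t = a" "S \<noteq> {} \<Longrightarrow> t \<in> S" by auto
qed

lemma verts_cell:
  assumes "cell Q a S t"
  shows "finite (verts Q a S)" "verts Q a S \<subseteq> idx Q" "\<And>v. v \<in> verts Q a S \<Longrightarrow> le Q v t"
  using cell_idx[OF assms] finite_rays rays_idx rays_le le_trans[of _ a t] by blast+

lemma simplicial_mono: 
  assumes "simplicial Q b" "le Q a b" "a \<in> idx Q" "b \<in> idx Q"
  shows "simplicial Q a"
proof -
  have sub: "rays Q a \<subseteq> rays Q b" using rays_mono assms by blast
  have "indep (rays Q a) (vec Q b)"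
    unfolding indep_def
  proof (intro allI impI ballI)
    fix c :: "'a \<Rightarrow> real" and v
    assume c: "\<forall>i. (\<Sum>v\<in>rays Q a. c v * of_int (vec Q b v i)) = 0" and v: "v \<in> rays Q a"
    let ?c = "\<lambda>v. if v \<in> rays Q a then c v else 0"
    have eq: "(\<Sum>v\<in>rays Q b. ?c v * of_int (vec Q b v i)) = (\<Sum>v\<in>rays Q a. c v * of_int (vec Q b v i))" for i
      using sub by (intro sum.mono_neutral_cong_right) (auto simp: finite_rays)
    have "\<forall>i. (\<Sum>v\<in>rays Q b. ?c v * of_int (vec Q b v i)) = 0"
      unfolding eq using c .
    then have "\<forall>v\<in>rays Q b. ?c v = 0"
      using assms(1)[unfolded simplicial_def indep_def, THEN spec, of ?c] by (rule rev_mp)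
    then have "?c v = 0" using v sub by (elim ballE) auto
    then show "c v = 0" using v by simp
  qed
  then show ?thesis
    using indep_vec[of "rays Q a" a b] assms finite_rays rays_idx rays_le by (auto simp: simplicial_def)
qed

lemma vec_ray_nonzero:
  assumes "r \<in> rays Q a" "a \<in> idx Q"
  shows "vec Q a r \<noteq> (\<lambda>i. 0)"
proof
  have r: "r \<in> idx Q" "le Q r a" "is_ray (mon Q r)" using assms by (auto simp: rays_def)
  assume "vec Q a r = (\<lambda>i. 0)"
  then have "fmap Q r a (center (mon Q r)) = fmap Q r a (\<lambda>i. 0)"
    using hom[OF r(2,1) assms(2)] by (simp add: vec_def mhom_def)
  then have "center (mon Q r) = (\<lambda>i. 0)"
    using inj_onD[OF inj[OF r(2,1) assms(2)]] center_mem[OF r(1)] sub[OF r(1)]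
    by (simp add: submonoid_def)
  then show False using center_ray(1)[OF r(3)] by simp
qed

text \<open>Every nonzero element of a ray has the generator as a summand, so a face of it that is
  itself a ray contains the generator and is everything.\<close>

lemma rays_ray:
  assumes "r \<in> idx Q" "is_ray (mon Q r)"
  shows "rays Q r = {r}"
proof -
  have "s = r" if "s \<in> rays Q r" for s
  proof -
    let ?e = "center (mon Q r)"
    have s: "s \<in> idx Q" "le Q s r" "is_ray (mon Q s)" using that by (auto simp: rays_def)
    have face: "mface (im r s) (mon Q r)" using im_face s assms by blast
    obtain n where n: "vec Q r s = (\<lambda>i. int n * ?e i)"
      using vec_mem[OF s(1) assms(1) s(2)] center_ray(2)[OF assms(2)] by auto
    have "vec Q r s \<noteq> (\<lambda>i. 0)" using vec_ray_nonzero[OF that assms(1)] .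
    then obtain m where m: "n = Suc m" using n by (cases n) auto
    have "vadd ?e (\<lambda>i. int m * ?e i) \<in> im r s"
      using vec_mem_im[OF s(1), of r] unfolding n m by (simp add: vadd_def algebra_simps)
    moreover have "(\<lambda>i. int m * ?e i) \<in> mon Q r"
      using submonoid_scale[OF sub[OF assms(1)] center_mem[OF assms(1)]] .
    ultimately have "?e \<in> im r s"
      using face center_mem[OF assms(1)] unfolding mface_def by blast
    then have "im r s = mon Q r" using face center_interior[OF toric[OF assms(1)]] by blast
    then show ?thesis
      using face_index_unique[OF s(1) assms(1,1) s(2) le_refl[OF assms(1)]] im_self[OF assms(1)] by simp
  qed
  then show ?thesis using assms le_refl by (auto simp: rays_def)
qed

lemma ray_simplicial:
  assumes "r \<in> idx Q" "is_ray (mon Q r)"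
  shows "simplicial Q r"
proof -
  have "\<exists>i. vec Q r r i \<noteq> 0" using center_ray(1)[OF assms(2)] vec_self[OF assms(1)] by auto
  then show ?thesis unfolding simplicial_def rays_ray[OF assms] indep_def by auto
qed

text \<open>Rays are simplicial and chain members are not; hence \<open>verts\<close> is a disjoint
  union and a vertex set determines both its parts.\<close>

lemma rays_cell_disjoint: "cell Q a S t \<Longrightarrow> rays Q b \<inter> S = {}"
  using cell_idx(7) ray_simplicial by (fastforce simp: rays_def)

text \<open>Absorption would put the centre of \<open>c\<close>, hence all of \<open>c\<close>, into
  the strictly smaller face \<open>b\<close>. This obstruction is behind both independence and
  uniqueness.\<close>

lemma not_in_lower:
  assumes b: "b \<in> idx Q" "c \<in> idx Q" "t \<in> idx Q" "le Q b c" "b \<noteq> c" "le Q c t"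
    and q: "q > 0" and z: "z \<in> supp (mon Q t)"
  shows "(\<lambda>i. q * of_int (vec Q t c i) + z i) \<notin> conehull (im t b)"
proof
  assume a: "(\<lambda>i. q * of_int (vec Q t c i) + z i) \<in> conehull (im t b)"
  have bt: "le Q b t" using b le_trans by blast
  have face: "mface (im t b) (mon Q t)" using im_face b bt by blast
  have "vec Q t c \<in> im t b"
    using mface_absorb[OF toric[OF b(3)] face vec_mem[OF b(2,3,6)] a q] z by simp
  then have "im t c \<subseteq> im t b" using vec_absorb[OF b(2,3,6) face] by blast
  then have "le Q c b" using im_le b bt by blast
  then show False using le_antisym b by blast
qed

lemma combination_im:
  assumes V: "finite V" "V \<subseteq> idx Q" "\<And>v. v \<in> V \<Longrightarrow> le Q v b" and b: "b \<in> idx Q" "t \<in> idx Q" "le Q b t"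
    and c: "\<And>v. v \<in> V \<Longrightarrow> 0 \<le> c v"
  shows "(\<lambda>i. \<Sum>v\<in>V. c v * of_int (vec Q t v i)) \<in> conehull (im t b)"
proof (rule conehull_sum[OF V(1) _ c])
  fix v assume v: "v \<in> V"
  then have "im t v \<subseteq> im t b" using im_mono V b by blast
  then show "vec Q t v \<in> im t b" using vec_mem_im[of v t] v V by blast
qed

lemma combination_supp:
  assumes V: "finite V" "V \<subseteq> idx Q" "\<And>v. v \<in> V \<Longrightarrow> le Q v t" and t: "t \<in> idx Q"
    and c: "\<And>v. v \<in> V \<Longrightarrow> 0 \<le> c v"
  shows "(\<lambda>i. \<Sum>v\<in>V. c v * of_int (vec Q t v i)) \<in> supp (mon Q t)"
  using combination_im[OF V t t le_refl[OF t] c] im_self[OF t] by (simp add: supp_def)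

lemma top_not_vert:
  assumes "cell Q a S b" "le Q b c" "b \<noteq> c" "c \<in> idx Q"
  shows "c \<notin> verts Q a S"
  using verts_cell(3)[OF assms(1)] le_antisym[OF assms(2) _ _ assms(4)] cell_idx(2)[OF assms(1)] assms(3) by blast

text \<open>In a relation involving the newest chain member \<open>c\<close>, solve for its centre
  and move the terms with negative coefficients to its side; the result lies in the cone over the
  lower face \<open>b\<close>, against \<open>not_in_lower\<close>.\<close>

lemma cell_indep:
  assumes "cell Q a S b" "le Q b t" "t \<in> idx Q"
  shows "indep (verts Q a S) (vec Q t)"
  using assms
proof (induction arbitrary: t)
  case (base a)
  then show ?case
    using indep_vec[of "rays Q a" a t] finite_rays rays_idx rays_le
    by (auto simp: simplicial_def)
next
  case (step a S b c)
  note b = cell_idx(2)[OF step(1)] and V = verts_cell[OF step(1)]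
  have bt: "le Q b t" using step le_trans b by blast
  have Vt: "le Q v t" if "v \<in> verts Q a S" for v using V that le_trans[OF _ bt] b step.prems(2) by blast
  have c: "c \<notin> verts Q a S" using top_not_vert[OF step(1,3,4,2)] .
  have ins: "verts Q a (insert c S) = insert c (verts Q a S)" by auto
  show ?case
    unfolding indep_def ins
  proof (intro allI impI)
    fix p :: "'a \<Rightarrow> real"
    assume p: "\<forall>i. (\<Sum>v\<in>insert c (verts Q a S). p v * of_int (vec Q t v i)) = 0"
    then have eq: "p c * of_int (vec Q t c i) + (\<Sum>v\<in>verts Q a S. p v * of_int (vec Q t v i)) = 0" for i
      using c V(1) by simp
    have "p c = 0"
    proof (rule ccontr)
      assume pc: "p c \<noteq> 0"
      define q where "q v = - p v / p c" for v
      let ?m = "\<lambda>i. \<Sum>v\<in>verts Q a S. max 0 (- q v) * of_int (vec Q t v i)"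
      have "1 * of_int (vec Q t c i) + ?m i = (\<Sum>v\<in>verts Q a S. max 0 (q v) * of_int (vec Q t v i))" for i
      proof -
        have "of_int (vec Q t c i) = - (\<Sum>v\<in>verts Q a S. p v * of_int (vec Q t v i)) / p c"
          using eq[of i] pc by (simp add: field_simps)
        also have "\<dots> = (\<Sum>v\<in>verts Q a S. q v * of_int (vec Q t v i))"
          by (simp add: q_def sum_divide_distrib sum_negf)
        finally have v: "of_int (vec Q t c i) = (\<Sum>v\<in>verts Q a S. q v * of_int (vec Q t v i))" .
        show ?thesis
          unfolding v mult_1 sum.distrib[symmetric] 
          by (rule sum.cong) (auto simp: distrib_right[symmetric] max_def)
      qed
      moreover have "(\<lambda>i. \<Sum>v\<in>verts Q a S. max 0 (q v) * of_int (vec Q t v i)) \<in> conehull (im t b)"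
        using combination_im[OF V b step.prems(2) bt] by simp
      moreover have "?m \<in> supp (mon Q t)"
        using combination_supp[OF V(1,2) Vt step.prems(2)] by simp
      ultimately show False
        using not_in_lower[OF b step(2) step.prems(2) step(3,4) step.prems(1), of 1 ?m] by simp
    qed
    moreover from this eq have "\<forall>v\<in>verts Q a S. p v = 0"
      using step.IH[OF bt step.prems(2)] unfolding indep_def by simp
    ultimately show "\<forall>v\<in>insert c (verts Q a S). p v = 0" by simp
  qed
qed

text \<open>Absorption puts every vertex into \<open>\<tau>\<close>. If the chain is nonempty the
  top is itself a vertex; otherwise the top is the base, whose cone is spanned by its rays.\<close>

lemma cell_minface:
  fixes p :: "'a \<Rightarrow> real"
  assumes c: "cell Q a S b" "le Q b t" "t \<in> idx Q"
    and p: "\<And>v. v \<in> verts Q a S \<Longrightarrow> p v > 0"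
    and \<tau>: "mface \<tau> (mon Q t)" "(\<lambda>i. \<Sum>v\<in>verts Q a S. p v * of_int (vec Q t v i)) \<in> conehull \<tau>"
  shows "im t b \<subseteq> \<tau>"
proof -
  note b = cell_idx(2)[OF c(1)] and V = verts_cell[OF c(1)]
  have Vt: "le Q v t" if "v \<in> verts Q a S" for v using V that le_trans[OF _ c(2)] b c(3) by blast
  have mem: "vec Q t v \<in> \<tau>" if v: "v \<in> verts Q a S" for v
  proof (rule mface_absorb[OF toric[OF c(3)] \<tau>(1) _ \<tau>(2) p[OF v]])
    show "vec Q t v \<in> mon Q t" using vec_mem V Vt c(3) v by blast
    have "(\<lambda>i. \<Sum>w\<in>verts Q a S - {v}. p w * of_int (vec Q t w i)) \<in> supp (mon Q t)"
      using V Vt p by (intro combination_supp c(3)) (auto simp: less_imp_le)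
    then show "(\<lambda>i. (\<Sum>v\<in>verts Q a S. p v * of_int (vec Q t v i)) - p v * of_int (vec Q t v i)) \<in> supp (mon Q t)"
      using V(1) v by (simp add: sum_diff1)
  qed
  show ?thesis
  proof (cases "S = {}")
    case False
    then have "vec Q t b \<in> \<tau>" using mem cell_idx(11)[OF c(1)] by blast
    then show ?thesis using vec_absorb[OF b c(3,2) \<tau>(1)] by blast
  next
    case True
    then have ab: "b = a" using cell_idx(10)[OF c(1)] by simp
    have "conehull (im t b) \<subseteq> conehull (vec Q t ` rays Q b)"
      using conehull_im_subset[OF b c(3,2) finite_rays _ rays_le supp_rays[OF b]] rays_idx by blast
    also have "\<dots> \<subseteq> conehull \<tau>" using mem ab by (intro conehull_mono) auto
    finally have "rof g \<in> conehull \<tau>" if "g \<in> im t b" for g using conehull_base[OF that] by blast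
    moreover have "im t b \<subseteq> mon Q t" using im_face[OF c(2) b c(3)] by (simp add: mface_def)
    ultimately show ?thesis using mface_conehull_mem[OF toric[OF c(3)] \<tau>(1)] by blast
  qed
qed

text \<open>The top is the smallest face containing the point, which is intrinsic to the
  point.\<close>

lemma cell_same_top:
  fixes p p' :: "'a \<Rightarrow> real"
  assumes c: "cell Q a S b" "le Q b t" "t \<in> idx Q" and c': "cell Q a' S' b'" "le Q b' t"
    and p: "\<And>v. v \<in> verts Q a S \<Longrightarrow> p v > 0" and p': "\<And>v. v \<in> verts Q a' S' \<Longrightarrow> p' v > 0"
    and eq: "(\<lambda>i. \<Sum>v\<in>verts Q a S. p v * of_int (vec Q t v i)) = (\<lambda>i. \<Sum>v\<in>verts Q a' S'. p' v * of_int (vec Q t v i))"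
  shows "b = b'"
proof -
  note b = cell_idx(2)[OF c(1)] cell_idx(2)[OF c'(1)]
  have "(\<lambda>i. \<Sum>v\<in>verts Q a' S'. p' v * of_int (vec Q t v i)) \<in> conehull (im t b')"
    using verts_cell[OF c'(1)] p' b c c' by (intro combination_im) (auto simp: less_imp_le)
  then have "im t b \<subseteq> im t b'"
    using cell_minface[where p = p, OF c p im_face[OF c'(2) b(2) c(3)]] unfolding eq by blast
  moreover have "(\<lambda>i. \<Sum>v\<in>verts Q a S. p v * of_int (vec Q t v i)) \<in> conehull (im t b)"
    using verts_cell[OF c(1)] p b c c' by (intro combination_im) (auto simp: less_imp_le)
  then have "im t b' \<subseteq> im t b"
    using cell_minface[where p = p', OF c' c(3) p' im_face[OF c(2) b(1) c(3)]] unfolding eq by blast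
  ultimately show ?thesis using face_index_unique[OF b c(3,2) c'(2)] by blast
qed

text \<open>Both cells have the same top. Two different coefficients at its centre would place a
  positive multiple of that centre, plus a point of the big cone, in the cone over a proper face; so
  the coefficients agree, and removing this vertex leaves shorter chains.\<close>

lemma cell_unique:
  fixes p p' :: "'a \<Rightarrow> real"
  assumes "cell Q a S b" "le Q b t" "t \<in> idx Q" and "cell Q a' S' b'" "le Q b' t"
    and "\<And>v. v \<in> verts Q a S \<Longrightarrow> p v > 0" and "\<And>v. v \<in> verts Q a' S' \<Longrightarrow> p' v > 0"
    and "(\<lambda>i. \<Sum>v\<in>verts Q a S. p v * of_int (vec Q t v i)) = (\<lambda>i. \<Sum>v\<in>verts Q a' S'. p' v * of_int (vec Q t v i))"
  shows "a = a' \<and> S = S'"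
  using assms
proof (induction arbitrary: a' S' b')
  case (base a)
  have top: "a = b'" using cell_same_top[OF cell.base[OF base(1,2)] base.prems(1-7)] .
  \<comment> \<open>The common top is simplicial, so it cannot belong to \<open>S'\<close>; hence
    that chain is empty.\<close>
  show ?case
    using cell_idx(7,10,11)[OF base.prems(3)] top base(2) by blast
next
  case (step a S b c)
  have top: "c = b'" using cell_same_top[OF cell.step[OF step(1-5)] step.prems(1-7)] .
  from step.prems(3) show ?case
  proof cases
    case base
    then show ?thesis using top step(5) by simp
  next
    case (step T b'')
    note c' = \<open>cell Q a' T b''\<close> \<open>le Q b'' b'\<close> \<open>b'' \<noteq> b'\<close>
    note b = cell_idx(2)[OF step.hyps(1)] cell_idx(2)[OF c'(1)]
    have bt: "le Q b t" "le Q b'' t" using b step.prems step.hyps c' le_trans top by blast+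
    have S': "S' = insert c T" using \<open>S' = insert b' T\<close> top by simp
    have notin: "c \<notin> verts Q a S" "c \<notin> verts Q a' T"
      using top_not_vert step.hyps c' top by blast+
    note V = verts_cell[OF step.hyps(1)] and V' = verts_cell[OF c'(1)]
    let ?y = "\<lambda>i. \<Sum>v\<in>verts Q a S. p v * of_int (vec Q t v i)"
    let ?y' = "\<lambda>i. \<Sum>v\<in>verts Q a' T. p' v * of_int (vec Q t v i)"
    have ins: "verts Q a (insert c S) = insert c (verts Q a S)" "verts Q a' (insert c T) = insert c (verts Q a' T)" by auto
    have eq: "p c * of_int (vec Q t c i) + ?y i = p' c * of_int (vec Q t c i) + ?y' i" for i
      using fun_cong[OF step.prems(7), of i] notin V(1) V'(1) unfolding S' ins by simp
    have pos: "\<And>v. v \<in> verts Q a S \<Longrightarrow> p v > 0" "\<And>v. v \<in> verts Q a' T \<Longrightarrow> p' v > 0"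
      using step.prems(5,6) S' by auto
    have y: "?y \<in> conehull (im t b)" "?y' \<in> conehull (im t b'')"
      using V V' pos b bt step.prems by (auto intro!: combination_im simp: less_imp_le)
    have ys: "?y \<in> supp (mon Q t)" "?y' \<in> supp (mon Q t)"
      using y im_face[OF bt(1) b(1) step.prems(2)] im_face[OF bt(2) b(2) step.prems(2)]
        conehull_mono[of "im t b" "mon Q t"] conehull_mono[of "im t b''" "mon Q t"]
      by (auto simp: supp_def mface_def)
    have "\<not> p c < p' c"
    proof
      assume "p c < p' c"
      moreover have "?y = (\<lambda>i. (p' c - p c) * of_int (vec Q t c i) + ?y' i)"
      proof
        fix i show "?y i = (p' c - p c) * of_int (vec Q t c i) + ?y' i"
          using eq[of i] unfolding left_diff_distrib by linarith
      qed
      ultimately show False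
        using not_in_lower[OF b(1) step.hyps(2) step.prems(2) step.hyps(3,4) step.prems(1) _ ys(2), of "p' c - p c"] y(1)
        by (metis diff_gt_0_iff_gt)
    qed
    moreover have "\<not> p' c < p c"
    proof
      assume "p' c < p c"
      moreover have "?y' = (\<lambda>i. (p c - p' c) * of_int (vec Q t c i) + ?y i)"
      proof
        fix i show "?y' i = (p c - p' c) * of_int (vec Q t c i) + ?y i"
          using eq[of i] unfolding left_diff_distrib by linarith
      qed
      ultimately show False
        using not_in_lower[OF b(2) step.hyps(2) step.prems(2) c'(2)[folded top] c'(3)[folded top] step.prems(1) _ ys(1), of "p c - p' c"] y(2)
        by (metis diff_gt_0_iff_gt)
    qed
    ultimately have "p c = p' c" by simp
    then have "?y = ?y'" using eq by (intro ext) simp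
    then have "a = a' \<and> S = T"
      using step.IH[OF bt(1) step.prems(2) c'(1) bt(2) pos] by blast
    then show ?thesis using S' by simp
  qed
qed

text \<open>The cell found has top exactly \<open>t\<close>, even for a boundary point, since a
  refinement has to cover each cone by the cells lying over its own index. The coefficient of the
  centre may then be zero.\<close>

lemma cell_cover:
  assumes "t \<in> idx Q" "x \<in> supp (mon Q t)"
  shows "\<exists>a S. cell Q a S t \<and> x \<in> conehull (vec Q t ` verts Q a S)"
  using assms
proof (induction arbitrary: x rule: idx_induct)
  case (less t)
  note tor = toric[OF less(1)]
  show ?case
  proof (cases "simplicial Q t")
    case True
    then show ?thesis
      using cell.base[OF less(1)] supp_rays[OF less(1)] less(3) by (intro exI[of _ t] exI[of _ "{}"]) auto
  next
    case False
    let ?w = "rof (vec Q t t)"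
    have mem: "vec Q t t \<in> mon Q t" using vec_mem less(1) le_refl by blast
    \<comment> \<open>A zero centre would lie in the zero face and force the monoid to be zero;
      without rays it would be simplicial.\<close>
    have "vec Q t t \<noteq> (\<lambda>i. 0)"
    proof
      assume "vec Q t t = (\<lambda>i. 0)"
      then have z: "mon Q t = {\<lambda>i. 0}"
        using center_interior[OF tor] mface_zero[OF tor] unfolding vec_self[OF less(1)]
        by (metis singletonI)
      have "rays Q t = {}"
      proof (rule ccontr)
        assume "rays Q t \<noteq> {}"
        then obtain r where r: "r \<in> rays Q t" by blast
        then have "vec Q t r = (\<lambda>i. 0)"
          using vec_mem[OF rays_idx less(1) rays_le] z by blast
        then show False using vec_ray_nonzero[OF r less(1)] by simp
      qed
      then show False using False by (simp add: simplicial_def indep_def)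
    qed
    then have "?w \<noteq> (\<lambda>i. 0)" by (auto simp: rof_def fun_eq_iff)
    moreover have "?w \<in> supp (mon Q t)" using conehull_base[OF mem] by (simp add: supp_def)
    ultimately obtain k \<tau> where k: "k \<ge> 0" "mface \<tau> (mon Q t)" "\<tau> \<noteq> mon Q t" "(\<lambda>i. x i - k * ?w i) \<in> conehull \<tau>"
      using toric_exit_face[OF tor less(3), of ?w] by metis
    obtain b where b: "b \<in> idx Q" "le Q b t" "im t b = \<tau>" using face_ex1[OF less(1) k(2)] by blast
    with k(3) im_self[OF less(1)] have ne: "b \<noteq> t" by auto
    let ?z = "\<lambda>i. x i - k * ?w i"
    \<comment> \<open>The boundary point is pulled back to the monoid of \<open>b\<close>, where the
      induction hypothesis finds a cell; the resulting presentation is pushed forward to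
      \<open>t\<close>.\<close>
    obtain y where y: "y \<in> supp (mon Q b)"
      "\<And>V c. finite V \<Longrightarrow> V \<subseteq> idx Q \<Longrightarrow> (\<And>v. v \<in> V \<Longrightarrow> le Q v b) \<Longrightarrow>
        y = (\<lambda>i. \<Sum>v\<in>V. c v * of_int (vec Q b v i)) \<Longrightarrow> ?z = (\<lambda>i. \<Sum>v\<in>V. c v * of_int (vec Q t v i))"
      using lift_vec[OF b(1) less(1) b(2)] k(4)[folded b(3)] by blast
    obtain a S where c: "cell Q a S b" "y \<in> conehull (vec Q b ` verts Q a S)"
      using less(2)[OF b(1,2) ne y(1)] by blast
    note V = verts_cell[OF c(1)]
    obtain e where e: "\<forall>v\<in>verts Q a S. 0 \<le> e v" "y = (\<lambda>i. \<Sum>v\<in>verts Q a S. e v * of_int (vec Q b v i))"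
      using c(2) unfolding conehull_image[OF V(1)] by blast
    have "?z \<in> conehull (vec Q t ` verts Q a S)"
      unfolding conehull_image[OF V(1)] using y(2)[OF V e(2)] e(1) by blast
    then have z: "?z \<in> conehull (vec Q t ` verts Q a (insert t S))"
      using conehull_mono[of "vec Q t ` verts Q a S" "vec Q t ` verts Q a (insert t S)"] by blast
    have "(\<lambda>i. k * ?w i + ?z i) \<in> conehull (vec Q t ` verts Q a (insert t S))"
      using z k(1) by (intro conehull_add conehull_scale conehull_base) auto
    then have "x \<in> conehull (vec Q t ` verts Q a (insert t S))" by simp
    then show ?thesis using cell.step[OF c(1) less(1) b(2) ne False] by blast
  qed
qed

section \<open>Faces of cells\<close>

lemma cell_top_unique:
  assumes "cell Q a S t" "cell Q a S t'"
  shows "t = t'"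
proof (cases "S = {}")
  case True
  then show ?thesis using cell_idx(10)[OF assms(1)] cell_idx(10)[OF assms(2)] by simp
next
  case False
  then have "le Q t t'" "le Q t' t"
    using cell_idx(9)[OF assms(1)] cell_idx(9)[OF assms(2)] cell_idx(11)[OF assms(1)] cell_idx(11)[OF assms(2)] by blast+
  then show ?thesis using le_antisym cell_idx(2)[OF assms(1)] cell_idx(2)[OF assms(2)] by blast
qed

lemma cell_top_mono:
  assumes "cell Q a S t" "cell Q a' S' t'" "le Q a a'" "S \<subseteq> S'"
  shows "le Q t t'"
  using cell_idx[OF assms(1)] cell_idx[OF assms(2)] assms(3,4) le_trans[of a a' t'] by blast

text \<open>Cells are closed under passing to faces: smaller bases inherit simpliciality, and
  dropping members of a chain leaves a chain, possibly with a lower top.\<close>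

lemma cell_sub:
  assumes "cell Q a S t" "S' \<subseteq> S" "le Q a' a" "a' \<in> idx Q"
  shows "\<exists>t'. cell Q a' S' t' \<and> le Q t' t"
  using assms
proof (induction arbitrary: S')
  case (base a)
  then have "cell Q a' {} a'" using simplicial_mono[OF base(2) _ _ base(1)] by (intro cell.base)
  then show ?case using base.prems by auto
next
  case (step a S b c)
  note b = cell_idx(2)[OF step(1)]
  show ?case
  proof (cases "c \<in> S'")
    case False
    then have "S' \<subseteq> S" using step.prems by blast
    then obtain t' where t': "cell Q a' S' t'" "le Q t' b" using step.IH step.prems by blast
    then show ?thesis using le_trans[OF _ step(3) cell_idx(2)[OF t'(1)] b step(2)] by blast
  next
    case True
    then have "S' - {c} \<subseteq> S" using step.prems by blast
    then obtain t' where t': "cell Q a' (S' - {c}) t'" "le Q t' b" using step.IH step.prems by blast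
    then have "le Q t' c" using le_trans[OF _ step(3) cell_idx(2)[OF t'(1)] b step(2)] by blast
    moreover have "t' \<noteq> c" using t'(2) step(3,4) le_antisym b step(2) by blast
    ultimately have "cell Q a' (insert c (S' - {c})) c" using cell.step[OF t'(1) step(2) _ _ step(5)] by blast
    then show ?thesis using True le_refl[OF step(2)] by (auto simp: insert_absorb)
  qed
qed

text \<open>A face is recovered from its rays because they span its cone.\<close>

lemma rays_inj:
  assumes "a \<in> idx Q" "a' \<in> idx Q" "t \<in> idx Q" "le Q a t" "le Q a' t" "rays Q a = rays Q a'"
  shows "a = a'"
proof -
  have *: "im t a \<subseteq> im t a'" if a: "a \<in> idx Q" "a' \<in> idx Q" "le Q a t" "le Q a' t" "rays Q a = rays Q a'" for a a'
  proof -
    have "conehull (im t a) \<subseteq> conehull (vec Q t ` rays Q a)"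
      using conehull_im_subset[OF a(1) assms(3) a(3) finite_rays _ rays_le supp_rays[OF a(1)]] rays_idx by blast
    also have "\<dots> \<subseteq> conehull (im t a')"
    proof (rule conehull_mono)
      show "vec Q t ` rays Q a \<subseteq> im t a'"
        using vec_mem_im[of _ t] im_mono[of _ a' t] rays_idx rays_le a assms(3) by blast
    qed
    finally have "rof g \<in> conehull (im t a')" if "g \<in> im t a" for g using conehull_base[OF that] by blast
    moreover have "im t a \<subseteq> mon Q t" using im_face[OF a(3,1) assms(3)] by (simp add: mface_def)
    ultimately show ?thesis using mface_conehull_mem[OF toric[OF assms(3)] im_face[OF a(4,2) assms(3)]] by blast
  qed
  show ?thesis
    using *[of a a'] *[of a' a] face_index_unique[OF assms(1-5)] assms by blast
qed

text \<open>Independence gives each point unique coordinates on the rays. In a sum supported on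
  \<open>W\<close> the nonnegative coordinates of the summands outside \<open>W\<close> add up to
  zero and hence vanish, so the lattice points over \<open>W\<close> form a face.\<close>

lemma simplicial_face:
  assumes a: "a \<in> idx Q" "simplicial Q a" and W: "W \<subseteq> rays Q a"
  shows "\<exists>a'. a' \<in> idx Q \<and> le Q a' a \<and> rays Q a' = W"
proof -
  let ?\<tau> = "{v\<in>mon Q a. rof v \<in> conehull (vec Q a ` W)}"
  have finW: "finite W" using W finite_rays finite_subset by blast
  have ind: "indep (rays Q a) (vec Q a)" using a by (simp add: simplicial_def)
  have extend: "\<exists>e. (\<forall>r\<in>rays Q a. 0 \<le> e r) \<and> (\<forall>r\<in>rays Q a - W. e r = 0) \<and>
      x = (\<lambda>i. \<Sum>r\<in>rays Q a. e r * of_int (vec Q a r i))" if x: "x \<in> conehull (vec Q a ` W)" for x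
  proof -
    obtain c where c: "\<forall>r\<in>W. 0 \<le> c r" "x = (\<lambda>i. \<Sum>r\<in>W. c r * of_int (vec Q a r i))"
      using x unfolding conehull_image[OF finW] by blast
    have "x = (\<lambda>i. \<Sum>r\<in>rays Q a. (if r \<in> W then c r else 0) * of_int (vec Q a r i))"
      unfolding c(2) using W by (intro ext sum.mono_neutral_cong_left) (auto simp: finite_rays)
    then show ?thesis using c(1) by (intro exI[of _ "\<lambda>r. if r \<in> W then c r else 0"]) auto
  qed
  have left: "v \<in> ?\<tau>" if v: "v \<in> mon Q a" and w: "w \<in> mon Q a" and vw: "vadd v w \<in> ?\<tau>" for v w
  proof -
    obtain c where c: "\<forall>r\<in>rays Q a. 0 \<le> c r" "rof v = (\<lambda>i. \<Sum>r\<in>rays Q a. c r * of_int (vec Q a r i))"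
      using subsetD[OF supp_rays[OF a(1)], of "rof v"] conehull_base[OF v]
      unfolding supp_def conehull_image[OF finite_rays] by auto
    obtain d where d: "\<forall>r\<in>rays Q a. 0 \<le> d r" "rof w = (\<lambda>i. \<Sum>r\<in>rays Q a. d r * of_int (vec Q a r i))"
      using subsetD[OF supp_rays[OF a(1)], of "rof w"] conehull_base[OF w]
      unfolding supp_def conehull_image[OF finite_rays] by auto
    obtain e where e: "\<forall>r\<in>rays Q a - W. e r = 0" "rof (vadd v w) = (\<lambda>i. \<Sum>r\<in>rays Q a. e r * of_int (vec Q a r i))"
      using extend vw by blast
    have "(\<lambda>i. \<Sum>r\<in>rays Q a. (c r + d r) * of_int (vec Q a r i)) = (\<lambda>i. rof v i + rof w i)"
      unfolding c(2) d(2) by (simp add: distrib_right sum.distrib)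
    also have "\<dots> = rof (vadd v w)" by (simp add: rof_def vadd_def)
    finally have "c r + d r = e r" if "r \<in> rays Q a" for r
      using indep_eqD[OF ind _ that, of "\<lambda>r. c r + d r" e] e(2) by simp
    then have "c r = 0" if "r \<in> rays Q a - W" for r using that e(1) c(1) d(1)
      by (metis DiffD1 add_nonneg_eq_0_iff)
    then have "rof v = (\<lambda>i. \<Sum>r\<in>W. c r * of_int (vec Q a r i))"
      unfolding c(2) using W by (intro ext sum.mono_neutral_right) (auto simp: finite_rays)
    then have "rof v \<in> conehull (vec Q a ` W)"
      unfolding conehull_image[OF finW] using c(1) W by (intro exI[of _ c]) auto
    then show ?thesis using v by simp
  qed
  have "mface ?\<tau> (mon Q a)"
    unfolding mface_def
  proof (intro conjI ballI impI)
    show "(\<lambda>i. 0) \<in> ?\<tau>" using sub[OF a(1)] conehull_zero by (simp add: submonoid_def rof_def)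
    show "vadd x y \<in> ?\<tau>" if "x \<in> ?\<tau>" "y \<in> ?\<tau>" for x y
      using that sub[OF a(1)] conehull_add[of "rof x" _ "rof y"] by (auto simp: submonoid_def rof_def vadd_def)
    show "v \<in> ?\<tau>" "w \<in> ?\<tau>" if "v \<in> mon Q a" "w \<in> mon Q a" "vadd v w \<in> ?\<tau>" for v w
    proof -
      have "vadd w v = vadd v w" by (auto simp: vadd_def)
      then show "v \<in> ?\<tau>" "w \<in> ?\<tau>" using left[of v w] left[of w v] that by simp_all
    qed
  qed auto
  then obtain a' where a': "a' \<in> idx Q" "le Q a' a" "im a a' = ?\<tau>" using face_ex1[OF a(1)] by blast
  have "r \<in> rays Q a'" if r: "r \<in> W" for r
  proof -
    have ra: "r \<in> idx Q" "le Q r a" "is_ray (mon Q r)" using r W by (auto simp: rays_def)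
    have "vec Q a r \<in> im a a'"
      unfolding a'(3) using vec_mem[OF ra(1) a(1) ra(2)] conehull_base[of "vec Q a r"] r by blast
    then have "im a r \<subseteq> im a a'" using vec_absorb[OF ra(1) a(1) ra(2) im_face[OF a'(2,1) a(1)]] by blast
    then show ?thesis using im_le[OF ra(1) a'(1) a(1) ra(2) a'(2)] ra by (simp add: rays_def)
  qed
  moreover have "r \<in> W" if r: "r \<in> rays Q a'" for r
  proof (rule ccontr)
    assume nW: "r \<notin> W"
    have ra: "r \<in> idx Q" "le Q r a'" "r \<in> rays Q a"
      using r rays_idx rays_le rays_mono[OF a'(2,1) a(1)] by blast+
    have "vec Q a r \<in> ?\<tau>"
      using vec_mem_im[OF ra(1), of a] im_mono[OF ra(2) a'(2) ra(1) a'(1) a(1)] a'(3) by blast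
    then obtain e where e: "\<forall>r\<in>rays Q a - W. e r = 0" "rof (vec Q a r) = (\<lambda>i. \<Sum>r\<in>rays Q a. e r * of_int (vec Q a r i))"
      using extend by blast
    \<comment> \<open>The presentation supported on \<open>W\<close> is compared with the trivial
      one, in which \<open>r\<close> has coefficient 1.\<close>
    have "(\<lambda>i. \<Sum>s\<in>rays Q a. (if s = r then 1 else 0) * of_int (vec Q a s i)) = rof (vec Q a r)"
      using ra(3) finite_rays by (simp add: rof_def if_distrib[of "\<lambda>z. z * _"] cong: if_cong)
    then have "(1 :: real) = e r"
      using indep_eqD[OF ind _ ra(3), of "\<lambda>s. if s = r then 1 else 0" e] e(2) by simp
    then show False using e(1) ra(3) nW by simp
  qed
  ultimately show ?thesis using a' by blast
qed

end

section \<open>Free monoids\<close>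

definition orth :: "nat \<Rightarrow> zv set" where
  "orth d = {x. zvec d x \<and> (\<forall>i. 0 \<le> x i)}"

definition unit_vec :: "nat \<Rightarrow> zv" where
  "unit_vec j = (\<lambda>i. if i = j then 1 else 0)"

lemma unit_vec_mem: "j < d \<Longrightarrow> unit_vec j \<in> orth d"
  by (auto simp: orth_def unit_vec_def zvec_def)

lemma sum_unit_vec:
  fixes c :: "nat \<Rightarrow> 'r :: comm_ring_1"
  shows "(\<Sum>j<d. c j * of_int (unit_vec j i)) = (if i < d then c i else 0)"
  by (simp add: unit_vec_def if_distrib[of of_int] if_distrib[of "\<lambda>z. _ * z"] cong: if_cong)

lemma conehull_unit_vec:
  "x \<in> conehull (unit_vec ` {..<d}) \<longleftrightarrow> rvec d x \<and> (\<forall>i. 0 \<le> x i)"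
proof
  assume "x \<in> conehull (unit_vec ` {..<d})"
  then obtain c where "\<forall>j\<in>{..<d}. 0 \<le> c j" "x = (\<lambda>i. \<Sum>j<d. c j * of_int (unit_vec j i))"
    using conehull_image[of "{..<d}" x unit_vec] by auto
  then show "rvec d x \<and> (\<forall>i. 0 \<le> x i)" by (auto simp: sum_unit_vec rvec_def)
next
  assume x: "rvec d x \<and> (\<forall>i. 0 \<le> x i)"
  then have "x = (\<lambda>i. \<Sum>j<d. x j * of_int (unit_vec j i))" by (auto simp: sum_unit_vec rvec_def)
  with x have "\<exists>c. (\<forall>j\<in>{..<d}. 0 \<le> c j) \<and> x = (\<lambda>i. \<Sum>j<d. c j * of_int (unit_vec j i))" by blast
  then show "x \<in> conehull (unit_vec ` {..<d})" by (simp add: conehull_image)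
qed

lemma rof_orth: "x \<in> orth d \<Longrightarrow> rof x \<in> conehull (unit_vec ` {..<d})"
  by (simp add: conehull_unit_vec orth_def rvec_rof) (simp add: rof_def)

lemma orth_toric: "toric_monoid (orth d)"
  unfolding toric_monoid_def
proof (intro exI[of _ d] exI[of _ "unit_vec ` {..<d}"] conjI allI impI)
  show "\<exists>y\<in>conehull (unit_vec ` {..<d}). \<exists>z\<in>conehull (unit_vec ` {..<d}). x = (\<lambda>i. y i - z i)"
    if "rvec d x" for x
    using that
    by (intro bexI[of _ "\<lambda>i. max 0 (x i)"] bexI[of _ "\<lambda>i. max 0 (- x i)"])
      (auto simp: conehull_unit_vec rvec_def max_def)
  show "x = (\<lambda>i. 0)" if "x \<in> conehull (unit_vec ` {..<d}) \<and> (\<lambda>i. - x i) \<in> conehull (unit_vec ` {..<d})" for x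
    using that by (auto simp: conehull_unit_vec intro!: ext order_antisym)
  show "orth d = {v. zvec d v \<and> rof v \<in> conehull (unit_vec ` {..<d})}"
    using rof_orth by (auto simp: orth_def conehull_unit_vec rof_def)
qed (auto simp: zvec_def unit_vec_def)

lemma supp_orth: "x \<in> supp (orth d) \<longleftrightarrow> rvec d x \<and> (\<forall>i. 0 \<le> x i)"
proof
  assume "x \<in> supp (orth d)"
  then have "x \<in> conehull (unit_vec ` {..<d})"
    unfolding supp_def
    using conehull_subset[of "orth d" "unit_vec ` {..<d}"] by (auto simp: rof_orth)
  then show "rvec d x \<and> (\<forall>i. 0 \<le> x i)" by (simp add: conehull_unit_vec)
next
  assume "rvec d x \<and> (\<forall>i. 0 \<le> x i)"
  then have "x \<in> conehull (unit_vec ` {..<d})" by (simp add: conehull_unit_vec)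
  moreover have "unit_vec ` {..<d} \<subseteq> orth d" using unit_vec_mem by auto
  ultimately show "x \<in> supp (orth d)" using conehull_mono unfolding supp_def by blast
qed

lemma orth_expand: "x \<in> orth d \<Longrightarrow> x = (\<lambda>i. \<Sum>j<d. int (nat (x j)) * unit_vec j i)"
  using sum_unit_vec[of "\<lambda>j. int (nat (x j))" _ d] by (auto simp: orth_def zvec_def)

text \<open>If a coordinate of an element is nonzero, the corresponding unit vector is a summand of
  it; so a face is generated by the unit vectors it contains.\<close>

lemma mface_orth:
  assumes "mface \<tau> (orth d)"
  shows "\<exists>I\<subseteq>{..<d}. \<tau> = {x\<in>orth d. \<forall>i. i \<notin> I \<longrightarrow> x i = 0}"
proof -
  let ?I = "{j. j < d \<and> unit_vec j \<in> \<tau>}"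
  note sub = mface_submonoid[OF assms]
  have "x i = 0" if x: "x \<in> \<tau>" and i: "i \<notin> ?I" for x i
  proof (rule ccontr)
    assume nz: "x i \<noteq> 0"
    have xo: "x \<in> orth d" using x assms by (auto simp: mface_def)
    then have id: "i < d" using nz by (auto simp: orth_def zvec_def not_less[symmetric])
    have "x i \<ge> 1" using nz xo by (auto simp: orth_def dest: spec[of _ i])
    then have "(\<lambda>j. x j - unit_vec i j) \<in> orth d" using xo id by (auto simp: orth_def zvec_def unit_vec_def)
    moreover have "vadd (unit_vec i) (\<lambda>j. x j - unit_vec i j) \<in> \<tau>" using x by (simp add: vadd_def)
    ultimately have "unit_vec i \<in> \<tau>" using assms unit_vec_mem[OF id] unfolding mface_def by blast
    then show False using i id by simp
  qed
  moreover have "x \<in> \<tau>" if x: "x \<in> orth d" "\<forall>i. i \<notin> ?I \<longrightarrow> x i = 0" for x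
  proof -
    have "x = (\<lambda>i. \<Sum>j<d. int (nat (x j)) * unit_vec j i)" using orth_expand[OF x(1)] .
    also have "\<dots> = (\<lambda>i. \<Sum>j\<in>?I. int (nat (x j)) * unit_vec j i)"
      using x(2) by (intro ext sum.mono_neutral_right) auto
    also have "\<dots> \<in> \<tau>" by (intro submonoid_sum[OF sub]) auto
    finally show ?thesis .
  qed
  moreover have "\<tau> \<subseteq> orth d" using assms by (simp add: mface_def)
  ultimately have "\<tau> = {x\<in>orth d. \<forall>i. i \<notin> ?I \<longrightarrow> x i = 0}" by blast
  moreover have "?I \<subseteq> {..<d}" by auto
  ultimately show ?thesis by blast
qed

lemma mface_orth_coord: "mface {x\<in>orth d. \<forall>i. i \<notin> I \<longrightarrow> x i = 0} (orth d)"
  unfolding mface_def by (auto simp: orth_def zvec_def vadd_def add_nonneg_eq_0_iff)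

lemma extremal_orth: "{e. extremal (orth d) e} = unit_vec ` {..<d}"
proof (intro equalityI subsetI)
  fix e assume "e \<in> unit_vec ` {..<d}"
  then obtain j where j: "j < d" "e = unit_vec j" by auto
  have ray: "x \<in> ray e \<and> y \<in> ray e"
    if x: "x \<in> supp (orth d)" and y: "y \<in> supp (orth d)" and xy: "(\<lambda>i. x i + y i) \<in> ray e" for x y
  proof -
    obtain t where t: "(\<lambda>i. x i + y i) = (\<lambda>i. t * of_int (e i))" using xy by (auto simp: ray_def)
    have nn: "0 \<le> x i" "0 \<le> y i" for i using x y by (auto simp: supp_orth)
    have "x i = 0 \<and> y i = 0" if "i \<noteq> j" for i
      using fun_cong[OF t, of i] that j nn[of i] by (simp add: unit_vec_def add_nonneg_eq_0_iff)
    then have "x = (\<lambda>i. x j * of_int (e i))" "y = (\<lambda>i. y j * of_int (e i))"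
      using j by (auto simp: unit_vec_def)
    then show ?thesis using nn unfolding ray_def by blast
  qed
  have prim: "k = 1" if "e = (\<lambda>i. int k * f i)" for f k
  proof -
    have "1 = int k * f j" using fun_cong[OF that, of j] j by (simp add: unit_vec_def)
    then show ?thesis by (metis zmult_eq_1_iff of_nat_eq_1_iff of_nat_0_le_iff zero_le_one neg_0_le_iff_le not_one_le_zero)
  qed
  show "e \<in> {e. extremal (orth d) e}"
  proof -
    have "e \<in> orth d" using unit_vec_mem[OF j(1)] j(2) by simp
    moreover have "e \<noteq> (\<lambda>i. 0)" using j(2) by (auto simp: unit_vec_def dest: fun_cong[of _ _ j])
    ultimately show ?thesis using ray prim unfolding extremal_def by blast
  qed
next
  fix e assume "e \<in> {e. extremal (orth d) e}"
  then have e: "e \<in> orth d" "e \<noteq> (\<lambda>i. 0)"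
    and ray: "\<And>x y. x \<in> supp (orth d) \<Longrightarrow> y \<in> supp (orth d) \<Longrightarrow> (\<lambda>i. x i + y i) \<in> ray e \<Longrightarrow> x \<in> ray e"
    and prim: "\<And>e' k. e' \<in> orth d \<Longrightarrow> e = (\<lambda>i. int k * e' i) \<Longrightarrow> k = 1"
    by (auto simp: extremal_def)
  from e(2) obtain j where j: "e j \<noteq> 0" by (auto simp: fun_eq_iff)
  then have jd: "j < d" using e(1) by (auto simp: orth_def zvec_def not_less[symmetric])
  have nn: "0 \<le> e i" for i using e(1) by (simp add: orth_def)
  \<comment> \<open>Splitting off one nonzero coordinate forces \<open>e\<close> to be a multiple of
    \<open>unit_vec j\<close>, and primitivity makes the factor 1.\<close>
  let ?x = "\<lambda>i. real_of_int (e j) * of_int (unit_vec j i)"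
  have "?x \<in> ray e"
  proof (rule ray[of _ "\<lambda>i. of_int (e i) - ?x i"])
    show "?x \<in> supp (orth d)" using jd nn by (auto simp: supp_orth rvec_def unit_vec_def)
    have "\<forall>i\<ge>d. e i = 0" using e(1) by (simp add: orth_def zvec_def)
    then show "(\<lambda>i. of_int (e i) - ?x i) \<in> supp (orth d)"
      using jd nn by (auto simp: supp_orth rvec_def unit_vec_def)
    show "(\<lambda>i. ?x i + (of_int (e i) - ?x i)) \<in> ray e" by (auto simp: ray_def intro!: exI[of _ 1])
  qed
  then obtain t where t: "?x = (\<lambda>i. t * of_int (e i))" by (auto simp: ray_def)
  have "t = 1" using fun_cong[OF t, of j] j by (simp add: unit_vec_def)
  then have "real_of_int (e i) = real_of_int (e j * unit_vec j i)" for i using fun_cong[OF t, of i] by simp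
  then have "e i = e j * unit_vec j i" for i by (rule of_int_eq_iff[THEN iffD1])
  then have eq: "e = (\<lambda>i. int (nat (e j)) * unit_vec j i)" unfolding nat_0_le[OF nn] by (rule ext)
  then have "nat (e j) = 1" using prim[OF unit_vec_mem[OF jd]] by blast
  then have "e = unit_vec j" using eq by simp
  then show "e \<in> unit_vec ` {..<d}" using jd by blast
qed

lemma inj_unit_vec: "inj unit_vec"
  by (rule injI) (metis unit_vec_def zero_neq_one)

lemma orth_smooth: "smooth (orth d)"
  unfolding smooth_def extremal_orth
proof (intro conjI ballI)
  fix v assume v: "v \<in> orth d"
  have sum: "(\<Sum>e\<in>unit_vec ` {..<d}. int (c e) * e i) = (if i < d then int (c (unit_vec i)) else 0)"
    for c :: "zv \<Rightarrow> nat" and i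
    using sum_unit_vec[of "\<lambda>j. int (c (unit_vec j))" i d]
    by (subst sum.reindex) (auto simp: inj_on_subset[OF inj_unit_vec])
  have ext: "extremal (orth d) e \<longleftrightarrow> e \<in> unit_vec ` {..<d}" for e using extremal_orth by blast
  let ?c = "\<lambda>e. if e \<in> unit_vec ` {..<d} then nat (v (inv unit_vec e)) else 0"
  show "\<exists>!c. (\<forall>e. \<not> extremal (orth d) e \<longrightarrow> c e = 0) \<and> v = (\<lambda>i. \<Sum>e\<in>unit_vec ` {..<d}. int (c e) * e i)"
  proof (rule ex1I[of _ ?c])
    show "(\<forall>e. \<not> extremal (orth d) e \<longrightarrow> ?c e = 0) \<and> v = (\<lambda>i. \<Sum>e\<in>unit_vec ` {..<d}. int (?c e) * e i)"
      unfolding sum ext using v by (auto simp: orth_def zvec_def inv_f_f[OF inj_unit_vec])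
    fix c :: "zv \<Rightarrow> nat"
    assume c: "(\<forall>e. \<not> extremal (orth d) e \<longrightarrow> c e = 0) \<and> v = (\<lambda>i. \<Sum>e\<in>unit_vec ` {..<d}. int (c e) * e i)"
    then have v': "v = (\<lambda>i. if i < d then int (c (unit_vec i)) else 0)" unfolding sum by simp
    show "c = ?c"
    proof
      fix e show "c e = ?c e"
      proof (cases "e \<in> unit_vec ` {..<d}")
        case True
        then obtain j where "j < d" "e = unit_vec j" by auto
        then show ?thesis using v' by (auto simp: inv_f_f[OF inj_unit_vec])
      qed (use c ext in auto)
    qed
  qed
qed auto

section \<open>Free monoids on finite vertex sets\<close>

definition enum :: "'a set \<Rightarrow> nat \<Rightarrow> 'a" where
  "enum V = (SOME f. bij_betw f {..<card V} V)"

definition pos :: "'a set \<Rightarrow> 'a \<Rightarrow> nat" where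
  "pos V = inv_into {..<card V} (enum V)"

lemma enum_bij: "finite V \<Longrightarrow> bij_betw (enum V) {..<card V} V"
  unfolding enum_def using someI_ex[OF ex_bij_betw_nat_finite[of V]] by (simp add: atLeast0LessThan)

lemma enum_mem: "finite V \<Longrightarrow> i < card V \<Longrightarrow> enum V i \<in> V"
  using enum_bij bij_betwE by blast

lemma pos_less: "finite V \<Longrightarrow> v \<in> V \<Longrightarrow> pos V v < card V"
  using enum_bij[of V] bij_betw_inv_into[of "enum V"] bij_betwE unfolding pos_def by blast

lemma enum_pos: "finite V \<Longrightarrow> v \<in> V \<Longrightarrow> enum V (pos V v) = v"
  unfolding pos_def using enum_bij bij_betw_inv_into_right by metis

lemma pos_enum: "finite V \<Longrightarrow> i < card V \<Longrightarrow> pos V (enum V i) = i"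
  unfolding pos_def using enum_bij bij_betw_inv_into_left by (metis lessThan_iff)

text \<open>The numberings of \<open>V\<close> and \<open>V'\<close> are chosen independently, so
  including one vertex set in another renumbers coordinates; new vertices get coefficient 0.\<close>

definition transfer :: "'a set \<Rightarrow> 'a set \<Rightarrow> zv \<Rightarrow> zv" where
  "transfer V V' x = (\<lambda>j. if j < card V' \<and> enum V' j \<in> V then x (pos V (enum V' j)) else 0)"

definition combine :: "'a set \<Rightarrow> ('a \<Rightarrow> zv) \<Rightarrow> zv \<Rightarrow> zv" where
  "combine V u x = (\<lambda>i. \<Sum>v\<in>V. x (pos V v) * u v i)"

lemma orth_eqI:
  assumes "finite V" "x \<in> orth (card V)" "y \<in> orth (card V)" "\<And>v. v \<in> V \<Longrightarrow> x (pos V v) = y (pos V v)"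
  shows "x = y"
proof
  fix i show "x i = y i"
  proof (cases "i < card V")
    case True
    then show ?thesis using assms(4)[OF enum_mem[OF assms(1)]] pos_enum[OF assms(1)] by metis
  next
    case False
    then show ?thesis using assms(2,3) by (simp add: orth_def zvec_def)
  qed
qed

lemma orth_build:
  assumes "finite V" "\<And>v. v \<in> V \<Longrightarrow> 0 \<le> f v"
  obtains x where "x \<in> orth (card V)" "\<And>v. v \<in> V \<Longrightarrow> x (pos V v) = f v"
  by (rule that[of "\<lambda>i. if i < card V then f (enum V i) else 0"])
    (use assms enum_mem in \<open>auto simp: orth_def zvec_def pos_less enum_pos\<close>)

lemma transfer_pos:
  "finite V' \<Longrightarrow> v \<in> V' \<Longrightarrow> transfer V V' x (pos V' v) = (if v \<in> V then x (pos V v) else 0)"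
  by (simp add: transfer_def pos_less enum_pos)

lemma transfer_mem: "x \<in> orth (card V) \<Longrightarrow> transfer V V' x \<in> orth (card V')"
  by (auto simp: transfer_def orth_def zvec_def)

lemma transfer_id: "finite V \<Longrightarrow> x \<in> orth (card V) \<Longrightarrow> transfer V V x = x"
  by (rule orth_eqI[of V]) (auto simp: transfer_mem transfer_pos)

lemma transfer_comp:
  assumes "finite V''" "V \<subseteq> V'" "V' \<subseteq> V''" "x \<in> orth (card V)"
  shows "transfer V' V'' (transfer V V' x) = transfer V V'' x"
  using assms finite_subset[OF assms(3,1)]
  by (intro orth_eqI[of V'']) (auto simp: transfer_mem transfer_pos)

lemma transfer_image:
  assumes "finite V'" "V \<subseteq> V'"
  shows "transfer V V' ` orth (card V) = {y\<in>orth (card V'). \<forall>v\<in>V' - V. y (pos V' v) = 0}"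
proof (intro equalityI subsetI)
  fix y assume "y \<in> transfer V V' ` orth (card V)"
  then show "y \<in> {y\<in>orth (card V'). \<forall>v\<in>V' - V. y (pos V' v) = 0}"
    using assms by (auto simp: transfer_mem transfer_pos)
next
  fix y assume y: "y \<in> {y\<in>orth (card V'). \<forall>v\<in>V' - V. y (pos V' v) = 0}"
  have fin: "finite V" using assms finite_subset by blast
  obtain x where x: "x \<in> orth (card V)" "\<And>v. v \<in> V \<Longrightarrow> x (pos V v) = y (pos V' v)"
    using orth_build[OF fin, of "\<lambda>v. y (pos V' v)"] y by (auto simp: orth_def)
  have "y = transfer V V' x"
    using assms x y by (intro orth_eqI[of V']) (auto simp: transfer_mem transfer_pos)
  then show "y \<in> transfer V V' ` orth (card V)" using x(1) by blast
qed

lemma coord_face: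
  assumes "finite V" "W \<subseteq> V"
  shows "{y\<in>orth (card V). \<forall>v\<in>V - W. y (pos V v) = 0} =
    {y\<in>orth (card V). \<forall>i. i \<notin> pos V ` W \<longrightarrow> y i = 0}"
proof -
  have "y i = 0" if y: "y \<in> orth (card V)" "\<forall>v\<in>V - W. y (pos V v) = 0" "i \<notin> pos V ` W" for y i
  proof (cases "i < card V")
    case True
    then have "enum V i \<in> V - W"
      using that(3) enum_mem[OF assms(1) True] pos_enum[OF assms(1) True] by force
    then show ?thesis using y(2) pos_enum[OF assms(1) True] by metis
  qed (use y in \<open>simp add: orth_def zvec_def\<close>)
  moreover have "pos V v \<notin> pos V ` W" if "v \<in> V - W" for v
  proof
    assume "pos V v \<in> pos V ` W"
    then obtain w where w: "w \<in> W" "pos V v = pos V w" by auto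
    have "v = w"
      using enum_pos[OF assms(1), of v] enum_pos[OF assms(1), of w] w that assms(2) by auto
    then show False using w that by simp
  qed
  ultimately show ?thesis by auto
qed

lemma coord_face_subset:
  assumes "finite V" "W \<subseteq> V" "W' \<subseteq> V"
    and "{y\<in>orth (card V). \<forall>v\<in>V - W. y (pos V v) = 0} \<subseteq> {y\<in>orth (card V). \<forall>v\<in>V - W'. y (pos V v) = 0}"
  shows "W \<subseteq> W'"
proof
  fix w assume w: "w \<in> W"
  obtain y where y: "y \<in> orth (card V)" "\<And>v. v \<in> V \<Longrightarrow> y (pos V v) = (if v = w then 1 else 0)"
    by (rule orth_build[OF assms(1), of "\<lambda>v. if v = w then 1 else 0"]) (simp, blast)
  then have "y \<in> {y\<in>orth (card V). \<forall>v\<in>V - W. y (pos V v) = 0}" using w by auto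
  then have "y \<in> {y\<in>orth (card V). \<forall>v\<in>V - W'. y (pos V v) = 0}" using assms(4) by blast
  then show "w \<in> W'" using y(2)[of w] w assms(2) by (cases "w \<in> W'") auto
qed

lemma transfer_face_emb:
  assumes "finite V'" "V \<subseteq> V'"
  shows "face_emb (transfer V V') (orth (card V)) (orth (card V'))"
  unfolding face_emb_def
proof (intro conjI)
  have fin: "finite V" using assms finite_subset by blast
  show "mhom (transfer V V') (orth (card V)) (orth (card V'))"
    unfolding mhom_def by (auto simp: transfer_mem) (auto simp: transfer_def vadd_def)
  show "inj_on (transfer V V') (orth (card V))"
  proof (rule inj_onI)
    fix x y assume xy: "x \<in> orth (card V)" "y \<in> orth (card V)" "transfer V V' x = transfer V V' y"
    then show "x = y"
      using transfer_pos[OF assms(1), of _ V x] transfer_pos[OF assms(1), of _ V y] assms(2)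
      by (intro orth_eqI[OF fin xy(1,2)]) (metis subsetD)
  qed
  show "mface (transfer V V' ` orth (card V)) (orth (card V'))"
    unfolding transfer_image[OF assms] coord_face[OF assms] by (rule mface_orth_coord)
qed

lemma combine_transfer:
  assumes "finite V'" "V \<subseteq> V'"
  shows "combine V' u (transfer V V' x) = combine V u x"
  unfolding combine_def
proof
  fix i
  show "(\<Sum>v\<in>V'. transfer V V' x (pos V' v) * u v i) = (\<Sum>v\<in>V. x (pos V v) * u v i)"
    using assms by (intro sum.mono_neutral_cong_right) (auto simp: transfer_pos)
qed

lemma combine_nat:
  "x \<in> orth d \<Longrightarrow> combine V u x = (\<lambda>i. \<Sum>v\<in>V. int (nat (x (pos V v))) * u v i)"
  by (simp add: combine_def orth_def)

lemma combine_mhom: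
  assumes "submonoid M" "finite V" "\<And>v. v \<in> V \<Longrightarrow> u v \<in> M"
  shows "mhom (combine V u) (orth d) M"
  unfolding mhom_def
proof (intro conjI ballI)
  show "combine V u x \<in> M" if "x \<in> orth d" for x
    unfolding combine_nat[OF that] using assms by (rule submonoid_sum)
qed (auto simp: combine_def vadd_def distrib_right sum.distrib)

lemma combine_inj:
  assumes "finite V" "indep V u"
  shows "inj_on (combine V u) (orth (card V))"
proof (rule inj_onI)
  fix x y assume xy: "x \<in> orth (card V)" "y \<in> orth (card V)" "combine V u x = combine V u y"
  have "(\<Sum>v\<in>V. of_int (x (pos V v)) * of_int (u v i)) = (\<Sum>v\<in>V. of_int (y (pos V v)) * (of_int (u v i) :: real))" for i
    using fun_cong[OF xy(3), of i] unfolding combine_def by (metis (no_types, lifting) of_int_mult of_int_sum sum.cong)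
  then have "real_of_int (x (pos V v)) = of_int (y (pos V v))" if "v \<in> V" for v
    using indep_eqD[OF assms(2) _ that, of "\<lambda>v. of_int (x (pos V v))" "\<lambda>v. of_int (y (pos V v))"] by simp
  then show "x = y" by (intro orth_eqI[OF assms(1) xy(1,2)]) simp
qed

lemma conehull_combine:
  assumes "finite V"
  shows "conehull (combine V u ` orth (card V)) = conehull (u ` V)"
proof
  show "conehull (combine V u ` orth (card V)) \<subseteq> conehull (u ` V)"
  proof (rule conehull_subset)
    fix g assume "g \<in> combine V u ` orth (card V)"
    then obtain x where x: "x \<in> orth (card V)" "g = combine V u x" by auto
    have "rof g = (\<lambda>i. \<Sum>v\<in>V. of_int (x (pos V v)) * of_int (u v i))" by (simp add: x(2) rof_def combine_def)
    then show "rof g \<in> conehull (u ` V)"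
      unfolding conehull_image[OF assms] using x(1)
      by (intro exI[of _ "\<lambda>v. of_int (x (pos V v))"]) (auto simp: orth_def)
  qed
  show "conehull (u ` V) \<subseteq> conehull (combine V u ` orth (card V))"
  proof (rule conehull_mono, rule subsetI)
    fix g assume "g \<in> u ` V"
    then obtain w where w: "w \<in> V" "g = u w" by auto
    obtain x where x: "x \<in> orth (card V)" "\<And>v. v \<in> V \<Longrightarrow> x (pos V v) = (if v = w then 1 else 0)"
      by (rule orth_build[OF assms, of "\<lambda>v. if v = w then 1 else 0"]) (simp, blast)
    have "combine V u x = g"
    proof
      fix i
      have "combine V u x i = (\<Sum>v\<in>V. (if v = w then 1 else 0) * u v i)"
        unfolding combine_def using x(2) by (intro sum.cong) auto
      then show "combine V u x i = g i"
        using w assms by (simp add: if_distrib[of "\<lambda>z. z * _"] cong: if_cong)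
    qed
    then show "g \<in> combine V u ` orth (card V)" using x(1) by blast
  qed
qed

text \<open>Push \<open>x\<close> slightly away from the sum \<open>?y\<close> of all generators.
  Solving the resulting presentation for \<open>x\<close> turns a nonnegative coefficient
  \<open>c v\<close> into \<open>(c v + \<epsilon>) / (1 + \<epsilon>)\<close>, which is
  positive.\<close>

lemma relint_positive:
  assumes "finite V" "x \<in> relint (conehull (u ` V))"
  shows "\<exists>p. (\<forall>v\<in>V. 0 < p v) \<and> x = (\<lambda>i. \<Sum>v\<in>V. (p v :: real) * of_int (u v i))"
proof -
  let ?y = "\<lambda>i. \<Sum>v\<in>V. 1 * real_of_int (u v i)"
  have "?y \<in> conehull (u ` V)" using assms(1) by (intro conehull_sum) auto
  then obtain \<epsilon> where \<epsilon>: "\<epsilon> > 0" "(\<lambda>i. x i + \<epsilon> * (x i - ?y i)) \<in> conehull (u ` V)"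
    using assms(2) unfolding relint_def by auto
  then obtain c where c: "\<forall>v\<in>V. 0 \<le> c v" "(\<lambda>i. x i + \<epsilon> * (x i - ?y i)) = (\<lambda>i. \<Sum>v\<in>V. c v * of_int (u v i))"
    unfolding conehull_image[OF assms(1)] by blast
  have "x i = (\<Sum>v\<in>V. ((c v + \<epsilon>) / (1 + \<epsilon>)) * of_int (u v i))" for i
  proof -
    have "(1 + \<epsilon>) * x i = (\<Sum>v\<in>V. (c v + \<epsilon>) * of_int (u v i))"
      using fun_cong[OF c(2), of i] by (simp add: algebra_simps sum.distrib sum_distrib_left)
    then have "x i = (\<Sum>v\<in>V. (c v + \<epsilon>) * of_int (u v i)) / (1 + \<epsilon>)" using \<epsilon>(1) by (simp add: field_simps)
    then show ?thesis by (simp add: sum_divide_distrib)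
  qed
  then show ?thesis
    using c(1) \<epsilon>(1) by (intro exI[of _ "\<lambda>v. (c v + \<epsilon>) / (1 + \<epsilon>)"]) (auto intro!: divide_pos_pos add_nonneg_pos)
qed

section \<open>Extremal generators and one-dimensional faces\<close>

lemma extremal_face:
  assumes tor: "toric_monoid \<sigma>" and e: "extremal \<sigma> e"
  shows "mface (range (\<lambda>n i. int n * e i)) \<sigma>"
proof -
  \<comment> \<open>The lattice points on the real ray of \<open>e\<close> form a submonoid
    generated by one vector, and primitivity identifies this generator with
    \<open>e\<close>.\<close>
  let ?M = "{v\<in>\<sigma>. rof v \<in> ray e}"
  have e': "e \<in> \<sigma>" "e \<noteq> (\<lambda>i. 0)"
    and face: "\<And>x y. x \<in> supp \<sigma> \<Longrightarrow> y \<in> supp \<sigma> \<Longrightarrow> (\<lambda>i. x i + y i) \<in> ray e \<Longrightarrow> x \<in> ray e \<and> y \<in> ray e"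
    and prim: "\<And>e' k. e' \<in> \<sigma> \<Longrightarrow> e = (\<lambda>i. int k * e' i) \<Longrightarrow> k = 1"
    using e unfolding extremal_def by blast+
  note sub = toric_submonoid[OF tor]
  have eM: "e \<in> ?M" using e'(1) by (auto simp: ray_def rof_def intro!: exI[of _ 1])
  have rayI: "rof v \<in> ray e" if "t \<ge> 0" "\<And>i. of_int (v i) = t * of_int (e i)" for t :: real and v
    unfolding ray_def rof_def using that by auto
  have rayE: "\<exists>t::real. t \<ge> 0 \<and> (\<forall>i. of_int (v i) = t * of_int (e i))" if "v \<in> ?M" for v
    using that unfolding ray_def rof_def by (auto dest: fun_cong)
  have M: "submonoid ?M"
    unfolding submonoid_def
  proof (intro conjI ballI)
    show "(\<lambda>i. 0) \<in> ?M" using sub rayI[of 0 "\<lambda>i. 0"] by (simp add: submonoid_def)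
    fix v w assume vw: "v \<in> ?M" "w \<in> ?M"
    obtain s t :: real where "s \<ge> 0" "\<forall>i. of_int (v i) = s * of_int (e i)" "t \<ge> 0" "\<forall>i. of_int (w i) = t * of_int (e i)"
      using rayE[OF vw(1)] rayE[OF vw(2)] by blast
    then have "rof (vadd v w) \<in> ray e"
      by (intro rayI[of "s + t"]) (auto simp: vadd_def distrib_right)
    then show "vadd v w \<in> ?M" using vw sub by (simp add: submonoid_def)
  qed
  have diff: "(\<lambda>i. v i - w i) \<in> ?M" if vw: "v \<in> ?M" "w \<in> ?M" "(\<lambda>i. v i - w i) \<in> \<sigma>" for v w
  proof -
    obtain s t :: real where st: "\<forall>i. of_int (v i) = s * of_int (e i)" "\<forall>i. of_int (w i) = t * of_int (e i)"
      using rayE[OF vw(1)] rayE[OF vw(2)] by blast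
    \<comment> \<open>Otherwise the difference and its negative would both lie in the pointed
      cone.\<close>
    have "s \<ge> t"
    proof (rule ccontr)
      assume "\<not> s \<ge> t"
      then have "(\<lambda>i. (t - s) * rof e i) \<in> supp \<sigma>"
        unfolding supp_def using e'(1) by (intro conehull_scale conehull_base) auto
      moreover have "(\<lambda>i. - rof (\<lambda>i. v i - w i) i) = (\<lambda>i. (t - s) * rof e i)"
        using st by (simp add: rof_def left_diff_distrib)
      ultimately have "rof (\<lambda>i. v i - w i) = (\<lambda>i. 0)"
        using toric_pointed[OF tor, of "rof (\<lambda>i. v i - w i)"] conehull_base[OF vw(3)] by (simp add: supp_def)
      then have "(s - t) * of_int (e i) = 0" for i
        using st by (auto simp: rof_def fun_eq_iff left_diff_distrib)
      then show False using e'(2) \<open>\<not> s \<ge> t\<close> by auto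
    qed
    then have "rof (\<lambda>i. v i - w i) \<in> ray e" using st by (intro rayI[of "s - t"]) (auto simp: left_diff_distrib)
    then show ?thesis using vw(3) by simp
  qed
  have proportional: "\<exists>t. \<forall>i. of_int (v i) = (t :: real) * of_int (w i)" if vw: "v \<in> ?M" "w \<in> ?M" "w \<noteq> (\<lambda>i. 0)" for v w
  proof -
    obtain s t :: real where st: "\<forall>i. of_int (v i) = s * of_int (e i)" "\<forall>i. of_int (w i) = t * of_int (e i)"
      using rayE[OF vw(1)] rayE[OF vw(2)] by blast
    have "t \<noteq> 0" using st(2) vw(3) by auto
    then show ?thesis using st by (intro exI[of _ "s / t"]) auto
  qed
  have "?M \<noteq> {\<lambda>i. 0}" using eM e'(2) by blast
  then obtain e0 where e0: "e0 \<noteq> (\<lambda>i. 0)" "?M = range (\<lambda>n i. int n * e0 i)"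
    using toric_proportional[OF tor _ M _ diff proportional] by blast
  then obtain k where k: "e = (\<lambda>i. int k * e0 i)" using eM by auto
  have "(\<lambda>i. int 1 * e0 i) \<in> ?M" unfolding e0(2) by (rule rangeI)
  then have "k = 1" using prim[of e0 k] k by simp
  then have eq: "?M = range (\<lambda>n i. int n * e i)" using k e0(2) by simp
  have "v \<in> ?M \<and> w \<in> ?M" if "v \<in> \<sigma>" "w \<in> \<sigma>" "vadd v w \<in> ?M" for v w
    using that face[of "rof v" "rof w"] conehull_base[OF that(1)] conehull_base[OF that(2)]
    by (simp add: supp_def rof_def vadd_def)
  then have "mface ?M \<sigma>"
    using M unfolding mface_def submonoid_def by (intro conjI) (simp, simp, blast, blast)
  then show ?thesis unfolding eq .
qed

lemma face_extremal:
  assumes tor: "toric_monoid \<sigma>" and face: "mface (range (\<lambda>n i. int n * e i)) \<sigma>" and nz: "e \<noteq> (\<lambda>i. 0)"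
  shows "extremal \<sigma> e"
proof -
  let ?\<tau> = "range (\<lambda>n i. int n * e i)"
  have e: "e \<in> \<sigma>" using face image_eqI[of e "\<lambda>n i. int n * e i" 1] by (auto simp: mface_def)
  have cone: "x \<in> ray e" if "x \<in> conehull ?\<tau>" for x
    using that
  proof (induction rule: conehull_induct)
    case zero
    show ?case by (auto simp: ray_def intro: exI[of _ 0])
  next
    case (step g c y)
    then obtain n t where "g = (\<lambda>i. int n * e i)" "t \<ge> 0" "y = (\<lambda>i. t * of_int (e i))"
      by (auto simp: ray_def)
    then show ?case using step(2) by (auto simp: ray_def algebra_simps intro!: exI[of _ "c * real n + t"])
  qed
  have "x \<in> ray e \<and> y \<in> ray e" if x: "x \<in> supp \<sigma>" and y: "y \<in> supp \<sigma>" and xy: "(\<lambda>i. x i + y i) \<in> ray e" for x y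
  proof -
    obtain t where t: "t \<ge> 0" "(\<lambda>i. x i + y i) = (\<lambda>i. t * of_int (e i))" using xy by (auto simp: ray_def)
    have "e \<in> ?\<tau>" using image_eqI[of e "\<lambda>n i. int n * e i" 1] by simp
    then have xy': "(\<lambda>i. x i + y i) \<in> conehull ?\<tau>"
      using conehull_scale[OF conehull_base t(1)] t(2) by (simp add: rof_def)
    then have "(\<lambda>i. y i + x i) \<in> conehull ?\<tau>" by (simp add: add.commute)
    then show ?thesis
      using cone mface_conehull_face[OF tor face x y xy'] mface_conehull_face[OF tor face y x] by blast
  qed
  \<comment> \<open>If \<open>e\<close> is \<open>k\<close> times \<open>e'\<close>, the face
    property makes \<open>e'\<close> in turn a multiple of \<open>e\<close>; comparing a nonzero
    coordinate gives \<open>k = 1\<close>.\<close>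
  moreover have "k = 1" if e': "e' \<in> \<sigma>" and k: "e = (\<lambda>i. int k * e' i)" for e' k
  proof -
    obtain m where m: "k = Suc m" using k nz by (cases k) auto
    have "vadd e' (\<lambda>i. int m * e' i) = e" unfolding k m by (simp add: vadd_def algebra_simps)
    then have "vadd e' (\<lambda>i. int m * e' i) \<in> ?\<tau>" using image_eqI[of e "\<lambda>n i. int n * e i" 1] by simp
    then have "e' \<in> ?\<tau>"
      using face e' submonoid_scale[OF toric_submonoid[OF tor] e'] unfolding mface_def by blast
    then obtain n where n: "e' = (\<lambda>i. int n * e i)" by auto
    obtain i where i: "e i \<noteq> 0" using nz by auto
    have "e i = int (k * n) * e i" using fun_cong[OF k, of i] fun_cong[OF n, of i] by simp
    then have "int (k * n) = 1" using i by simp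
    then show ?thesis by (metis nat_mult_eq_1_iff of_nat_eq_1_iff)
  qed
  ultimately show ?thesis using e nz unfolding extremal_def by blast
qed

context complete_complex
begin

lemma im_ray:
  assumes "r \<in> rays Q a" "a \<in> idx Q"
  shows "im a r = range (\<lambda>n i. int n * vec Q a r i)"
proof -
  have r: "r \<in> idx Q" "le Q r a" "is_ray (mon Q r)" using assms by (auto simp: rays_def)
  show ?thesis
    by (subst center_ray(2)[OF r(3)])
      (simp add: image_image vec_def mhom_scale[OF hom[OF r(2,1) assms(2)] sub[OF r(1)] center_mem[OF r(1)]])
qed

lemma extremal_ray:
  assumes "r \<in> rays Q a" "a \<in> idx Q"
  shows "extremal (mon Q a) (vec Q a r)"
  using face_extremal[OF toric[OF assms(2)] _ vec_ray_nonzero[OF assms]]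
    im_face[of r a] rays_idx[OF assms(1)] rays_le[OF assms(1)] im_ray[OF assms] assms(2) by simp

lemma ray_of_extremal:
  assumes a: "a \<in> idx Q" and e: "extremal (mon Q a) e"
  shows "\<exists>r\<in>rays Q a. vec Q a r = e"
proof -
  let ?\<tau> = "range (\<lambda>n i. int n * e i)"
  obtain r where r: "r \<in> idx Q" "le Q r a" "im a r = ?\<tau>"
    using face_ex1[OF a extremal_face[OF toric[OF a] e]] by blast
  have e\<tau>: "e \<in> ?\<tau>" using image_eqI[of e "\<lambda>n i. int n * e i" 1] by simp
  then obtain e' where e': "e' \<in> mon Q r" "fmap Q r a e' = e" using r(3) by (metis imageE)
  note h = hom[OF r(2,1) a] and s = sub[OF r(1)]
  have "x \<in> range (\<lambda>n i. int n * e' i)" if x: "x \<in> mon Q r" for x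
  proof -
    obtain n where n: "fmap Q r a x = (\<lambda>i. int n * e i)" using r(3) x by blast
    have "fmap Q r a x = fmap Q r a (\<lambda>i. int n * e' i)" using n mhom_scale[OF h s e'(1)] e'(2) by simp
    then have "x = (\<lambda>i. int n * e' i)"
      using inj_onD[OF inj[OF r(2,1) a]] x submonoid_scale[OF s e'(1)] by blast
    then show ?thesis by blast
  qed
  then have "mon Q r = range (\<lambda>n i. int n * e' i)" using submonoid_scale[OF s e'(1)] by blast
  moreover have "e' \<noteq> (\<lambda>i. 0)" using e' h e by (auto simp: mhom_def extremal_def)
  ultimately have "is_ray (mon Q r)" unfolding is_ray_def by blast
  then have ray: "r \<in> rays Q a" using r by (simp add: rays_def)
  \<comment> \<open>The chosen centre is mapped to some multiple of \<open>e\<close>, and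
    extremality of that image leaves only the factor 1.\<close>
  obtain n where n: "vec Q a r = (\<lambda>i. int n * e i)" using vec_mem_im[OF r(1), of a] r(3) by auto
  have "e \<in> mon Q a" using e by (simp add: extremal_def)
  then have "n = 1" using extremal_ray[OF ray a] n unfolding extremal_def by blast
  then show ?thesis using ray n by auto
qed

text \<open>Translates smoothness, which speaks of extremals, into a statement about indices of
  rays.\<close>

lemma vec_rays_bij:
  assumes a: "a \<in> idx Q"
  shows "bij_betw (vec Q a) (rays Q a) {e. extremal (mon Q a) e}"
proof -
  have "r = s" if rs: "r \<in> rays Q a" "s \<in> rays Q a" "vec Q a r = vec Q a s" for r s
  proof -
    have "im a r = im a s" using im_ray rs a by simp
    then show ?thesis using face_index_unique[of r s a] rays_idx[of r] rays_idx[of s] rays_le[of r] rays_le[of s] rs a by simp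
  qed
  then have "inj_on (vec Q a) (rays Q a)" by (auto intro: inj_onI)
  moreover have "vec Q a ` rays Q a = {e. extremal (mon Q a) e}"
    using extremal_ray[OF _ a] ray_of_extremal[OF a] by blast
  ultimately show ?thesis by (simp add: bij_betw_def)
qed

lemma sum_extremal:
  assumes "a \<in> idx Q"
  shows "(\<Sum>e\<in>{e. extremal (mon Q a) e}. f e * e i) = (\<Sum>r\<in>rays Q a. f (vec Q a r) * vec Q a r i)"
  using sum.reindex_bij_betw[OF vec_rays_bij[OF assms], of "\<lambda>e. f e * e i"] by simp

lemma smooth_span:
  assumes a: "a \<in> idx Q" "smooth (mon Q a)" and v: "v \<in> mon Q a"
  obtains n :: "'a \<Rightarrow> nat" where "v = (\<lambda>i. \<Sum>r\<in>rays Q a. int (n r) * vec Q a r i)"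
proof -
  obtain c where "v = (\<lambda>i. \<Sum>e\<in>{e. extremal (mon Q a) e}. int (c e) * e i)"
    using a(2) v unfolding smooth_def by blast
  then have "v = (\<lambda>i. \<Sum>r\<in>rays Q a. int (c (vec Q a r)) * vec Q a r i)"
    using sum_extremal[OF a(1), of "\<lambda>e. int (c e)"] by simp
  then show ?thesis by (rule that)
qed

text \<open>Uniqueness of natural coefficients excludes nontrivial integral relations among the
  rays, and \<open>real_relation\<close> upgrades this to real relations.\<close>

lemma smooth_simplicial:
  assumes a: "a \<in> idx Q" "smooth (mon Q a)"
  shows "simplicial Q a"
proof -
  note bij = vec_rays_bij[OF a(1)]
  let ?E = "{e. extremal (mon Q a) e}"
  have nat: "n r = m r"
    if eq: "\<And>i. (\<Sum>r\<in>rays Q a. int (n r) * vec Q a r i) = (\<Sum>r\<in>rays Q a. int (m r) * vec Q a r i)"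
      and r: "r \<in> rays Q a" for n m :: "'a \<Rightarrow> nat" and r
  proof -
    let ?v = "\<lambda>i. \<Sum>r\<in>rays Q a. int (n r) * vec Q a r i"
    have "?v \<in> mon Q a"
      using vec_mem rays_idx rays_le a(1) by (intro submonoid_sum[OF sub[OF a(1)] finite_rays]) blast
    then have uniq: "\<exists>!c. (\<forall>e. \<not> extremal (mon Q a) e \<longrightarrow> c e = 0) \<and> ?v = (\<lambda>i. \<Sum>e\<in>?E. int (c e) * e i)"
      using a(2) unfolding smooth_def by blast
    \<comment> \<open>Carries coefficients from ray indices to extremals, with value 0 elsewhere as
      the uniqueness clause of \<open>smooth\<close> demands.\<close>
    define ext where "ext k e = (if extremal (mon Q a) e then k (inv_into (rays Q a) (vec Q a) e) else 0)"
      for k :: "'a \<Rightarrow> nat" and e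
    have ext: "ext k (vec Q a r) = k r" if "r \<in> rays Q a" for k r
      using that extremal_ray[OF that a(1)] bij_betw_inv_into_left[OF bij that] by (simp add: ext_def)
    have "(\<Sum>e\<in>?E. int (ext k e) * e i) = (\<Sum>r\<in>rays Q a. int (k r) * vec Q a r i)" for k i
      unfolding sum_extremal[OF a(1), of "\<lambda>e. int (ext k e)"] using ext by (intro sum.cong) auto
    then have "(\<forall>e. \<not> extremal (mon Q a) e \<longrightarrow> ext n e = 0) \<and> ?v = (\<lambda>i. \<Sum>e\<in>?E. int (ext n e) * e i)"
      "(\<forall>e. \<not> extremal (mon Q a) e \<longrightarrow> ext m e = 0) \<and> ?v = (\<lambda>i. \<Sum>e\<in>?E. int (ext m e) * e i)"
      using eq by (simp_all add: ext_def)
    then have "ext n = ext m" by (rule trans[OF the1_equality[OF uniq, symmetric] the1_equality[OF uniq]])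
    then show ?thesis using ext[OF r, of n] ext[OF r, of m] by simp
  qed
  show ?thesis
    unfolding simplicial_def indep_def
  proof (intro allI impI ballI)
    fix c :: "'a \<Rightarrow> real" and r0
    assume c: "\<forall>i. (\<Sum>r\<in>rays Q a. c r * of_int (vec Q a r i)) = 0" and r0: "r0 \<in> rays Q a"
    \<comment> \<open>The second family is the indicator of \<open>r0\<close>, constant in the
      coordinate, so the conclusion of \<open>real_relation\<close> amounts to
      \<open>c r0 = 0\<close>.\<close>
    have "(\<Sum>r\<in>rays Q a. c r * of_int ((\<lambda>i. if r = r0 then 1 else 0) 0)) = 0"
    proof (rule real_relation[where g = "vec Q a" and h = "\<lambda>r i. if r = r0 then 1 else 0" and i = 0, OF finite_rays])
      fix n :: "'a \<Rightarrow> int" and i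
      assume "\<And>i. (\<Sum>r\<in>rays Q a. n r * vec Q a r i) = 0"
      then have "(\<Sum>r\<in>rays Q a. int (nat (n r)) * vec Q a r i) = (\<Sum>r\<in>rays Q a. int (nat (- n r)) * vec Q a r i)" for i
        using sum_int_eq_iff[of n "\<lambda>r. vec Q a r i" "rays Q a"] by blast
      then have "nat (n r0) = nat (- n r0)" by (rule nat[OF _ r0])
      then have "n r0 = 0" by linarith
      then show "(\<Sum>r\<in>rays Q a. n r * (if r = r0 then 1 else 0)) = 0" by (intro sum.neutral) auto
    qed (use c in simp)
    also have "(\<Sum>r\<in>rays Q a. c r * of_int ((\<lambda>i. if r = r0 then 1 else 0) 0)) = (\<Sum>r\<in>rays Q a. if r = r0 then c r else 0)"
      by (intro sum.cong) auto
    finally show "c r0 = 0" using r0 finite_rays by simp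
  qed
qed

end

section \<open>The subdivision\<close>

type_synonym 'a cell = "'a \<times> 'a set \<times> 'a"

definition cverts :: "'a mcomplex \<Rightarrow> 'a cell \<Rightarrow> 'a set" where
  "cverts Q c = verts Q (fst c) (fst (snd c))"

definition ctop :: "'a cell \<Rightarrow> 'a" where
  "ctop c = snd (snd c)"

text \<open>Each cell carries a new free lattice with one basis vector per vertex. The order
  compares bases and chains, which determine the top of a cell of a complete complex.\<close>

definition subdivision :: "'a mcomplex \<Rightarrow> 'a cell mcomplex" where
  "subdivision Q =
     \<lparr>idx = {(a, S, t). cell Q a S t},
      le = (\<lambda>c c'. le Q (fst c) (fst c') \<and> fst (snd c) \<subseteq> fst (snd c')),
      mon = (\<lambda>c. orth (card (cverts Q c))),
      fmap = (\<lambda>c c'. transfer (cverts Q c) (cverts Q c'))\<rparr>"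

definition realize :: "'a mcomplex \<Rightarrow> 'a cell \<Rightarrow> zv \<Rightarrow> zv" where
  "realize Q c = combine (cverts Q c) (vec Q (ctop c))"

lemma subdivision_simps [simp]:
  "(a, S, t) \<in> idx (subdivision Q) \<longleftrightarrow> cell Q a S t"
  "le (subdivision Q) c c' \<longleftrightarrow> le Q (fst c) (fst c') \<and> fst (snd c) \<subseteq> fst (snd c')"
  "mon (subdivision Q) c = orth (card (cverts Q c))"
  "fmap (subdivision Q) c c' = transfer (cverts Q c) (cverts Q c')"
  by (auto simp: subdivision_def)

lemma subdivision_idx: "c \<in> idx (subdivision Q) \<longleftrightarrow> cell Q (fst c) (fst (snd c)) (ctop c)"
  by (cases c) (simp add: ctop_def)

context complete_complex
begin

lemma cverts_cell:
  assumes "c \<in> idx (subdivision Q)"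
  shows "finite (cverts Q c)" "cverts Q c \<subseteq> idx Q" "\<And>v. v \<in> cverts Q c \<Longrightarrow> le Q v (ctop c)" "ctop c \<in> idx Q"
  using verts_cell[OF assms[unfolded subdivision_idx]] cell_idx(2)[OF assms[unfolded subdivision_idx]]
  unfolding cverts_def by blast+

lemma cverts_mono:
  assumes "c \<in> idx (subdivision Q)" "c' \<in> idx (subdivision Q)" "le (subdivision Q) c c'"
  shows "cverts Q c \<subseteq> cverts Q c'"
  using assms cell_idx(1) rays_mono[of "fst c" "fst c'"] unfolding subdivision_idx cverts_def by auto

lemma ctop_mono:
  assumes "c \<in> idx (subdivision Q)" "c' \<in> idx (subdivision Q)" "le (subdivision Q) c c'"
  shows "le Q (ctop c) (ctop c')"
  using assms cell_top_mono unfolding subdivision_idx by auto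

text \<open>A face of a free monoid is a subset \<open>W\<close> of the vertices. Its rays are those
  of a unique face of the simplicial base, its other members form a subchain, and disjointness of
  the two kinds of vertices makes this splitting unique.\<close>

lemma subdivision_faces:
  assumes c': "c' \<in> idx (subdivision Q)" and \<tau>: "mface \<tau> (orth (card (cverts Q c')))"
  shows "\<exists>!c. c \<in> idx (subdivision Q) \<and> le (subdivision Q) c c' \<and>
    transfer (cverts Q c) (cverts Q c') ` orth (card (cverts Q c)) = \<tau>"
proof -
  obtain a' S' t' where [simp]: "c' = (a', S', t')" by (cases c')
  have cell': "cell Q a' S' t'" using c' by simp
  note ci' = cell_idx[OF cell'] and V' = verts_cell(1)[OF cell']
  let ?V' = "verts Q a' S'"
  have disj: "rays Q b \<inter> S' = {}" for b using rays_cell_disjoint[OF cell'] .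
  obtain I where I: "I \<subseteq> {..<card ?V'}" "\<tau> = {x\<in>orth (card ?V'). \<forall>i. i \<notin> I \<longrightarrow> x i = 0}"
    using mface_orth[OF \<tau>] by (auto simp: cverts_def)
  define W where "W = enum ?V' ` I"
  have WV: "W \<subseteq> ?V'" using I(1) enum_mem[OF V'] by (auto simp: W_def)
  have "pos ?V' ` W = I" using I(1) pos_enum[OF V'] by (force simp: W_def image_image)
  then have \<tau>W: "\<tau> = {y\<in>orth (card ?V'). \<forall>v\<in>?V' - W. y (pos ?V' v) = 0}"
    using coord_face[OF V' WV] I(2) by simp
  have im: "transfer V ?V' ` orth (card V) = \<tau> \<longleftrightarrow> V = W" if V: "V \<subseteq> ?V'" for V
    unfolding transfer_image[OF V' V] \<tau>W
    using coord_face_subset[OF V' V WV] coord_face_subset[OF V' WV V] by blast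
  obtain a where a: "a \<in> idx Q" "le Q a a'" "rays Q a = W \<inter> rays Q a'"
    using simplicial_face[OF ci'(1,3), of "W \<inter> rays Q a'"] by blast
  obtain t where t: "cell Q a (W \<inter> S') t" using cell_sub[OF cell' _ a(2,1), of "W \<inter> S'"] by blast
  have vW: "verts Q a (W \<inter> S') = W" using a(3) WV by blast
  show ?thesis
  proof (rule ex1I[of _ "(a, W \<inter> S', t)"])
    show "(a, W \<inter> S', t) \<in> idx (subdivision Q) \<and> le (subdivision Q) (a, W \<inter> S', t) c' \<and>
      transfer (cverts Q (a, W \<inter> S', t)) (cverts Q c') ` orth (card (cverts Q (a, W \<inter> S', t))) = \<tau>"
      using t a(2) im[OF WV] by (simp add: cverts_def vW)
  next
    fix c
    assume c: "c \<in> idx (subdivision Q) \<and> le (subdivision Q) c c' \<and>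
      transfer (cverts Q c) (cverts Q c') ` orth (card (cverts Q c)) = \<tau>"
    obtain b T s where [simp]: "c = (b, T, s)" by (cases c)
    have b: "cell Q b T s" "le Q b a'" "T \<subseteq> S'" using c by auto
    note bi = cell_idx(1)[OF b(1)]
    have rb: "rays Q b \<subseteq> rays Q a'" using rays_mono[OF b(2) bi ci'(1)] .
    have "verts Q b T = W" using im[of "verts Q b T"] rb b(3) c by (auto simp: cverts_def)
    then have TW: "T = W \<inter> S'" and rW: "rays Q b = W \<inter> rays Q a'" using rb b(3) disj by blast+
    have "b = a" using rays_inj[OF bi a(1) ci'(1) b(2) a(2)] rW a(3) by simp
    then show "c = (a, W \<inter> S', t)" using TW b(1) t cell_top_unique by auto
  qed
qed

lemma subdivision_complex: "monoidal_complex (subdivision Q)"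
  unfolding monoidal_complex_def
proof (intro conjI ballI impI allI)
  let ?K = "subdivision Q"
  have "idx ?K \<subseteq> idx Q \<times> Pow (idx Q) \<times> idx Q"
    using cell_idx(1,2,6) by (auto simp: subdivision_def) blast
  then show "finite (idx ?K)" using finite_idx finite_subset by blast
  show "le ?K c c" if "c \<in> idx ?K" for c
    using that cell_idx(1) le_refl by (auto simp: subdivision_idx)
  show "c = c'" if "c \<in> idx ?K" "c' \<in> idx ?K" "le ?K c c' \<and> le ?K c' c" for c c'
  proof -
    have "fst c = fst c'" "fst (snd c) = fst (snd c')"
      using that le_antisym cell_idx(1) unfolding subdivision_idx by auto
    moreover from this have "ctop c = ctop c'"
      using that cell_top_unique unfolding subdivision_idx by metis
    ultimately show ?thesis by (simp add: prod_eq_iff ctop_def)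
  qed
  show "le ?K c c''" if "c \<in> idx ?K" "c' \<in> idx ?K" "c'' \<in> idx ?K" "le ?K c c' \<and> le ?K c' c''" for c c' c''
    using that le_trans[of "fst c" "fst c'" "fst c''"] cell_idx(1) unfolding subdivision_idx by auto
  show "toric_monoid (mon ?K c)" for c by (simp add: orth_toric)
  show "face_emb (fmap ?K c c') (mon ?K c) (mon ?K c')" if "c \<in> idx ?K" "c' \<in> idx ?K" "le ?K c c'" for c c'
    using transfer_face_emb[OF cverts_cell(1)[OF that(2)] cverts_mono[OF that]] by simp
  show "fmap ?K c c x = x" if "c \<in> idx ?K" "x \<in> mon ?K c" for c x
    using transfer_id[OF cverts_cell(1)[OF that(1)]] that(2) by simp
  show "fmap ?K c' c'' (fmap ?K c c' x) = fmap ?K c c'' x"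
    if "c \<in> idx ?K" "c' \<in> idx ?K" "c'' \<in> idx ?K" "le ?K c c' \<and> le ?K c' c''" "x \<in> mon ?K c" for c c' c'' x
    using transfer_comp[OF cverts_cell(1)[OF that(3)] cverts_mono[OF that(1,2)] cverts_mono[OF that(2,3)]] that(4,5)
    by simp
  show "\<exists>!c. c \<in> idx ?K \<and> le ?K c c' \<and> fmap ?K c c' ` mon ?K c = \<tau>" if "c' \<in> idx ?K" "mface \<tau> (mon ?K c')" for c' \<tau>
    using subdivision_faces[of c' \<tau>] that by simp
qed

lemma realize_mhom:
  assumes "c \<in> idx (subdivision Q)"
  shows "mhom (realize Q c) (mon (subdivision Q) c) (mon Q (ctop c))"
  unfolding realize_def subdivision_simps
  using cverts_cell[OF assms] vec_mem by (intro combine_mhom sub) auto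

lemma subdivision_morphism: "morphism (subdivision Q) Q ctop (realize Q)"
  unfolding morphism_def
proof (intro conjI ballI impI)
  let ?K = "subdivision Q"
  show "ctop c \<in> idx Q" if "c \<in> idx ?K" for c using cverts_cell(4)[OF that] .
  show "le Q (ctop c) (ctop c')" if "c \<in> idx ?K" "c' \<in> idx ?K" "le ?K c c'" for c c'
    using ctop_mono[OF that] .
  show "mhom (realize Q c) (mon ?K c) (mon Q (ctop c))" if "c \<in> idx ?K" for c
    using realize_mhom[OF that] .
  show "realize Q c' (fmap ?K c c' x) = fmap Q (ctop c) (ctop c') (realize Q c x)"
    if c: "c \<in> idx ?K" "c' \<in> idx ?K" "le ?K c c'" and x: "x \<in> mon ?K c" for c c' x
  proof -
    note V = cverts_cell[OF c(1)] and t' = cverts_cell(4)[OF c(2)] and tt = ctop_mono[OF c]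
    have xo: "x \<in> orth (card (cverts Q c))" using x by simp
    have mem: "vec Q (ctop c) v \<in> mon Q (ctop c)" if "v \<in> cverts Q c" for v using vec_mem V that by blast
    have "realize Q c' (fmap ?K c c' x) = combine (cverts Q c) (vec Q (ctop c')) x"
      unfolding realize_def subdivision_simps
      by (rule combine_transfer[OF cverts_cell(1)[OF c(2)] cverts_mono[OF c]])
    also have "\<dots> = combine (cverts Q c) (\<lambda>v. fmap Q (ctop c) (ctop c') (vec Q (ctop c) v)) x"
      unfolding combine_def using vec_comp V t' tt by (intro ext sum.cong) auto
    also have "\<dots> = fmap Q (ctop c) (ctop c') (realize Q c x)"
      unfolding realize_def combine_nat[OF xo]
      by (rule mhom_sum[OF hom[OF tt V(4) t'] sub[OF V(4)] V(1) mem, symmetric])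
    finally show ?thesis .
  qed
qed

lemma conehull_realize:
  assumes "c \<in> idx (subdivision Q)"
  shows "conehull (realize Q c ` mon (subdivision Q) c) = conehull (vec Q (ctop c) ` cverts Q c)"
  unfolding realize_def subdivision_simps using conehull_combine[OF cverts_cell(1)[OF assms]] .

lemma realize_inj:
  assumes "c \<in> idx (subdivision Q)"
  shows "inj_on (realize Q c) (mon (subdivision Q) c)"
  unfolding realize_def subdivision_simps
proof (rule combine_inj[OF cverts_cell(1)[OF assms]])
  show "indep (cverts Q c) (vec Q (ctop c))"
    using cell_indep[OF assms[unfolded subdivision_idx] le_refl] cverts_cell(4)[OF assms]
    unfolding cverts_def by blast
qed

lemma subdivision_refinement: "refinement (subdivision Q) Q ctop (realize Q)"
  unfolding refinement_def
proof (intro conjI ballI impI)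
  let ?K = "subdivision Q"
  show "morphism ?K Q ctop (realize Q)" by (rule subdivision_morphism)
  show "inj_on (realize Q c) (mon ?K c)" if "c \<in> idx ?K" for c using realize_inj[OF that] .
  show "(\<Union>c\<in>{c\<in>idx ?K. ctop c = t}. conehull (realize Q c ` mon ?K c)) = supp (mon Q t)" if t: "t \<in> idx Q" for t
  proof (intro equalityI subsetI)
    fix x assume "x \<in> (\<Union>c\<in>{c\<in>idx ?K. ctop c = t}. conehull (realize Q c ` mon ?K c))"
    then obtain c where c: "c \<in> idx ?K" "ctop c = t" "x \<in> conehull (realize Q c ` mon ?K c)" by blast
    have "realize Q c ` mon ?K c \<subseteq> mon Q t" using realize_mhom[OF c(1)] c(2) unfolding mhom_def by blast
    then show "x \<in> supp (mon Q t)" using c(3) conehull_mono unfolding supp_def by blast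
  next
    fix x assume "x \<in> supp (mon Q t)"
    then obtain a S where c: "cell Q a S t" "x \<in> conehull (vec Q t ` verts Q a S)" using cell_cover[OF t] by blast
    have "(a, S, t) \<in> idx ?K" "ctop (a, S, t) = t" using c by (auto simp: ctop_def)
    moreover have "x \<in> conehull (realize Q (a, S, t) ` mon ?K (a, S, t))"
      using c conehull_realize[of "(a, S, t)"] by (simp add: ctop_def cverts_def)
    ultimately show "x \<in> (\<Union>c\<in>{c\<in>idx ?K. ctop c = t}. conehull (realize Q c ` mon ?K c))" by blast
  qed
  show "relint (conehull (realize Q c ` mon ?K c)) \<inter> relint (conehull (realize Q c' ` mon ?K c')) = {}"
    if t: "t \<in> idx Q" and c: "c \<in> {c\<in>idx ?K. ctop c = t}" and c': "c' \<in> {c\<in>idx ?K. ctop c = t}" and ne: "c \<noteq> c'"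
    for t c c'
  proof (rule ccontr)
    assume "relint (conehull (realize Q c ` mon ?K c)) \<inter> relint (conehull (realize Q c' ` mon ?K c')) \<noteq> {}"
    then obtain x where x: "x \<in> relint (conehull (vec Q t ` cverts Q c))" "x \<in> relint (conehull (vec Q t ` cverts Q c'))"
      using conehull_realize c c' by auto
    \<comment> \<open>A relative interior point has positive coefficients at all vertices of both
      cells, as \<open>cell_unique\<close> requires.\<close>
    obtain p where p: "\<forall>v\<in>cverts Q c. 0 < p v" "x = (\<lambda>i. \<Sum>v\<in>cverts Q c. (p v :: real) * of_int (vec Q t v i))"
      using relint_positive[OF _ x(1)] cverts_cell(1) c by blast
    obtain p' where p': "\<forall>v\<in>cverts Q c'. 0 < p' v" "x = (\<lambda>i. \<Sum>v\<in>cverts Q c'. (p' v :: real) * of_int (vec Q t v i))"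
      using relint_positive[OF _ x(2)] cverts_cell(1) c' by blast
    have cell: "cell Q (fst c) (fst (snd c)) t" "cell Q (fst c') (fst (snd c')) t"
      using c c' by (auto simp: subdivision_idx)
    have "fst c = fst c' \<and> fst (snd c) = fst (snd c')"
      by (rule cell_unique[OF cell(1) le_refl[OF t] t cell(2) le_refl[OF t], where p = p and p' = p'])
        (use p p' in \<open>auto simp: cverts_def\<close>)
    then show False using ne c c' by (auto simp: prod_eq_iff ctop_def)
  qed
qed

lemma smooth_cell:
  assumes "smooth_complex Q"
  shows "cell Q a S t \<longleftrightarrow> a \<in> idx Q \<and> S = {} \<and> t = a"
proof -
  have sim: "simplicial Q b" if "b \<in> idx Q" for b
    using smooth_simplicial[OF that] assms that unfolding smooth_complex_def by blast
  show ?thesis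
  proof
    assume c: "cell Q a S t"
    have "S = {}" using cell_idx(6,7)[OF c] sim by blast
    then show "a \<in> idx Q \<and> S = {} \<and> t = a" using cell_idx(1,10)[OF c] by blast
  next
    assume "a \<in> idx Q \<and> S = {} \<and> t = a"
    then show "cell Q a S t" using cell.base[of a Q] sim[of a] by simp
  qed
qed

lemma subdivision_iso:
  assumes smooth: "smooth_complex Q"
  shows "complex_iso (subdivision Q) Q ctop (realize Q)"
  unfolding complex_iso_def
proof (intro conjI ballI impI)
  let ?K = "subdivision Q"
  have idx: "c \<in> idx ?K \<longleftrightarrow> (\<exists>a\<in>idx Q. c = (a, {}, a))" for c
    by (cases c) (auto simp: smooth_cell[OF smooth])
  show "morphism ?K Q ctop (realize Q)" by (rule subdivision_morphism)
  show "bij_betw ctop (idx ?K) (idx Q)"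
    by (rule bij_betw_byWitness[where f' = "\<lambda>a. (a, {}, a)"]) (auto simp: idx ctop_def)
  show "le ?K c c'" if "c \<in> idx ?K" "c' \<in> idx ?K" "le Q (ctop c) (ctop c')" for c c'
    using that by (auto simp: idx ctop_def)
  show "bij_betw (realize Q c) (mon ?K c) (mon Q (ctop c))" if c: "c \<in> idx ?K" for c
    unfolding bij_betw_def
  proof (intro conjI equalityI)
    show "inj_on (realize Q c) (mon ?K c)" using realize_inj[OF c] .
    show "realize Q c ` mon ?K c \<subseteq> mon Q (ctop c)" using realize_mhom[OF c] unfolding mhom_def by blast
    show "mon Q (ctop c) \<subseteq> realize Q c ` mon ?K c"
    proof
      fix v assume v: "v \<in> mon Q (ctop c)"
      obtain a where a: "a \<in> idx Q" "c = (a, {}, a)" using c idx by blast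
      have V: "cverts Q c = rays Q a" "ctop c = a" using a(2) by (auto simp: cverts_def ctop_def)
      \<comment> \<open>Smoothness presents \<open>v\<close> on the rays with natural coefficients;
        these are the coordinates of its preimage.\<close>
      obtain n :: "'a \<Rightarrow> nat" where n: "v = (\<lambda>i. \<Sum>r\<in>rays Q a. int (n r) * vec Q a r i)"
        using smooth_span[OF a(1)] smooth v a(1) V(2) unfolding smooth_complex_def by metis
      obtain x where x: "x \<in> orth (card (rays Q a))" "\<And>r. r \<in> rays Q a \<Longrightarrow> x (pos (rays Q a) r) = int (n r)"
        using orth_build[OF finite_rays[of a], of "\<lambda>r. int (n r)"] by auto
      have "realize Q c x = v"
        unfolding realize_def V combine_def n using x(2) by (intro ext sum.cong) auto
      then show "v \<in> realize Q c ` mon ?K c" using x(1) V by auto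
    qed
  qed
qed

end

section \<open>Restriction to subcomplexes\<close>

definition down_closed :: "'a mcomplex \<Rightarrow> 'a set \<Rightarrow> bool" where
  "down_closed Q B \<longleftrightarrow> B \<subseteq> idx Q \<and> (\<forall>b\<in>B. \<forall>a\<in>idx Q. le Q a b \<longrightarrow> a \<in> B)"

lemma restr_simps [simp]:
  "idx (restr Q B) = B" "le (restr Q B) = le Q" "mon (restr Q B) = mon Q" "fmap (restr Q B) = fmap Q"
  by (simp_all add: restr_def)

text \<open>An index below \<open>b\<close> gives a face of \<open>mon Q b\<close>. Completeness of
  the restriction provides an index in \<open>B\<close> with the same image, and reducedness of the
  whole complex makes the two equal. Conversely, a down-closed set keeps the indices of all
  faces.\<close>

lemma subcomplex_iff_down_closed:
  assumes Q: "monoidal_complex Q"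
  shows "subcomplex Q B \<longleftrightarrow> down_closed Q B"
proof
  interpret complete_complex Q using Q by unfold_locales
  assume B: "subcomplex Q B"
  then have sub: "B \<subseteq> idx Q" and mc: "monoidal_complex (restr Q B)" by (auto simp: subcomplex_def)
  have "a \<in> B" if a: "b \<in> B" "a \<in> idx Q" "le Q a b" for a b
  proof -
    have "mface (im b a) (mon (restr Q B) b)" using im_face a sub by auto
    then obtain a' where a': "a' \<in> B" "le Q a' b" "im b a' = im b a"
      using complete_complex.face_ex1[of "restr Q B" b "im b a"] mc a(1) by (auto simp: complete_complex_def)
    then have "a' = a" using face_index_unique[of a' a b] a sub by blast
    then show ?thesis using a' by simp
  qed
  then show "down_closed Q B" using sub by (auto simp: down_closed_def)
next
  interpret complete_complex Q using Q by unfold_locales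
  assume B: "down_closed Q B"
  then have sub: "B \<subseteq> idx Q" and dc: "\<And>a b. b \<in> B \<Longrightarrow> a \<in> idx Q \<Longrightarrow> le Q a b \<Longrightarrow> a \<in> B"
    by (auto simp: down_closed_def)
  have "monoidal_complex (restr Q B)"
    unfolding monoidal_complex_def restr_simps
  proof (intro conjI ballI impI allI)
    show "finite B" using finite_subset[OF sub finite_idx] .
    show "\<exists>!a. a \<in> B \<and> le Q a b \<and> fmap Q a b ` mon Q a = \<tau>" if "b \<in> B" "mface \<tau> (mon Q b)" for b \<tau>
      using face_ex1[of b \<tau>] that sub dc by (metis subsetD)
    show "le Q a c" if "a \<in> B" "b \<in> B" "c \<in> B" "le Q a b \<and> le Q b c" for a b c
      using le_trans that sub by blast
    show "fmap Q b c (fmap Q a b x) = fmap Q a c x"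
      if "a \<in> B" "b \<in> B" "c \<in> B" "le Q a b \<and> le Q b c" "x \<in> mon Q a" for a b c x
      using fmap_comp that sub by blast
  qed (use sub le_refl le_antisym toric face_emb fmap_id in blast)+
  then show "subcomplex Q B" using sub by (simp add: subcomplex_def)
qed

lemma rays_restr:
  assumes "down_closed Q B" "a \<in> B"
  shows "rays (restr Q B) a = rays Q a"
  using assms by (auto simp: rays_def down_closed_def)

lemma vec_restr: "vec (restr Q B) = vec Q"
  by (intro ext) (simp add: vec_def)

lemma simplicial_restr:
  "down_closed Q B \<Longrightarrow> a \<in> B \<Longrightarrow> simplicial (restr Q B) a \<longleftrightarrow> simplicial Q a"
  by (simp add: simplicial_def rays_restr vec_restr)

text \<open>All indices involved in a cell lie below its top, so only the top has to be tested for
  membership in \<open>B\<close>.\<close>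

lemma cell_restr:
  assumes B: "down_closed Q B"
  shows "cell (restr Q B) a S t \<longleftrightarrow> cell Q a S t \<and> t \<in> B"
proof
  assume "cell (restr Q B) a S t"
  then show "cell Q a S t \<and> t \<in> B"
  proof induction
    case (base a)
    then show ?case using B cell.base[of a Q] simplicial_restr[OF B] by (auto simp: down_closed_def)
  next
    case (step a S b c)
    then show ?case using B cell.step[of Q a S b c] simplicial_restr[OF B] by (auto simp: down_closed_def)
  qed
next
  assume "cell Q a S t \<and> t \<in> B"
  then have "cell Q a S t" "t \<in> B" by auto
  then show "cell (restr Q B) a S t"
  proof induction
    case (base a)
    then show ?case using cell.base[of a "restr Q B"] simplicial_restr[OF B] by auto
  next
    case (step a S b c)
    have "b \<in> idx Q" using step(1) by cases auto
    then have "b \<in> B" using B step by (auto simp: down_closed_def)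
    then show ?case using step cell.step[of "restr Q B" a S b c] simplicial_restr[OF B] by auto
  qed
qed

text \<open>The agreement is literal: centres are chosen from the monoid alone and numberings from
  the vertex set alone, and neither changes under restriction.\<close>

lemma subdivision_restr:
  assumes Q: "monoidal_complex Q" and B: "down_closed Q B"
  shows "idx (subdivision (restr Q B)) = {c \<in> idx (subdivision Q). ctop c \<in> B}"
    and "c \<in> idx (subdivision (restr Q B)) \<Longrightarrow> cverts (restr Q B) c = cverts Q c"
    and "c \<in> idx (subdivision (restr Q B)) \<Longrightarrow> realize (restr Q B) c = realize Q c"
proof -
  interpret complete_complex Q using Q by unfold_locales
  show idx: "idx (subdivision (restr Q B)) = {c \<in> idx (subdivision Q). ctop c \<in> B}"
    by (auto simp: subdivision_idx cell_restr[OF B])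
  show v: "cverts (restr Q B) c = cverts Q c" if "c \<in> idx (subdivision (restr Q B))" for c
  proof -
    have c: "cell Q (fst c) (fst (snd c)) (ctop c)" "ctop c \<in> B" using that by (auto simp: idx subdivision_idx)
    then have "fst c \<in> B" using B cell_idx(1,4) by (auto simp: down_closed_def)
    then show ?thesis by (simp add: cverts_def rays_restr[OF B])
  qed
  show "realize (restr Q B) c = realize Q c" if "c \<in> idx (subdivision (restr Q B))"
    using v[OF that] by (simp add: realize_def vec_restr)
qed

section \<open>Renaming cells by natural numbers\<close>

definition reindex :: "('b \<Rightarrow> 'c) \<Rightarrow> 'b set \<Rightarrow> 'c mcomplex \<Rightarrow> 'b mcomplex" where
  "reindex g I K = \<lparr>idx = I, le = (\<lambda>i j. le K (g i) (g j)), mon = (\<lambda>i. mon K (g i)),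
     fmap = (\<lambda>i j. fmap K (g i) (g j))\<rparr>"

lemma reindex_simps [simp]:
  "idx (reindex g I K) = I" "le (reindex g I K) i j = le K (g i) (g j)"
  "mon (reindex g I K) i = mon K (g i)" "fmap (reindex g I K) i j = fmap K (g i) (g j)"
  by (simp_all add: reindex_def)

lemma reindex_complex:
  assumes g: "bij_betw g I (idx K)" and K: "monoidal_complex K"
  shows "monoidal_complex (reindex g I K)"
proof -
  interpret complete_complex K using K by unfold_locales
  have mem: "g i \<in> idx K" if "i \<in> I" for i using g that bij_betwE by blast
  have inj: "i = j" if "i \<in> I" "j \<in> I" "g i = g j" for i j
    using g that by (auto simp: bij_betw_def dest: inj_onD)
  show ?thesis
    unfolding monoidal_complex_def reindex_simps
  proof (intro conjI ballI impI allI)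
    show "finite I" using finite_idx bij_betw_finite[OF g] by blast
    show "i = j" if "i \<in> I" "j \<in> I" "le K (g i) (g j) \<and> le K (g j) (g i)" for i j
      using inj le_antisym mem that by blast
    show "le K (g i) (g k)" if "i \<in> I" "j \<in> I" "k \<in> I" "le K (g i) (g j) \<and> le K (g j) (g k)" for i j k
      using le_trans mem that by blast
    show "fmap K (g j) (g k) (fmap K (g i) (g j) x) = fmap K (g i) (g k) x"
      if "i \<in> I" "j \<in> I" "k \<in> I" "le K (g i) (g j) \<and> le K (g j) (g k)" "x \<in> mon K (g i)" for i j k x
      using fmap_comp mem that by blast
    show "\<exists>!i. i \<in> I \<and> le K (g i) (g j) \<and> fmap K (g i) (g j) ` mon K (g i) = \<tau>"
      if j: "j \<in> I" "mface \<tau> (mon K (g j))" for j \<tau>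
    proof -
      obtain a where a: "a \<in> idx K" "le K a (g j)" "fmap K a (g j) ` mon K a = \<tau>"
        by (rule ex1E[OF face_ex1[OF mem[OF j(1)] j(2)]]) (elim conjE, rule that)
      obtain i where i: "i \<in> I" "g i = a" using a(1) bij_betw_imp_surj_on[OF g] by (metis imageE)
      show ?thesis
      proof (rule ex1I[of _ i])
        show "i \<in> I \<and> le K (g i) (g j) \<and> fmap K (g i) (g j) ` mon K (g i) = \<tau>" using a i by simp
        fix i' assume i': "i' \<in> I \<and> le K (g i') (g j) \<and> fmap K (g i') (g j) ` mon K (g i') = \<tau>"
        then have "g i' = a" using face_index_unique[of "g i'" a "g j"] mem j(1) a by blast
        then show "i' = i" using i i' inj by blast
      qed
    qed
  qed (use mem le_refl toric face_emb fmap_id in blast)+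
qed

lemma reindex_morphism:
  assumes g: "bij_betw g I (idx K)" and m: "morphism K Q f fm"
  shows "morphism (reindex g I K) Q (\<lambda>i. f (g i)) (\<lambda>i. fm (g i))"
proof -
  have mem: "g i \<in> idx K" if "i \<in> I" for i using g that bij_betwE by blast
  show ?thesis using m mem unfolding morphism_def by simp
qed

lemma reindex_refinement:
  assumes g: "bij_betw g I (idx K)" and r: "refinement K Q f fm"
  shows "refinement (reindex g I K) Q (\<lambda>i. f (g i)) (\<lambda>i. fm (g i))"
proof -
  have mem: "g i \<in> idx K" if "i \<in> I" for i using g that bij_betwE by blast
  have inj: "i = j" if "i \<in> I" "j \<in> I" "g i = g j" for i j
    using g that by (auto simp: bij_betw_def dest: inj_onD)
  have im: "g ` {i\<in>I. f (g i) = b} = {a\<in>idx K. f a = b}" for b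
    using g unfolding bij_betw_def by auto
  have un: "(\<Union>i\<in>{i\<in>I. f (g i) = b}. conehull (fm (g i) ` mon K (g i))) =
      (\<Union>a\<in>{a\<in>idx K. f a = b}. conehull (fm a ` mon K a))" for b
    unfolding im[symmetric] by (simp add: image_image)
  show ?thesis
    unfolding refinement_def reindex_simps un
  proof (intro conjI ballI impI)
    show "morphism (reindex g I K) Q (\<lambda>i. f (g i)) (\<lambda>i. fm (g i))"
      by (rule reindex_morphism[OF g]) (use r in \<open>simp add: refinement_def\<close>)
    show "inj_on (fm (g i)) (mon K (g i))" if "i \<in> I" for i
      using r mem[OF that] by (simp add: refinement_def)
    show "(\<Union>a\<in>{a\<in>idx K. f a = b}. conehull (fm a ` mon K a)) = supp (mon Q b)" if "b \<in> idx Q" for b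
      using r that by (simp add: refinement_def)
    show "relint (conehull (fm (g i) ` mon K (g i))) \<inter> relint (conehull (fm (g j) ` mon K (g j))) = {}"
      if "b \<in> idx Q" "i \<in> {i\<in>I. f (g i) = b}" "j \<in> {i\<in>I. f (g i) = b}" "i \<noteq> j" for b i j
    proof -
      have "g i \<noteq> g j" using inj that by blast
      then show ?thesis using r that mem by (simp add: refinement_def)
    qed
  qed
qed

lemma reindex_iso:
  assumes g: "bij_betw g I (idx K)" and iso: "complex_iso K Q f fm"
  shows "complex_iso (reindex g I K) Q (\<lambda>i. f (g i)) (\<lambda>i. fm (g i))"
proof -
  have mem: "g i \<in> idx K" if "i \<in> I" for i using g that bij_betwE by blast
  have "bij_betw (\<lambda>i. f (g i)) I (idx Q)"
    using bij_betw_trans[OF g, of f "idx Q"] iso by (simp add: complex_iso_def comp_def)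
  moreover have "morphism (reindex g I K) Q (\<lambda>i. f (g i)) (\<lambda>i. fm (g i))"
    by (rule reindex_morphism[OF g]) (use iso in \<open>simp add: complex_iso_def\<close>)
  ultimately show ?thesis
    using iso mem unfolding complex_iso_def by simp
qed

text \<open>The code depends on the whole finite set, so a complex and its restriction number their
  common cells independently; comparing them needs a translation of codes.\<close>

definition encode :: "'b set \<Rightarrow> 'b \<Rightarrow> nat" where
  "encode X = (SOME f. inj_on f X)"

definition decode :: "'b set \<Rightarrow> nat \<Rightarrow> 'b" where
  "decode X = inv_into X (encode X)"

lemma encode_inj: "finite X \<Longrightarrow> inj_on (encode X) X"
  unfolding encode_def using finite_imp_inj_to_nat_seg[of X] by (metis (mono_tags) someI_ex)

lemma decode_bij: "finite X \<Longrightarrow> bij_betw (decode X) (encode X ` X) X"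
  unfolding decode_def by (intro bij_betw_inv_into inj_on_imp_bij_betw encode_inj)

lemma decode_encode: "finite X \<Longrightarrow> x \<in> X \<Longrightarrow> decode X (encode X x) = x"
  unfolding decode_def using encode_inj by (rule inv_into_f_f)

definition nat_subdivision :: "'a mcomplex \<Rightarrow> nat mcomplex" where
  "nat_subdivision Q = (let X = idx (subdivision Q) in reindex (decode X) (encode X ` X) (subdivision Q))"

abbreviation nat_top :: "'a mcomplex \<Rightarrow> nat \<Rightarrow> 'a" where
  "nat_top Q i \<equiv> ctop (decode (idx (subdivision Q)) i)"

abbreviation nat_realize :: "'a mcomplex \<Rightarrow> nat \<Rightarrow> zv \<Rightarrow> zv" where
  "nat_realize Q i \<equiv> realize Q (decode (idx (subdivision Q)) i)"

text \<open>The translation \<open>\<psi>\<close> decodes in the subcomplex and encodes again in the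
  whole. Both codes then name the same cell, so the monoid components of the isomorphism can be
  identities.\<close>

lemma nat_subdivision_restr:
  assumes Q: "monoidal_complex Q" and A: "subcomplex Q A0"
  defines "R \<equiv> nat_subdivision Q" and "R0 \<equiv> nat_subdivision (restr Q A0)"
  shows "subcomplex R {a\<in>idx R. nat_top Q a \<in> A0} \<and>
    (\<exists>\<psi> \<psi>m. complex_iso R0 (restr R {a\<in>idx R. nat_top Q a \<in> A0}) \<psi> \<psi>m \<and>
       (\<forall>c\<in>idx R0. nat_top Q (\<psi> c) = nat_top (restr Q A0) c \<and>
          (\<forall>x\<in>mon R0 c. nat_realize Q (\<psi> c) (\<psi>m c x) = nat_realize (restr Q A0) c x)))"
proof -
  interpret complete_complex Q using Q by unfold_locales
  let ?K = "subdivision Q" and ?K' = "subdivision (restr Q A0)"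
  let ?X = "idx ?K" and ?X' = "idx ?K'"
  let ?g = "decode ?X" and ?g' = "decode ?X'"
  let ?B = "{a\<in>idx R. nat_top Q a \<in> A0}"
  have dc: "down_closed Q A0" using A subcomplex_iff_down_closed[OF Q] by simp
  have fin: "finite ?X" using subdivision_complex by (simp add: monoidal_complex_def)
  note sr = subdivision_restr[OF Q dc]
  have sub: "?X' \<subseteq> ?X" using sr(1) by blast
  have fin0: "finite ?X'" using finite_subset[OF sub fin] .
  have R: "R = reindex ?g (encode ?X ` ?X) ?K" and R0: "R0 = reindex ?g' (encode ?X' ` ?X') ?K'"
    by (simp_all add: R_def R0_def nat_subdivision_def Let_def)
  have RC: "monoidal_complex R" unfolding R by (rule reindex_complex[OF decode_bij[OF fin] subdivision_complex])
  have g: "?g i \<in> ?X" if "i \<in> encode ?X ` ?X" for i using decode_bij[OF fin] that bij_betwE by blast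
  have g0: "?g' i \<in> ?X'" if "i \<in> encode ?X' ` ?X'" for i using decode_bij[OF fin0] that bij_betwE by blast
  \<comment> \<open>Tops are monotone, so the preimage of a down-closed set is down-closed.\<close>
  have "down_closed R ?B"
    unfolding down_closed_def
  proof (intro conjI ballI impI)
    show "?B \<subseteq> idx R" by blast
    fix b a assume b: "b \<in> ?B" and a: "a \<in> idx R" "le R a b"
    have "le Q (nat_top Q a) (nat_top Q b)" using ctop_mono[OF g g] a b by (simp add: R)
    then show "a \<in> ?B" using dc a b cverts_cell(4)[OF g] by (auto simp: down_closed_def R)
  qed
  then have "subcomplex R ?B" using subcomplex_iff_down_closed[OF RC] by simp
  moreover define \<psi> where "\<psi> i = encode ?X (?g' i)" for i
  have g\<psi>: "?g (\<psi> i) = ?g' i" if "i \<in> idx R0" for i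
  proof -
    have "?g' i \<in> ?X" using g0[of i] that sub by (auto simp only: R0 reindex_simps)
    then show ?thesis unfolding \<psi>_def by (rule decode_encode[OF fin])
  qed
  have BX: "?B = encode ?X ` ?X'"
    unfolding sr(1) by (auto simp: R decode_encode[OF fin])
  have "bij_betw (encode ?X) ?X' ?B"
    unfolding BX using inj_on_subset[OF encode_inj[OF fin] sub] by (rule inj_on_imp_bij_betw)
  then have \<psi>bij: "bij_betw \<psi> (idx R0) ?B"
    using bij_betw_trans[OF decode_bij[OF fin0]] by (simp add: R0 \<psi>_def[abs_def] comp_def)
  have verts: "cverts (restr Q A0) (?g' i) = cverts Q (?g' i)" if "i \<in> idx R0" for i
    using sr(2) g0 that by (simp add: R0)
  have mon: "mon R (\<psi> i) = mon R0 i" if "i \<in> idx R0" for i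
    using g\<psi>[OF that] verts[OF that] by (simp add: R R0)
  have le: "le R (\<psi> i) (\<psi> j) \<longleftrightarrow> le R0 i j" if "i \<in> idx R0" "j \<in> idx R0" for i j
    using g\<psi>[OF that(1)] g\<psi>[OF that(2)] by (simp add: R R0)
  have fmap: "fmap R (\<psi> i) (\<psi> j) = fmap R0 i j" if "i \<in> idx R0" "j \<in> idx R0" for i j
    using g\<psi>[OF that(1)] g\<psi>[OF that(2)] verts[OF that(1)] verts[OF that(2)] by (simp add: R R0)
  have "complex_iso R0 (restr R ?B) \<psi> (\<lambda>_ x. x)"
    unfolding complex_iso_def morphism_def restr_simps
  proof (intro conjI ballI impI)
    show "\<psi> i \<in> ?B" if "i \<in> idx R0" for i using \<psi>bij that bij_betwE by blast
    show "bij_betw \<psi> (idx R0) ?B" by (rule \<psi>bij)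
    show "mhom (\<lambda>x. x) (mon R0 i) (mon R (\<psi> i))" if "i \<in> idx R0" for i using mon[OF that] by (simp add: mhom_def)
    show "bij_betw (\<lambda>x. x) (mon R0 i) (mon R (\<psi> i))" if "i \<in> idx R0" for i
      using mon[OF that] by (simp add: bij_betw_def)
  qed (use le fmap in auto)
  moreover have "nat_top Q (\<psi> i) = nat_top (restr Q A0) i" if "i \<in> idx R0" for i using g\<psi>[OF that] by simp
  moreover have "nat_realize Q (\<psi> i) x = nat_realize (restr Q A0) i x" if "i \<in> idx R0" for i x
    using g\<psi>[OF that] sr(3)[OF g0] that by (simp add: R0)
  ultimately show ?thesis by blast
qed

text \<open>With natural numbers as indices, equality of complexes is rendered by isomorphism: over
  a smooth complex the refinement map itself is one, and for a subcomplex the isomorphism commutes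
  with both refinement maps.\<close>

theorem theorem4p5:
  "\<exists>ns :: 'a mcomplex \<Rightarrow> nat mcomplex \<times> (nat \<Rightarrow> 'a) \<times> (nat \<Rightarrow> zv \<Rightarrow> zv).
     \<forall>Q. monoidal_complex Q \<longrightarrow>
       (case ns Q of (R, f, fm) \<Rightarrow>
          monoidal_complex R \<and> smooth_complex R \<and> refinement R Q f fm \<and>
          (smooth_complex Q \<longrightarrow> complex_iso R Q f fm) \<and>
          (\<forall>A0. subcomplex Q A0 \<longrightarrow>
             (case ns (restr Q A0) of (R0, f0, fm0) \<Rightarrow>
                subcomplex R {a \<in> idx R. f a \<in> A0} \<and>
                (\<exists>\<psi> \<psi>m. complex_iso R0 (restr R {a \<in> idx R. f a \<in> A0}) \<psi> \<psi>m \<and>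
                   (\<forall>c\<in>idx R0. f (\<psi> c) = f0 c \<and>
                      (\<forall>x\<in>mon R0 c. fm (\<psi> c) (\<psi>m c x) = fm0 c x))))))"
proof (rule exI[of _ "\<lambda>Q. (nat_subdivision Q, nat_top Q, nat_realize Q)"], intro allI impI)
  fix Q :: "'a mcomplex"
  assume Q: "monoidal_complex Q"
  interpret complete_complex Q using Q by unfold_locales
  let ?X = "idx (subdivision Q)"
  have "finite ?X" using subdivision_complex by (simp add: monoidal_complex_def)
  note bij = decode_bij[OF this]
  have R: "nat_subdivision Q = reindex (decode ?X) (encode ?X ` ?X) (subdivision Q)"
    by (simp add: nat_subdivision_def Let_def)
  have "monoidal_complex (nat_subdivision Q)"
    unfolding R by (rule reindex_complex[OF bij subdivision_complex])
  moreover have "smooth_complex (nat_subdivision Q)"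
    by (simp add: R smooth_complex_def orth_smooth)
  moreover have "refinement (nat_subdivision Q) Q (nat_top Q) (nat_realize Q)"
    unfolding R by (rule reindex_refinement[OF bij subdivision_refinement])
  moreover have "complex_iso (nat_subdivision Q) Q (nat_top Q) (nat_realize Q)" if "smooth_complex Q"
    unfolding R by (rule reindex_iso[OF bij subdivision_iso[OF that]])
  ultimately show "case (nat_subdivision Q, nat_top Q, nat_realize Q) of (R, f, fm) \<Rightarrow>
          monoidal_complex R \<and> smooth_complex R \<and> refinement R Q f fm \<and>
          (smooth_complex Q \<longrightarrow> complex_iso R Q f fm) \<and>
          (\<forall>A0. subcomplex Q A0 \<longrightarrow>
             (case (nat_subdivision (restr Q A0), nat_top (restr Q A0), nat_realize (restr Q A0)) of (R0, f0, fm0) \<Rightarrow>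
                subcomplex R {a \<in> idx R. f a \<in> A0} \<and>
                (\<exists>\<psi> \<psi>m. complex_iso R0 (restr R {a \<in> idx R. f a \<in> A0}) \<psi> \<psi>m \<and>
                   (\<forall>c\<in>idx R0. f (\<psi> c) = f0 c \<and>
                      (\<forall>x\<in>mon R0 c. fm (\<psi> c) (\<psi>m c x) = fm0 c x)))))"
    using nat_subdivision_restr[OF Q] by simp
qed

end
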